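(* There is a function $f\colon \mathbb{N}\to\mathbb{N}$ such that for all $t,\ell\in\mathbb{N}$, every $C_{\geq t}$-free graph that does not contain $K_{\ell,\ell}$ as a (not necessarily induced) subgraph has degeneracy at most $\ell^{f(t)}$.
   Context: All graphs are finite, simple and undirected; $\mathbb{N}$ denotes the positive integers. A graph is $C_{\geq t}$-free if it contains no induced cycle with at least $t$ vertices. $K_{\ell,\ell}$ is the complete bipartite graph with $\ell$ vertices on each side. A graph is $d$-degenerate if every (nonempty) induced subgraph contains a vertex of degree at most $d$ in that subgraph; the degeneracy of $G$ is the minimum $d\geq 0$ for which $G$ is $d$-degenerate. *)

theory Defs
  imports "Graph_Theory.Graph_Theory"
begin

text \<open>
  Finite simple undirected graphs are the \<^locale>\<open>graph\<close>s of the library, i.e. finite loop-free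
  symmetric digraphs without parallel arcs. An edge \<open>{u, v}\<close> is a pair of opposite arcs, so the
  degree of a vertex is its \<^const>\<open>out_degree\<close>.
\<close>

text \<open>
  The cycle on \<open>n\<close> vertices as a graph. The library's \<^const>\<open>pre_digraph.cycle\<close> describes closed
  walks instead, and in a symmetric digraph already \<open>a, b, a\<close> is such a cycle; hence \<open>3 \<le> n\<close>.
\<close>

definition cycle_graph :: "nat \<Rightarrow> ('a, 'b) pre_digraph \<Rightarrow> bool" where
  "cycle_graph n H \<longleftrightarrow> graph H \<and> 3 \<le> n \<and>
    (\<exists>c. bij_betw c {..<n} (verts H) \<and>
         arcs_ends H = (\<Union>i<n. {(c i, c (Suc i mod n)), (c (Suc i mod n), c i)}))"

definition long_cycle_free :: "nat \<Rightarrow> ('a, 'b) pre_digraph \<Rightarrow> bool" where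
  "long_cycle_free t G \<longleftrightarrow> \<not> (\<exists>H n. induced_subgraph H G \<and> cycle_graph n H \<and> t \<le> n)"

definition degenerate :: "nat \<Rightarrow> ('a, 'b) pre_digraph \<Rightarrow> bool" where
  "degenerate d G \<longleftrightarrow>
    (\<forall>H. induced_subgraph H G \<and> verts H \<noteq> {} \<longrightarrow> (\<exists>v\<in>verts H. out_degree H v \<le> d))"

definition degeneracy :: "('a, 'b) pre_digraph \<Rightarrow> nat" where
  "degeneracy G = (LEAST d. degenerate d G)"

text \<open>The minimum exists for every finite graph.\<close>

lemma degeneracy_le_iff:
  assumes "fin_digraph G"
  shows "degeneracy G \<le> d \<longleftrightarrow> degenerate d G"
proof
  have "degenerate (card (arcs G)) G"
    unfolding degenerate_def
  proof (intro allI impI, elim conjE)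
    fix H assume H: "induced_subgraph H G" "verts H \<noteq> {}"
    then obtain v where "v \<in> verts H" by blast
    moreover have "out_arcs H v \<subseteq> arcs G"
      using H by (auto simp: out_arcs_def)
    then have "out_degree H v \<le> card (arcs G)"
      unfolding out_degree_def using assms fin_digraph.finite_arcs card_mono by blast
    ultimately show "\<exists>v\<in>verts H. out_degree H v \<le> card (arcs G)" by blast
  qed
  then have least: "degenerate (degeneracy G) G"
    unfolding degeneracy_def by (rule LeastI)
  show "degenerate d G" if "degeneracy G \<le> d"
    using least that unfolding degenerate_def by (meson order_trans)
  show "degeneracy G \<le> d" if "degenerate d G"
    using that unfolding degeneracy_def by (rule Least_le)
qed

end

theory Submission
  imports Defs Complex_Main "HOL-Library.FuncSet"
begin

text \<open>
  Suppose that a subgraph has minimum degree \<open>d = l\<^bsup>c\<^esup>\<close>, but that there is neither \<open>K\<^bsub>l,l\<^esub>\<close> nor a hole of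
  length at least \<open>t\<close>. The absence of \<open>K\<^bsub>l,l\<^esub>\<close> means that fewer than \<open>l\<close> vertices see almost all
  of a large set, so avoiding the neighbourhoods of boundedly many vertices costs factors polynomial
  in \<open>l\<close>. With dependent random choice this yields a long hole in every pair of large sets whose
  density is at least the inverse of a fixed power of \<open>l\<close> (a dense pair).

  Pass to a subgraph that is critical for the average degree. If many edges join vertices of degree
  less than \<open>d\<^sup>4\<close> to vertices of larger degree, then there is a large independent set \<open>A\<close> whose
  vertices have about \<open>d\<close> neighbours in a much smaller set \<open>B\<close>. Either the vertices at distance two
  from some \<open>b \<in> B\<close> are so few that they form a dense pair with the neighbourhood of \<open>b\<close>, or a random
  independent subset of \<open>B\<close> contains a long cycle of pairs joined by private vertices of \<open>A\<close>, which
  is a hole.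

  Otherwise pigeonholing on degrees gives a nearly regular piece. Take its breadth-first layering, let
  \<open>S\<close> be two consecutive layers that span many edges, and \<open>R\<close> the layer before them. Build an induced
  path from \<open>R\<close> through \<open>t\<close> vertices of \<open>S\<close>, keeping a dense connected part of \<open>S\<close> attached to its end
  and anticomplete to the rest of it. Every vertex of \<open>R\<close> that sees this part must see the path, since
  the path closes up to a long hole otherwise. Repeating this gives a dense pair between \<open>R\<close> and the
  union of the paths.
\<close>

text \<open>Minimum degree gives no upper bound on degrees, and this shapes the proof: growing an
  induced path deletes whole neighbourhoods, which is affordable only if no neighbourhood carries a
  large share of the edges. The threshold \<open>d ^ 4\<close> is high enough to make the vertices
  above it very rare, so that many edges to them mean an unbalanced pair, and low enough for the
  degrees below it to span a polynomial range. As \<open>d = s ^ N\<close> with \<open>N\<close>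
  depending on \<open>t\<close> alone, this range has boundedly many classes of ratio
  \<open>s\<close>. Every later loss is a fixed power of \<open>s\<close> that \<open>d\<close>
  outweighs, and \<open>s\<close> is a power of \<open>l\<close> that absorbs all constants in
  \<open>t\<close>. The two classes that survive may still have very different degrees, so sets are
  measured by weights of the order of the degrees; then deleting a neighbourhood costs about the
  product of the two degree scales, on whichever side the vertex lies. A piece so light that one
  deletion would matter is itself a dense pair and thus already excluded.\<close>

definition ind_cycle :: "('a \<Rightarrow> 'a \<Rightarrow> bool) \<Rightarrow> (nat \<Rightarrow> 'a) \<Rightarrow> nat \<Rightarrow> bool" where
  "ind_cycle E c n \<longleftrightarrow> 3 \<le> n \<and> inj_on c {..<n} \<and>
    (\<forall>i<n. \<forall>j<n. E (c i) (c j) \<longleftrightarrow> j = Suc i mod n \<or> i = Suc j mod n)"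

lemma Suc_mod_eq: "i < n \<Longrightarrow> Suc i mod n = (if Suc i = n then 0 else Suc i)"
  by auto

text \<open>Reading \<open>x 0\<close>, \<open>y 0\<close>, \<open>x 1\<close>, \<open>y 1\<close>,
  ... around the circle gives the hole: \<open>y j\<close> links \<open>x j\<close> to its cyclic
  successor. Both counting arguments for holes end with this pattern, the \<open>x i\<close> being
  independent hubs and the \<open>y j\<close> independent private links between consecutive
  hubs.\<close>

lemma subdivided_ind_cycle:
  assumes k: "2 \<le> k"
    and sym: "\<And>u v. E u v \<Longrightarrow> E v u"
    and ix: "inj_on x {..<k}" and iy: "inj_on y {..<k}"
    and xy: "\<And>i j. i < k \<Longrightarrow> j < k \<Longrightarrow> E (x i) (y j) \<longleftrightarrow> i = j \<or> i = Suc j mod k"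
    and xx: "\<And>i j. i < k \<Longrightarrow> j < k \<Longrightarrow> \<not> E (x i) (x j)"
    and yy: "\<And>i j. i < k \<Longrightarrow> j < k \<Longrightarrow> \<not> E (y i) (y j)"
  shows "\<exists>c. ind_cycle E c (2 * k)"
proof -
  define c where "c n = (if even n then x (n div 2) else y (n div 2))" for n
  have ne: "x i \<noteq> y j" if "i < k" "j < k" for i j
  proof
    assume "x i = y j"
    then have "\<not> E (x j) (y j)" using xx[OF that(2,1)] by simp
    then show False using xy[OF that(2,2)] by simp
  qed
  have "inj_on c {..<2*k}"
  proof (rule inj_onI)
    fix i j assume "i \<in> {..<2*k}" "j \<in> {..<2*k}" and eq: "c i = c j"
    then have d: "i div 2 < k" "j div 2 < k" by auto
    have "even i = even j" using eq ne[OF d] ne[OF d(2,1)] by (auto simp: c_def split: if_splits)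
    moreover have "i div 2 = j div 2"
      using eq calculation d ix iy by (auto simp: c_def inj_on_def split: if_splits)
    ultimately show "i = j" by presburger
  qed
  moreover have "E (c i) (c j) \<longleftrightarrow> j = Suc i mod (2*k) \<or> i = Suc j mod (2*k)"
    if "i < 2*k" "j < 2*k" for i j
  proof -
    have d: "i div 2 < k" "j div 2 < k" using that by auto
    have m: "Suc i mod (2*k) = (if Suc i = 2*k then 0 else Suc i)"
      "Suc j mod (2*k) = (if Suc j = 2*k then 0 else Suc j)"
      using that by (auto simp: Suc_mod_eq)
    have m2: "Suc (i div 2) mod k = (if Suc (i div 2) = k then 0 else Suc (i div 2))"
      "Suc (j div 2) mod k = (if Suc (j div 2) = k then 0 else Suc (j div 2))"
      using d by (auto simp: Suc_mod_eq)
    consider (ee) "even i" "even j" | (eo) "even i" "odd j" | (oe) "odd i" "even j" | (oo) "odd i" "odd j"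
      by blast
    then show ?thesis
    proof cases
      case ee
      then have "\<not> E (c i) (c j)" using xx d by (simp add: c_def)
      moreover have "Suc i \<noteq> 2 * k" "Suc j \<noteq> 2 * k" using ee by presburger+
      ultimately show ?thesis using ee m by auto
    next
      case oo
      then have "\<not> E (c i) (c j)" using yy d by (simp add: c_def)
      moreover have "j \<noteq> Suc i" "i \<noteq> Suc j" "i \<noteq> 0" "j \<noteq> 0" using oo by presburger+
      ultimately show ?thesis unfolding m by auto
    next
      case eo
      then have "E (c i) (c j) \<longleftrightarrow> i div 2 = j div 2 \<or> i div 2 = Suc (j div 2) mod k"
        using xy d by (simp add: c_def)
      also have "\<dots> \<longleftrightarrow> j = Suc i mod (2*k) \<or> i = Suc j mod (2*k)"
      proof -
        obtain a b where ab: "i = 2 * a" "j = Suc (2 * b)" using eo by (auto elim!: evenE oddE)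
        show ?thesis unfolding m m2 using that k unfolding ab by auto
      qed
      finally show ?thesis .
    next
      case oe
      have "E (c i) (c j) \<longleftrightarrow> E (c j) (c i)" using sym by blast
      also have "\<dots> \<longleftrightarrow> j div 2 = i div 2 \<or> j div 2 = Suc (i div 2) mod k"
        using xy d oe by (simp add: c_def)
      also have "\<dots> \<longleftrightarrow> j = Suc i mod (2*k) \<or> i = Suc j mod (2*k)"
      proof -
        obtain a b where ab: "i = Suc (2 * a)" "j = 2 * b" using oe by (auto elim!: evenE oddE)
        show ?thesis unfolding m m2 using that k unfolding ab by auto
      qed
      finally show ?thesis .
    qed
  qed
  ultimately show ?thesis using k unfolding ind_cycle_def by (intro exI[of _ c]) auto
qed

section \<open>Graphs without large bicliques and long holes\<close>

locale thin_graph =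
  fixes V :: "'a set" and E :: "'a \<Rightarrow> 'a \<Rightarrow> bool" and l t :: nat
  assumes finite_V: "finite V"
    and E_sym: "E u v \<Longrightarrow> E v u"
    and E_irrefl: "\<not> E u u"
    and E_in: "E u v \<Longrightarrow> u \<in> V"
    and l_ge: "2 \<le> l"
    and no_biclique: "\<lbrakk>X \<subseteq> V; Y \<subseteq> V; card X = l; card Y = l\<rbrakk> \<Longrightarrow> \<exists>x\<in>X. \<exists>y\<in>Y. \<not> E x y"
    and no_hole: "ind_cycle E c n \<Longrightarrow> n < t"
begin

definition nb :: "'a \<Rightarrow> 'a set" where "nb v = {u. E v u}"
definition nbc :: "'a \<Rightarrow> 'a set" where "nbc v = insert v (nb v)"

lemma nb_iff [simp]: "u \<in> nb v \<longleftrightarrow> E v u" by (simp add: nb_def)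
lemma E_in2: "E u v \<Longrightarrow> v \<in> V" using E_sym E_in by blast
lemma nb_sub: "nb v \<subseteq> V" using E_in2 by auto
lemma finite_nb [simp]: "finite (nb v)" using nb_sub finite_V finite_subset by blast
lemma E_comm: "E u v \<longleftrightarrow> E v u" using E_sym by blast

text \<open>The only way the absence of \<open>K\<^bsub>l,l\<^esub>\<close> enters the argument: avoiding a neighbourhood costs just
  a factor of order \<open>l\<close>, for all but few vertices.\<close>

lemma few_dominating:
  assumes W: "W \<subseteq> V" "4 * l \<le> card W"
  shows "card {z \<in> V. card (W - nbc z) * (4 * l) < card W} < l"
proof (rule ccontr)
  assume "\<not> ?thesis"
  then obtain Z where Z: "Z \<subseteq> {z \<in> V. card (W - nbc z) * (4 * l) < card W}" "card Z = l"
    by (meson not_le obtain_subset_with_card_n)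
  have fW: "finite W" using W finite_V finite_subset by blast
  have fZ: "finite Z" using Z(2) l_ge card.infinite by fastforce
  \<comment> \<open>Together the \<open>l\<close> vertices of \<open>Z\<close> miss at most a
    quarter of \<open>W\<close> and \<open>l\<close> further vertices (a vertex of \<open>Z\<close>
    may itself lie in \<open>W\<close>), so at least \<open>l\<close> common neighbours remain and
    form a biclique with \<open>Z\<close>.\<close>
  define W' where "W' = {w \<in> W. \<forall>z\<in>Z. E z w}"
  have sub: "W - W' \<subseteq> (\<Union>z\<in>Z. W - nb z)" unfolding W'_def by auto
  have fU: "finite (\<Union>z\<in>Z. W - nb z)" using fW fZ by blast
  have "card (W - W') \<le> card (\<Union>z\<in>Z. W - nb z)" by (rule card_mono[OF fU sub])
  also have "\<dots> \<le> (\<Sum>z\<in>Z. card (W - nb z))" by (rule card_UN_le[OF fZ])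
  finally have "l * 4 * card (W - W') \<le> l * 4 * (\<Sum>z\<in>Z. card (W - nb z))" by simp
  also have "\<dots> = (\<Sum>z\<in>Z. l * 4 * card (W - nb z))" by (rule sum_distrib_left)
  also have "\<dots> \<le> (\<Sum>z\<in>Z. card W + 4 * l)"
  proof (rule sum_mono)
    fix z assume "z \<in> Z"
    then have "card (W - nbc z) * (4 * l) < card W" using Z by blast
    moreover have "card (W - nb z) \<le> card (W - nbc z) + 1"
    proof -
      have "W - nb z \<subseteq> insert z (W - nbc z)" by (auto simp: nbc_def)
      then have "card (W - nb z) \<le> card (insert z (W - nbc z))" using fW by (intro card_mono) auto
      also have "\<dots> \<le> card (W - nbc z) + 1" using card_insert_le_m1 fW by (simp add: card_insert_if)
      finally show ?thesis .
    qed
    then have "l * 4 * card (W - nb z) \<le> l * 4 * (card (W - nbc z) + 1)"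
      by (intro mult_le_mono) auto
    ultimately show "l * 4 * card (W - nb z) \<le> card W + 4 * l" by (simp add: algebra_simps)
  qed
  also have "\<dots> = l * (card W + 4 * l)" using Z by simp
  finally have "4 * card (W - W') \<le> card W + 4 * l" using l_ge by simp
  moreover have "card W = card W' + card (W - W')"
    using fW card_mono[of W W'] card_Diff_subset[of W' W] by (simp add: W'_def)
  ultimately have "l \<le> card W'" using W by linarith
  then obtain Y where Y: "Y \<subseteq> W'" "card Y = l" by (meson obtain_subset_with_card_n)
  have "Z \<subseteq> V" "Y \<subseteq> V" using Z Y W unfolding W'_def by auto
  from no_biclique[OF this Z(2) Y(2)] show False using Y unfolding W'_def by blast
qed

end

subsection \<open>Dense pairs\<close>

text \<open>Exposes coordinate \<open>j\<close> last: with the other values fixed as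
  \<open>g\<close>, only the values of \<open>f j\<close> are left to count.\<close>

lemma card_PiE_insert_filter:
  assumes "finite I" "finite U" "j \<notin> I"
  shows "card {f \<in> PiE (insert j I) (\<lambda>_. U). Q f} = (\<Sum>g\<in>PiE I (\<lambda>_. U). card {x \<in> U. Q (g(j := x))})"
proof -
  let ?S = "Sigma (PiE I (\<lambda>_. U)) (\<lambda>g. {x \<in> U. Q (g(j := x))})"
  have "bij_betw (\<lambda>(g, x). g(j := x)) ?S {f \<in> PiE (insert j I) (\<lambda>_. U). Q f}"
    unfolding bij_betw_def
  proof
    show "inj_on (\<lambda>(g, x). g(j := x)) ?S"
    proof (rule inj_onI, clarsimp)
      fix g x g' x' assume g: "g \<in> PiE I (\<lambda>_. U)" "g' \<in> PiE I (\<lambda>_. U)" and eq: "g(j := x) = g'(j := x')"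
      have "x = x'" using fun_cong[OF eq, of j] by simp
      moreover have "g i = g' i" for i
        using fun_cong[OF eq, of i] g assms(3) by (cases "i = j") (auto simp: PiE_def extensional_def)
      ultimately show "g = g' \<and> x = x'" by auto
    qed
    show "(\<lambda>(g, x). g(j := x)) ` ?S = {f \<in> PiE (insert j I) (\<lambda>_. U). Q f}"
    proof (intro equalityI subsetI)
      fix f assume f: "f \<in> {f \<in> PiE (insert j I) (\<lambda>_. U). Q f}"
      then have "f = (\<lambda>(g, x). g(j := x)) (f(j := undefined), f j)" by simp
      moreover have "(f(j := undefined), f j) \<in> ?S"
        using f assms(3) by (auto simp: PiE_def Pi_def extensional_def)
      ultimately show "f \<in> (\<lambda>(g, x). g(j := x)) ` ?S" by blast
    next
      fix f assume "f \<in> (\<lambda>(g, x). g(j := x)) ` ?S"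
      then show "f \<in> {f \<in> PiE (insert j I) (\<lambda>_. U). Q f}"
        by (auto simp: PiE_def Pi_def extensional_def)
    qed
  qed
  then have "card {f \<in> PiE (insert j I) (\<lambda>_. U). Q f} = card ?S"
    by (simp add: bij_betw_same_card)
  also have "\<dots> = (\<Sum>g\<in>PiE I (\<lambda>_. U). card {x \<in> U. Q (g(j := x))})"
    using assms by (intro card_SigmaI) (auto intro: finite_PiE)
  finally show ?thesis .
qed

lemma card_PiE_const: "finite I \<Longrightarrow> card (PiE I (\<lambda>_. U)) = card U ^ card I"
  by (simp add: card_PiE)

context thin_graph
begin

lemma nbc_comm: "u \<in> nbc v \<longleftrightarrow> v \<in> nbc u"
  using E_sym by (auto simp: nbc_def)

text \<open>The closed neighbourhood also forbids equality, so such a tuple is injective with an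
  independent image.\<close>

definition indep :: "nat \<Rightarrow> (nat \<Rightarrow> 'a) \<Rightarrow> bool" where
  "indep k f \<longleftrightarrow> (\<forall>i<k. \<forall>j<k. i \<noteq> j \<longrightarrow> f i \<notin> nbc (f j))"

lemma indep_Suc_upd:
  assumes "indep k g" "\<And>i. i < k \<Longrightarrow> g i \<notin> nbc x"
  shows "indep (Suc k) (g(k := x))"
  using assms unfolding indep_def by (auto simp: less_Suc_eq nbc_comm)

text \<open>Greedy choice from the last set. Each other set has fewer than \<open>l\<close> vertices
  that nearly dominate it, so some \<open>x\<close> in the last set is none of these, and deleting
  \<open>nbc x\<close> shrinks every remaining set by a factor of at most \<open>4 * l\<close>. Each
  factor of \<open>(4 * l) ^ n\<close> pays for one such round.\<close>

lemma transversal: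
  assumes "\<And>i. i < n \<Longrightarrow> W i \<subseteq> V" "\<And>i. i < n \<Longrightarrow> M * (4 * l) ^ n \<le> card (W i)" "n * l < M"
  shows "\<exists>g. (\<forall>i<n. g i \<in> W i) \<and> indep n g"
  using assms
proof (induction n arbitrary: W)
  case 0
  then show ?case by (simp add: indep_def)
next
  case (Suc n)
  have pow: "4 * l * (M * (4 * l) ^ n) \<le> card (W i)" if "i < Suc n" for i
    using Suc.prems(2)[OF that] by (simp add: mult_ac)
  have M: "1 \<le> M * (4 * l) ^ n" using Suc.prems(3) l_ge by simp
  have big: "4 * l \<le> card (W i)" if "i < Suc n" for i
    using order_trans[OF mult_le_mono2[OF M, of "4 * l"] pow[OF that]] by simp
  define D where "D i = {z \<in> V. card (W i - nbc z) * (4 * l) < card (W i)}" for i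
  have "card (\<Union>i<n. D i) \<le> (\<Sum>i<n. card (D i))" by (rule card_UN_le) simp
  also have "\<dots> \<le> (\<Sum>i<n. l)"
    using few_dominating[OF Suc.prems(1) big] by (intro sum_mono) (auto simp: D_def intro: less_imp_le)
  also have "\<dots> = n * l" by simp
  also have "\<dots> < M" using Suc.prems(3) by simp
  also have "M \<le> card (W n)"
  proof -
    have "M * 1 \<le> M * (4 * l) ^ Suc n" using l_ge by (intro mult_le_mono2) simp
    from order_trans[OF this Suc.prems(2)[of n]] show ?thesis by simp
  qed
  finally have "card (\<Union>i<n. D i) < card (W n)" .
  moreover have "finite (\<Union>i<n. D i)" using finite_V by (auto simp: D_def)
  ultimately have "\<not> W n \<subseteq> (\<Union>i<n. D i)" using card_mono by (meson not_le)
  then obtain x where x: "x \<in> W n" "\<And>i. i < n \<Longrightarrow> x \<notin> D i" by blast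
  have xV: "x \<in> V" using x Suc.prems(1)[of n] by auto
  have "\<exists>g. (\<forall>i<n. g i \<in> W i - nbc x) \<and> indep n g"
  proof (rule Suc.IH)
    show "W i - nbc x \<subseteq> V" if "i < n" for i using Suc.prems(1)[of i] that by auto
    show "M * (4 * l) ^ n \<le> card (W i - nbc x)" if "i < n" for i
    proof -
      have "card (W i) \<le> 4 * l * card (W i - nbc x)"
        using x(2)[OF that] xV by (simp add: D_def mult.commute)
      then have "4 * l * (M * (4 * l) ^ n) \<le> 4 * l * card (W i - nbc x)" using pow[of i] that by linarith
      then show ?thesis using l_ge by simp
    qed
    show "n * l < M" using Suc.prems(3) by simp
  qed
  then obtain g where g: "\<And>i. i < n \<Longrightarrow> g i \<in> W i - nbc x" "indep n g" by blast
  have "indep (Suc n) (g(n := x))" using g by (intro indep_Suc_upd) auto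
  moreover have "\<forall>i<Suc n. (g(n := x)) i \<in> W i" using g x by (auto simp: less_Suc_eq)
  ultimately show ?case by blast
qed

text \<open>At least half of \<open>U\<close> can serve as last coordinate \<open>x\<close> without
  nearly dominating \<open>U\<close>; the others are then chosen recursively in
  \<open>U - nbc x\<close>, which is smaller by a factor of at most \<open>4 * l\<close>. The step
  from \<open>k\<close> to \<open>k + 1\<close> thus costs \<open>2 * (4 * l) ^ k\<close>, which is
  within \<open>(8 * l) ^ (2 * k + 1)\<close>; hence the exponent \<open>k * k\<close>.\<close>

lemma indep_count:
  assumes "U \<subseteq> V" "(8 * l) ^ k \<le> card U"
  shows "real (card U) ^ k / (8 * real l) ^ (k * k)
    \<le> card {f \<in> PiE {..<k} (\<lambda>_. U). indep k f}"
  using assms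
proof (induction k arbitrary: U)
  case 0
  then show ?case by (simp add: indep_def)
next
  case (Suc k)
  have fU: "finite U" using Suc.prems finite_V finite_subset by blast
  have "1 \<le> (8 * l) ^ k" using l_ge by simp
  then have "8 * l * 1 \<le> 8 * l * (8 * l) ^ k" by (rule mult_le_mono2)
  from order_trans[OF this] have big: "8 * l \<le> card U" using Suc.prems(2) by simp
  define D where "D = {z \<in> V. card (U - nbc z) * (4 * l) < card U}"
  have "card D < l" unfolding D_def using big by (intro few_dominating[OF Suc.prems(1)]) simp
  then have "card U \<le> 2 * card (U - D)" using big diff_card_le_card_Diff[of D U] finite_V
    by (auto simp: D_def)
  then have half: "real (card U) / 2 \<le> card (U - D)" by linarith
  have each: "(real (card U) / (4 * l)) ^ k / (8 * real l) ^ (k * k)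
      \<le> card {g \<in> PiE {..<k} (\<lambda>_. U - nbc x). indep k g}" if x: "x \<in> U - D" for x
  proof -
    have "card U \<le> 4 * l * card (U - nbc x)" using x Suc.prems(1) by (auto simp: D_def mult.commute)
    then have "real (card U) \<le> real (4 * l * card (U - nbc x))" by (simp only: of_nat_le_iff)
    then have le: "real (card U) / (4 * l) \<le> card (U - nbc x)" using l_ge by (simp add: field_simps)
    have "4 * l * (2 * (8 * l) ^ k) = (8 * l) ^ Suc k" by simp
    also have "\<dots> \<le> 4 * l * card (U - nbc x)"
      using Suc.prems(2) \<open>card U \<le> 4 * l * card (U - nbc x)\<close> by (rule order_trans)
    finally have "4 * l * (2 * (8 * l) ^ k) \<le> 4 * l * card (U - nbc x)" .
    then have "2 * (8 * l) ^ k \<le> card (U - nbc x)"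
      by (rule mult_left_le_imp_le) (use l_ge in simp)
    then have "real (card (U - nbc x)) ^ k / (8 * real l) ^ (k * k)
      \<le> card {g \<in> PiE {..<k} (\<lambda>_. U - nbc x). indep k g}"
      using Suc.prems(1) by (intro Suc.IH) auto
    moreover have "(real (card U) / (4 * l)) ^ k \<le> real (card (U - nbc x)) ^ k"
      using le by (intro power_mono) auto
    ultimately show ?thesis by (meson divide_right_mono order_trans zero_le_power of_nat_0_le_iff zero_le_mult_iff zero_le_numeral)
  qed
  let ?S = "Sigma (U - D) (\<lambda>x. {g \<in> PiE {..<k} (\<lambda>_. U - nbc x). indep k g})"
  let ?T = "{f \<in> PiE {..<Suc k} (\<lambda>_. U). indep (Suc k) f}"
  have "inj_on (\<lambda>(x, g). g(k := x)) ?S"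
  proof (rule inj_onI, clarsimp)
    fix g x g' x' assume g: "g \<in> PiE {..<k} (\<lambda>_. U - nbc x)" "g' \<in> PiE {..<k} (\<lambda>_. U - nbc x')"
      and eq: "g(k := x) = g'(k := x')"
    have "x = x'" using fun_cong[OF eq, of k] by simp
    moreover have "g i = g' i" for i
      using fun_cong[OF eq, of i] g by (cases "i = k") (auto simp: PiE_def extensional_def)
    ultimately show "x = x' \<and> g = g'" by auto
  qed
  moreover have "(\<lambda>(x, g). g(k := x)) ` ?S \<subseteq> ?T"
  proof (clarsimp, intro conjI)
    fix x g assume *: "x \<in> U" "x \<notin> D" "g \<in> PiE {..<k} (\<lambda>_. U - nbc x)" "indep k g"
    show "g(k := x) \<in> PiE {..<Suc k} (\<lambda>_. U)"
      using * by (auto simp: PiE_def Pi_def extensional_def less_Suc_eq)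
    show "indep (Suc k) (g(k := x))" using * by (intro indep_Suc_upd) (auto simp: PiE_def Pi_def)
  qed
  moreover have "finite ?T" using fU by (auto intro!: finite_PiE finite_subset[of ?T "PiE {..<Suc k} (\<lambda>_. U)"])
  ultimately have "card ?S \<le> card ?T" by (meson card_inj_on_le)
  moreover have "card ?S = (\<Sum>x\<in>U - D. card {g \<in> PiE {..<k} (\<lambda>_. U - nbc x). indep k g})"
    using fU by (intro card_SigmaI) (auto intro!: finite_subset[of "{g \<in> PiE {..<k} (\<lambda>_. U - nbc x). indep k g}" "PiE {..<k} (\<lambda>_. U - nbc x)" for x] finite_PiE)
  ultimately have "(\<Sum>x\<in>U - D. real (card {g \<in> PiE {..<k} (\<lambda>_. U - nbc x). indep k g})) \<le> card ?T"
    by (simp flip: of_nat_sum)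
  moreover have "(\<Sum>x\<in>U - D. (real (card U) / (4 * l)) ^ k / (8 * real l) ^ (k * k))
      \<le> (\<Sum>x\<in>U - D. real (card {g \<in> PiE {..<k} (\<lambda>_. U - nbc x). indep k g}))"
    using each by (intro sum_mono) auto
  ultimately have "card (U - D) * ((real (card U) / (4 * l)) ^ k / (8 * real l) ^ (k * k)) \<le> card ?T"
    by simp
  moreover have "real (card U) / 2 * ((real (card U) / (4 * l)) ^ k / (8 * real l) ^ (k * k))
     \<le> card (U - D) * ((real (card U) / (4 * l)) ^ k / (8 * real l) ^ (k * k))"
    using half by (intro mult_right_mono) auto
  moreover have "real (card U) ^ Suc k / (8 * real l) ^ (Suc k * Suc k)
     \<le> real (card U) / 2 * ((real (card U) / (4 * l)) ^ k / (8 * real l) ^ (k * k))"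
  proof -
    have l1: "1 \<le> real l" using l_ge by simp
    have "2 * (4 * real l) ^ k \<le> (8 * real l) ^ (2 * k + 1)"
    proof -
      have "(4 * real l) ^ k \<le> (8 * real l) ^ k" using l1 by (intro power_mono) auto
      also have "\<dots> \<le> (8 * real l) ^ (2 * k)" using l1 by (intro power_increasing) auto
      finally have "2 * (4 * real l) ^ k \<le> (8 * real l) * (8 * real l) ^ (2 * k)"
        using l1 by (intro mult_mono) auto
      then show ?thesis by simp
    qed
    then have "2 * (4 * real l) ^ k * (8 * real l) ^ (k * k) \<le> (8 * real l) ^ (2 * k + 1) * (8 * real l) ^ (k * k)"
      by (intro mult_right_mono) auto
    also have "\<dots> = (8 * real l) ^ (2 * k + 1 + k * k)" by (simp only: power_add)
    also have "2 * k + 1 + k * k = Suc k * Suc k" by simp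
    finally have "real (card U) ^ Suc k / (8 * real l) ^ (Suc k * Suc k)
      \<le> real (card U) ^ Suc k / (2 * (4 * real l) ^ k * (8 * real l) ^ (k * k))"
      using l1 by (intro divide_left_mono) auto
    also have "\<dots> = real (card U) / 2 * ((real (card U) / (4 * l)) ^ k / (8 * real l) ^ (k * k))"
      by (simp add: power_divide)
    finally show ?thesis .
  qed
  ultimately show ?case by linarith
qed

text \<open>The candidates for a link between the hubs \<open>f i\<close> and \<open>f i'\<close>
  that is private as far as the hubs indexed by \<open>J\<close> are concerned.\<close>

definition lens :: "'a set \<Rightarrow> nat \<Rightarrow> nat \<Rightarrow> (nat \<Rightarrow> 'a) \<Rightarrow> nat set \<Rightarrow> 'a set" where
  "lens Y i i' f J = {y \<in> Y. E (f i) y \<and> E (f i') y \<and> (\<forall>j\<in>J. y \<notin> nbc (f j))}"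

text \<open>For \<open>J = {}\<close> only the values at \<open>i\<close> and \<open>i'\<close>
  matter; the indices of \<open>J\<close> are then exposed one by one. While a lens has at least
  \<open>4 * l\<close> vertices, fewer than \<open>l\<close> values of the next coordinate shrink it
  by more than a factor \<open>4 * l\<close>, so each index spoils at most
  \<open>l * card U ^ (card I - 1)\<close> further tuples. The factor
  \<open>(4 * l) ^ card J\<close> is the shrinkage allowed so far, and the lower bound on
  \<open>s\<close> keeps unspoilt lenses large enough.\<close>

lemma card_small_lens:
  fixes s :: real
  assumes I: "finite I" "i \<in> I" "i' \<in> I" "i \<noteq> i'" and J: "J \<subseteq> I - {i, i'}"
    and U: "U \<subseteq> V" and Y: "Y \<subseteq> V"
    and s: "(4 * real l) ^ (card I) \<le> s"
  shows "card {f \<in> PiE I (\<lambda>_. U). card (lens Y i i' f J) * (4 * real l) ^ card J < s}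
    \<le> card {(x, x') \<in> U \<times> U. card {y \<in> Y. E x y \<and> E x' y} < s} * card U ^ (card I - 2)
      + card J * (l * card U ^ (card I - 1))"
proof -
  have fJ: "finite J" using J I finite_subset by blast
  have fU: "finite U" "finite Y" using U Y finite_V finite_subset by blast+
  have fP: "finite (PiE K (\<lambda>_. U))" if "K \<subseteq> I" for K
    using fU I that by (auto intro: finite_PiE finite_subset)
  show ?thesis using fJ J
  proof (induction J rule: finite_induct)
    case empty
    let ?A = "{f \<in> PiE I (\<lambda>_. U). card (lens Y i i' f {}) * (4 * real l) ^ card ({}::nat set) < s}"
    let ?B = "{(x, x') \<in> U \<times> U. card {y \<in> Y. E x y \<and> E x' y} < s}"
    let ?h = "\<lambda>f. ((f i, f i'), restrict f (I - {i, i'}))"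
    have "inj_on ?h ?A"
    proof (rule inj_onI)
      fix f g assume fg: "f \<in> ?A" "g \<in> ?A" and eq: "?h f = ?h g"
      have "f j = g j" if "j \<in> I" for j
      proof (cases "j \<in> {i, i'}")
        case True then show ?thesis using eq by auto
      next
        case False
        then have "restrict f (I - {i, i'}) j = restrict g (I - {i, i'}) j" using eq by simp
        then show ?thesis using False that by simp
      qed
      then show "f = g" using fg by (intro PiE_ext[of f I "\<lambda>_. U" g]) auto
    qed
    moreover have "?h ` ?A \<subseteq> ?B \<times> PiE (I - {i, i'}) (\<lambda>_. U)"
      using I by (auto simp: lens_def PiE_def Pi_def)
    moreover have "finite (?B \<times> PiE (I - {i, i'}) (\<lambda>_. U))"
      using fU fP by (intro finite_cartesian_product) (auto intro: finite_subset[of _ "U \<times> U"])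
    ultimately have "card ?A \<le> card (?B \<times> PiE (I - {i, i'}) (\<lambda>_. U))" by (rule card_inj_on_le)
    also have "\<dots> = card ?B * card U ^ (card I - 2)"
      using I by (simp add: card_cartesian_product card_PiE_const card_Diff_subset numeral_2_eq_2)
    finally show ?case by simp
  next
    case (insert j J)
    let ?bad = "\<lambda>J f. card (lens Y i i' f J) * (4 * real l) ^ card J < s"
    have j: "j \<in> I" "j \<noteq> i" "j \<noteq> i'" "finite (I - {j})" using insert.prems I by auto
    have cJ: "card J + 1 \<le> card I"
    proof -
      have "insert j J \<subseteq> I" using insert.prems by auto
      then have "card (insert j J) \<le> card I" using I by (intro card_mono) auto
      then show ?thesis using insert.hyps by simp
    qed
    let ?Q = "\<lambda>f. \<not> ?bad J f \<and> ?bad (insert j J) f"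
    have small: "card {x \<in> U. ?Q (g(j := x))} \<le> l" for g
    proof (cases "\<exists>x. ?Q (g(j := x))")
      case True
      define L where "L = lens Y i i' g J"
      have L: "lens Y i i' (g(j := x)) J = L" for x
        using insert.hyps j unfolding L_def lens_def by auto
      have L': "lens Y i i' (g(j := x)) (insert j J) = L - nbc x" for x
        using insert.hyps j unfolding L_def lens_def by auto
      have sL: "s \<le> card L * (4 * real l) ^ card J" using True by (auto simp: L)
      have "(4 * real l) ^ (card J + 1) \<le> (4 * real l) ^ card I"
        using cJ l_ge by (intro power_increasing) auto
      then have "(4 * real l) * (4 * real l) ^ card J \<le> card L * (4 * real l) ^ card J"
        using order_trans[OF order_trans[OF _ s] sL] by simp
      then have "4 * real l \<le> card L" by (rule mult_right_le_imp_le) (use l_ge in simp)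
      then have "4 * l \<le> card L" by linarith
      moreover have "L \<subseteq> V" using Y unfolding L_def lens_def by auto
      ultimately have few: "card {z \<in> V. card (L - nbc z) * (4 * l) < card L} < l"
        by (intro few_dominating)
      have "{x \<in> U. ?Q (g(j := x))} \<subseteq> {z \<in> V. card (L - nbc z) * (4 * l) < card L}"
      proof safe
        fix x assume x: "x \<in> U" "card (lens Y i i' (g(j := x)) (insert j J)) * (4 * real l) ^ card (insert j J) < s"
        show "x \<in> V" using x U by auto
        have "card (L - nbc x) * (4 * real l) * (4 * real l) ^ card J < s"
          using x(2) insert.hyps by (simp add: L' mult_ac)
        also note sL
        finally have "card (L - nbc x) * (4 * real l) < card L"
          by (rule mult_right_less_imp_less) (use l_ge in simp)
        then have "real (card (L - nbc x) * (4 * l)) < real (card L)" by simp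
        then show "card (L - nbc x) * (4 * l) < card L" by (simp only: of_nat_less_iff)
      qed
      then have "card {x \<in> U. ?Q (g(j := x))} \<le> card {z \<in> V. card (L - nbc z) * (4 * l) < card L}"
        using finite_V by (intro card_mono) auto
      then show ?thesis using few by simp
    next
      case False
      then have "{x \<in> U. ?Q (g(j := x))} = {}" by blast
      then show ?thesis by (metis card.empty le0)
    qed
    have "{f \<in> PiE I (\<lambda>_. U). ?bad (insert j J) f}
        \<subseteq> {f \<in> PiE I (\<lambda>_. U). ?bad J f} \<union> {f \<in> PiE I (\<lambda>_. U). ?Q f}" by blast
    then have "card {f \<in> PiE I (\<lambda>_. U). ?bad (insert j J) f}
        \<le> card ({f \<in> PiE I (\<lambda>_. U). ?bad J f} \<union> {f \<in> PiE I (\<lambda>_. U). ?Q f})"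
      using fP by (intro card_mono) auto
    also have "\<dots> \<le> card {f \<in> PiE I (\<lambda>_. U). ?bad J f} + card {f \<in> PiE I (\<lambda>_. U). ?Q f}"
      by (rule card_Un_le)
    also have "card {f \<in> PiE I (\<lambda>_. U). ?Q f} \<le> l * card U ^ (card I - 1)"
    proof -
      have "card {f \<in> PiE (insert j (I - {j})) (\<lambda>_. U). ?Q f}
          = (\<Sum>g\<in>PiE (I - {j}) (\<lambda>_. U). card {x \<in> U. ?Q (g(j := x))})"
        using j fU by (intro card_PiE_insert_filter) auto
      also have "\<dots> \<le> (\<Sum>g\<in>PiE (I - {j}) (\<lambda>_. U). l)" using small by (intro sum_mono)
      also have "\<dots> = l * card U ^ (card I - 1)" using j by (simp add: card_PiE_const)
      finally show ?thesis using j by (simp add: insert_absorb)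
    qed
    also have "card {f \<in> PiE I (\<lambda>_. U). ?bad J f}
      \<le> card {(x, x') \<in> U \<times> U. card {y \<in> Y. E x y \<and> E x' y} < s} * card U ^ (card I - 2)
      + card J * (l * card U ^ (card I - 1))"
      using insert.IH insert.prems by blast
    finally show ?case using insert.hyps by (simp add: algebra_simps)
  qed
qed

text \<open>Dependent random choice: the neighbourhood of a random vertex of \<open>Y\<close> is a large subset of \<open>X\<close>
  nearly all of whose pairs have many common neighbours.\<close>

lemma dependent_choice:
  fixes \<Theta> :: real
  assumes X: "finite X" "X \<noteq> {}" and Y: "finite Y" "Y \<noteq> {}" and h: "0 < h" and T: "0 < \<Theta>"
    and dense: "card X * card Y \<le> h * card {(x, y) \<in> X \<times> Y. E x y}"
  obtains U where "U \<subseteq> X" "card X \<le> 2 * h * card U"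
    "card {(x, x') \<in> U \<times> U. card {y \<in> Y. E x y \<and> E x' y} < card Y / (4 * real h ^ 2 * \<Theta>)} \<le> real (card U) ^ 2 / \<Theta>"
proof -
  define s where "s = card Y / (4 * real h ^ 2 * \<Theta>)"
  define U where "U y = {x \<in> X. E x y}" for y
  define B where "B = {(x, x') \<in> X \<times> X. card {y \<in> Y. E x y \<and> E x' y} < s}"
  define b where "b y = card (B \<inter> U y \<times> U y)" for y
  \<comment> \<open>A Lagrange multiplier: for random \<open>y\<close>, the mean of
    \<open>b y\<close> is at most \<open>card X ^ 2 * s / card Y\<close> and that of
    \<open>card (U y)\<close> at least \<open>card X / h\<close>, so with this \<open>\<mu>\<close>
    the mean of \<open>\<mu> * (card (U y) - card X / (2 * h)) - b y\<close> is nonnegative. One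
    \<open>y\<close> with a nonnegative value yields both conclusions, as \<open>0 \<le> b y\<close>
    and \<open>\<mu> = card X / (2 * h) / \<Theta>\<close>.\<close>
  define \<mu> where "\<mu> = 2 * h * s * card X / card Y"
  have Xp: "0 < card X" "0 < card Y" using X Y by (auto simp: card_gt_0_iff)
  have spos: "0 < s" using Xp h T by (simp add: s_def)
  have fB: "finite B" using X by (auto simp: B_def intro: finite_subset[of _ "X \<times> X"])
  have "{(x, y) \<in> X \<times> Y. E x y} = (\<lambda>(y, x). (x, y)) ` Sigma Y U" by (auto simp: U_def)
  then have "card {(x, y) \<in> X \<times> Y. E x y} = card (Sigma Y U)"
    by (simp add: card_image inj_on_def split_beta prod_eq_iff)
  also have "\<dots> = (\<Sum>y\<in>Y. card (U y))" using X Y by (intro card_SigmaI) (auto simp: U_def)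
  finally have sumU: "card X * card Y \<le> real h * (\<Sum>y\<in>Y. card (U y))"
    using dense by (metis of_nat_le_iff of_nat_mult)
  define cn where "cn p = {y \<in> Y. E (fst p) y \<and> E (snd p) y}" for p
  have "(\<Sum>y\<in>Y. b y) = card (Sigma Y (\<lambda>y. B \<inter> U y \<times> U y))"
    unfolding b_def using Y(1) fB by (intro card_SigmaI[symmetric]) auto
  also have "\<dots> = card ((\<lambda>(y, p). (p, y)) ` Sigma Y (\<lambda>y. B \<inter> U y \<times> U y))"
    by (rule card_image[symmetric]) (auto simp: inj_on_def)
  also have "(\<lambda>(y, p). (p, y)) ` Sigma Y (\<lambda>y. B \<inter> U y \<times> U y) = Sigma B cn"
    by (auto simp: U_def B_def cn_def)
  also have "card (Sigma B cn) = (\<Sum>p\<in>B. card (cn p))"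
    using fB Y(1) by (intro card_SigmaI) (auto simp: cn_def)
  finally have "(\<Sum>y\<in>Y. real (b y)) = (\<Sum>p\<in>B. real (card (cn p)))"
    by (simp flip: of_nat_sum)
  also have "\<dots> \<le> (\<Sum>p\<in>B. s)" by (intro sum_mono) (auto simp: B_def cn_def)
  also have "\<dots> \<le> real (card X * card X) * s"
  proof -
    have "card B \<le> card (X \<times> X)" using X by (intro card_mono) (auto simp: B_def)
    then have "real (card B) \<le> real (card X * card X)" by (simp only: card_cartesian_product of_nat_le_iff)
    then show ?thesis using spos by (simp add: mult_right_mono)
  qed
  finally have sumb: "(\<Sum>y\<in>Y. real (b y)) \<le> real (card X) * card X * s" by simp
  have "0 \<le> (\<Sum>y\<in>Y. \<mu> * (card (U y) - card X / (2 * h)) - b y)"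
  proof -
    have "(\<Sum>y\<in>Y. \<mu> * (card (U y) - card X / (2 * h)) - b y)
        = \<mu> * (\<Sum>y\<in>Y. card (U y)) - \<mu> * (card Y * (card X / (2 * h))) - (\<Sum>y\<in>Y. real (b y))"
      by (simp add: sum_subtractf flip: sum_distrib_left) (simp add: algebra_simps)
    moreover have "\<mu> * (real (card X * card Y) / h) \<le> \<mu> * (\<Sum>y\<in>Y. card (U y))"
      using sumU h spos Xp by (intro mult_left_mono) (auto simp: \<mu>_def field_simps)
    moreover have "\<mu> * (real (card X * card Y) / h) - \<mu> * (card Y * (card X / (2 * h)))
        = real (card X) * card X * s"
      using h Xp by (simp add: \<mu>_def field_simps)
    ultimately show ?thesis using sumb by linarith
  qed
  then have "\<exists>y\<in>Y. 0 \<le> \<mu> * (card (U y) - card X / (2 * h)) - b y"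
    using Y sum_strict_mono[of Y "\<lambda>y. \<mu> * (card (U y) - card X / (2 * h)) - b y" "\<lambda>_. 0"]
    by (fastforce simp: not_le)
  then obtain y where y: "y \<in> Y" "b y \<le> \<mu> * (card (U y) - card X / (2 * h))" by auto
  have lpos: "0 < \<mu>" using spos Xp h by (simp add: \<mu>_def)
  have "0 \<le> \<mu> * (card (U y) - card X / (2 * h))" using y(2) by linarith
  then have U1: "card X / (2 * h) \<le> card (U y)" using lpos by (simp add: zero_le_mult_iff)
  have "real (b y) \<le> \<mu> * card (U y)" 
  proof -
    have "\<mu> * (card (U y) - card X / (2 * h)) \<le> \<mu> * card (U y)"
      using lpos by (intro mult_left_mono) auto
    then show ?thesis using y(2) by linarith
  qed
  also have "\<mu> = card X / (2 * h) / \<Theta>"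
    using Xp h T by (simp add: \<mu>_def s_def field_simps power2_eq_square)
  also have "card X / (2 * h) / \<Theta> * card (U y) \<le> card (U y) / \<Theta> * card (U y)"
    using U1 T by (intro mult_right_mono divide_right_mono) auto
  finally have "real (b y) \<le> real (card (U y)) ^ 2 / \<Theta>" by (simp add: power2_eq_square)
  moreover have "{(x, x') \<in> U y \<times> U y. card {y \<in> Y. E x y \<and> E x' y} < s} = B \<inter> U y \<times> U y"
    by (auto simp: B_def U_def)
  moreover have "card X \<le> 2 * h * card (U y)"
  proof -
    have "real (card X) \<le> real (2 * h * card (U y))" using U1 h by (simp add: field_simps)
    then show ?thesis by (simp only: of_nat_le_iff)
  qed
  moreover have "U y \<subseteq> X" by (auto simp: U_def)
  ultimately show thesis using that[of "U y"] by (simp add: b_def s_def)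
qed

lemma indep_inj: "indep k f \<Longrightarrow> inj_on f {..<k}"
  unfolding indep_def inj_on_def nbc_def by blast

lemma indep_not_E: "indep k f \<Longrightarrow> i < k \<Longrightarrow> j < k \<Longrightarrow> \<not> E (f i) (f j)"
  using E_irrefl E_sym unfolding indep_def nbc_def by (cases "i = j") auto

text \<open>Of the \<open>k\<close>-tuples from the set \<open>U\<close> supplied by dependent
  choice, at least a fraction \<open>1 / b\<close> are independent, while fewer have a small lens
  between some cyclically consecutive entries. A tuple of the first kind and not of the second
  extends by a transversal of its lenses to a hole of length \<open>2 * k\<close>. In the exponent,
  \<open>k * k\<close> pays for \<open>b\<close>, \<open>2 * k\<close> for thinning the lenses and
  for the transversal, and \<open>5\<close> covers the remaining polynomial factors.\<close>

lemma no_dense_pair: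
  assumes XY: "X \<subseteq> V" "Y \<subseteq> V" and h: "0 < h" and k: "3 \<le> k" "t \<le> 2 * k"
    and dense: "card X * card Y \<le> h * card {(x, y) \<in> X \<times> Y. E x y}"
    and big: "(8 * k * l * h) ^ (k * k + 2 * k + 5) \<le> card X" "(8 * k * l * h) ^ (k * k + 2 * k + 5) \<le> card Y"
  shows False
proof -
  define \<beta> where "\<beta> = 8 * k * l * h"
  define b where "b = (8 * l) ^ (k * k)"
  have pos: "1 \<le> k" "1 \<le> l" "1 \<le> h" using k l_ge h by auto
  have \<beta>1: "1 \<le> \<beta>" "8 * l \<le> \<beta>" "4 * l \<le> \<beta>" using pos by (auto simp: \<beta>_def intro: Suc_leI)
  have b\<beta>: "b \<le> \<beta> ^ (k * k)" unfolding b_def using \<beta>1 by (intro power_mono) auto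
  have bpos: "1 \<le> b" using pos by (simp add: b_def)
  have c1: "2 * h * (4 * k * k * l) \<le> \<beta> ^ 2" "16 * k * h ^ 2 \<le> \<beta> ^ 2"
  proof -
    have "8 * h * k * k * l * 1 \<le> 8 * h * k * k * l * (8 * l * h)" using pos by (intro mult_le_mono2) auto
    then show "2 * h * (4 * k * k * l) \<le> \<beta> ^ 2" by (simp add: \<beta>_def power2_eq_square mult_ac)
    have "16 * k * h ^ 2 * 1 \<le> 16 * k * h ^ 2 * (4 * k * l ^ 2)" using pos by (intro mult_le_mono2) auto
    then show "16 * k * h ^ 2 \<le> \<beta> ^ 2" by (simp add: \<beta>_def power2_eq_square mult_ac)
  qed
  have c2: "k * l + 1 \<le> \<beta>"
  proof -
    have "k * l * 2 \<le> k * l * (8 * h)" using pos by (intro mult_le_mono2) auto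
    moreover have "1 \<le> k * l" using pos by simp
    ultimately have "k * l + 1 \<le> k * l * (8 * h)" by linarith
    also have "\<dots> = \<beta>" by (simp add: \<beta>_def mult_ac)
    finally show ?thesis .
  qed
  have big': "\<beta> ^ (k * k + 2 * k + 5) \<le> card X" "\<beta> ^ (k * k + 2 * k + 5) \<le> card Y"
    using big by (simp_all add: \<beta>_def)
  have X1: "2 * h * (4 * k * k * l * b) \<le> card X"
  proof -
    have "2 * h * (4 * k * k * l * b) = 2 * h * (4 * k * k * l) * b" by simp
    also have "\<dots> \<le> \<beta> ^ 2 * \<beta> ^ (k * k)" using c1 b\<beta> by (intro mult_le_mono)
    also have "\<dots> = \<beta> ^ (k * k + 2)" by (simp add: power_add power2_eq_square)
    also have "\<dots> \<le> \<beta> ^ (k * k + 2 * k + 5)" using \<beta>1 by (intro power_increasing) auto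
    finally show ?thesis using big' by simp
  qed
  have Y1: "16 * k * h ^ 2 * b * ((k * l + 1) * (4 * l) ^ (2 * k)) \<le> card Y"
  proof -
    have "16 * k * h ^ 2 * b * ((k * l + 1) * (4 * l) ^ (2 * k))
      \<le> \<beta> ^ 2 * \<beta> ^ (k * k) * (\<beta> * \<beta> ^ (2 * k))"
      using c1 b\<beta> c2 \<beta>1 by (intro mult_le_mono power_mono) auto
    also have "\<dots> = \<beta> ^ (2 + k * k + (1 + 2 * k))" by (simp only: power_add power_one_right)
    also have "\<dots> \<le> \<beta> ^ (k * k + 2 * k + 5)" using \<beta>1 by (intro power_increasing) auto
    finally show ?thesis using big' by simp
  qed
  \<comment> \<open>With this value the \<open>k\<close> consecutive pairs spoil at most a fraction
    \<open>1 / (4 * b)\<close> of the tuples by having few common neighbours; the remaining hubs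
    spoil at most as many again.\<close>
  define \<Theta> where "\<Theta> = 4 * real k * real b"
  define s where "s = card Y / (4 * real h ^ 2 * \<Theta>)"
  have Tpos: "0 < \<Theta>" using pos bpos by (simp add: \<Theta>_def)
  have fXY: "finite X" "finite Y" using XY finite_V finite_subset by blast+
  have "0 < \<beta> ^ (k * k + 2 * k + 5)" using \<beta>1 by simp
  then have ne: "X \<noteq> {}" "Y \<noteq> {}" using big' by auto
  obtain U where U: "U \<subseteq> X" "card X \<le> 2 * h * card U"
    "card {(x, x') \<in> U \<times> U. card {y \<in> Y. E x y \<and> E x' y} < s} \<le> real (card U) ^ 2 / \<Theta>"
    using dependent_choice[OF fXY(1) ne(1) fXY(2) ne(2) h Tpos dense] unfolding s_def by blast
  have UV: "U \<subseteq> V" and fU: "finite U" using U XY fXY finite_subset by blast+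
  have "2 * h * (4 * k * k * l * b) \<le> 2 * h * card U" using X1 U(2) by (rule order_trans)
  then have u1: "4 * k * k * l * b \<le> card U" by (rule mult_left_le_imp_le) (use h in simp)
  have u2: "(8 * l) ^ k \<le> card U"
  proof -
    have "(8 * l) ^ k \<le> b" unfolding b_def using pos by (intro power_increasing) auto
    also have "1 * b \<le> (4 * k * k * l) * b" using pos by (intro mult_le_mono1) auto
    finally show ?thesis using u1 by simp
  qed
  have s1: "real ((k * l + 1) * (4 * l) ^ (2 * k)) \<le> s"
  proof -
    have "real (16 * k * h ^ 2 * b * ((k * l + 1) * (4 * l) ^ (2 * k))) \<le> real (card Y)"
      using Y1 by (simp only: of_nat_le_iff)
    then have "real ((k * l + 1) * (4 * l) ^ (2 * k)) * real (16 * k * h ^ 2 * b) \<le> real (card Y)"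
      by (simp only: of_nat_mult mult.commute)
    moreover have "0 < real (16 * k * h ^ 2 * b)" using pos bpos by simp
    ultimately have "real ((k * l + 1) * (4 * l) ^ (2 * k)) \<le> real (card Y) / real (16 * k * h ^ 2 * b)"
      by (simp only: pos_le_divide_eq)
    also have "\<dots> = s" by (simp add: s_def \<Theta>_def mult_ac)
    finally show ?thesis .
  qed
  have s2: "(4 * real l) ^ k \<le> s"
  proof -
    have "1 * (4 * l) ^ k \<le> (k * l + 1) * (4 * l) ^ (2 * k)"
      using pos by (intro mult_le_mono power_increasing) auto
    then have "real ((4 * l) ^ k) \<le> real ((k * l + 1) * (4 * l) ^ (2 * k))" by (simp only: of_nat_le_iff mult_1)
    then show ?thesis using s1 by simp
  qed
  define nx where "nx i = Suc i mod k" for i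
  define J where "J i = {..<k} - {i, nx i}" for i
  have nx: "nx i < k" "nx i \<noteq> i" if "i < k" for i
    using that k unfolding nx_def by (auto simp: Suc_mod_eq split: if_splits)
  have cJ: "card (J i) = k - 2" if "i < k" for i
    using nx[OF that] that unfolding J_def by (simp add: card_Diff_subset)
  define P where "P = PiE {..<k} (\<lambda>_. U)"
  have fP: "finite P" using fU by (auto simp: P_def intro: finite_PiE)
  define Bad where "Bad i = {f \<in> P. card (lens Y i (nx i) f (J i)) * (4 * real l) ^ (k - 2) < s}" for i
  let ?u = "real (card U)"
  have cB: "card (Bad i) \<le> ?u ^ k / \<Theta> + k * (l * ?u ^ (k - 1))" if i: "i < k" for i
  proof -
    let ?B = "{(x, x') \<in> U \<times> U. card {y \<in> Y. E x y \<and> E x' y} < s}"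
    have "card (Bad i) \<le> card ?B * card U ^ (k - 2) + (k - 2) * (l * card U ^ (k - 1))"
      using card_small_lens[of "{..<k}" i "nx i" "J i" U Y s] nx[OF i] i UV XY s2
      using cJ[OF i] by (simp add: Bad_def P_def J_def numeral_2_eq_2)
    also have "\<dots> \<le> card ?B * card U ^ (k - 2) + k * (l * card U ^ (k - 1))" by simp
    finally have "real (card (Bad i)) \<le> real (card ?B * card U ^ (k - 2) + k * (l * card U ^ (k - 1)))"
      by (simp only: of_nat_le_iff)
    also have "\<dots> = card ?B * ?u ^ (k - 2) + k * (l * ?u ^ (k - 1))" by simp
    also have "real (card ?B) * ?u ^ (k - 2) \<le> ?u ^ 2 / \<Theta> * ?u ^ (k - 2)"
      using U(3) by (intro mult_right_mono) auto
    also have "?u ^ 2 / \<Theta> * ?u ^ (k - 2) = ?u ^ k / \<Theta>"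
    proof -
      have "?u ^ 2 / \<Theta> * ?u ^ (k - 2) = ?u ^ 2 * ?u ^ (k - 2) / \<Theta>" by simp
      also have "?u ^ 2 * ?u ^ (k - 2) = ?u ^ (2 + (k - 2))" by (rule power_add[symmetric])
      also have "2 + (k - 2) = k" using k by simp
      finally show ?thesis .
    qed
    finally show ?thesis by simp
  qed
  have "card (\<Union>i<k. Bad i) \<le> (\<Sum>i<k. card (Bad i))" by (rule card_UN_le) simp
  then have "real (card (\<Union>i<k. Bad i)) \<le> real (\<Sum>i<k. card (Bad i))" by (simp only: of_nat_le_iff)
  also have "\<dots> \<le> (\<Sum>i<k. ?u ^ k / \<Theta> + k * (l * ?u ^ (k - 1)))"
    using cB by (simp only: of_nat_sum) (intro sum_mono, simp)
  also have "\<dots> = k * (?u ^ k / \<Theta>) + k * k * l * ?u ^ (k - 1)" by (simp add: algebra_simps)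
  also have "k * (?u ^ k / \<Theta>) = ?u ^ k / b / 4" using pos by (simp add: \<Theta>_def)
  also have "k * k * l * ?u ^ (k - 1) \<le> ?u ^ k / b / 4"
  proof -
    have "real (4 * k * k * l * b) \<le> real (card U)" using u1 by (simp only: of_nat_le_iff)
    then have "real (k * k * l) \<le> ?u / b / 4" using bpos by (simp add: field_simps)
    then have "real (k * k * l) * ?u ^ (k - 1) \<le> ?u / b / 4 * ?u ^ (k - 1)" by (intro mult_right_mono) auto
    also have "\<dots> = ?u ^ k / b / 4" using pos by (simp add: power_eq_if)
    finally show ?thesis by simp
  qed
  also have "?u ^ k / b / 4 + ?u ^ k / b / 4 < ?u ^ k / b"
  proof -
    have "1 \<le> (8 * l) ^ k" using pos by simp
    then have "0 < card U" using u2 by linarith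
    then have "0 < ?u ^ k / b" using bpos by simp
    then show ?thesis by linarith
  qed
  also have "?u ^ k / b \<le> card {f \<in> P. indep k f}"
    using indep_count[OF UV u2] by (simp add: b_def P_def)
  finally have "card (\<Union>i<k. Bad i) < card {f \<in> P. indep k f}" by simp
  moreover have "finite (\<Union>i<k. Bad i)" using fP by (auto simp: Bad_def)
  ultimately have "\<not> {f \<in> P. indep k f} \<subseteq> (\<Union>i<k. Bad i)" using card_mono by (meson not_le)
  then obtain f where f: "f \<in> P" "indep k f" "\<And>i. i < k \<Longrightarrow> f \<notin> Bad i" by blast
  define W where "W i = lens Y i (nx i) f (J i)" for i
  have "\<exists>g. (\<forall>i<k. g i \<in> W i) \<and> indep k g"
  proof (rule transversal)
    show "W i \<subseteq> V" for i using XY by (auto simp: W_def lens_def)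
    show "(k * l + 1) * (4 * l) ^ k \<le> card (W i)" if "i < k" for i
    proof -
      have "s \<le> card (W i) * (4 * real l) ^ (k - 2)" using f(1) f(3)[OF that] by (auto simp: Bad_def W_def)
      then have "real ((k * l + 1) * (4 * l) ^ (2 * k)) \<le> real (card (W i) * (4 * l) ^ (k - 2))"
        using s1 by simp
      then have "(k * l + 1) * (4 * l) ^ (2 * k) \<le> card (W i) * (4 * l) ^ (k - 2)" by (simp only: of_nat_le_iff)
      also have "\<dots> \<le> card (W i) * (4 * l) ^ k" using pos by (intro mult_le_mono2 power_increasing) auto
      also have "(4 * l) ^ (2 * k) = (4 * l) ^ k * (4 * l) ^ k" by (simp only: mult_2 power_add)
      finally have "(k * l + 1) * (4 * l) ^ k * (4 * l) ^ k \<le> card (W i) * (4 * l) ^ k"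
        by (simp only: mult.assoc)
      then show ?thesis by (rule mult_right_le_imp_le) (use pos in simp)
    qed
    show "k * l < k * l + 1" by simp
  qed
  then obtain g where g: "\<And>i. i < k \<Longrightarrow> g i \<in> W i" "indep k g" by blast
  have "\<exists>c. ind_cycle E c (2 * k)"
  proof (rule subdivided_ind_cycle)
    show "E (f i) (g j) \<longleftrightarrow> i = j \<or> i = Suc j mod k" if ij: "i < k" "j < k" for i j
    proof -
      have "g j \<in> lens Y j (nx j) f (J j)" using g(1)[OF ij(2)] by (simp add: W_def)
      then show ?thesis using ij unfolding lens_def J_def nx_def nbc_def by auto
    qed
  qed (use k f g indep_inj indep_not_E E_sym in auto)
  then show False using no_hole k by fastforce
qed

subsection \<open>Holes from induced paths\<close>

definition ind_path :: "'a list \<Rightarrow> bool" where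
  "ind_path ps \<longleftrightarrow> distinct ps \<and>
    (\<forall>i<length ps. \<forall>j<length ps. E (ps ! i) (ps ! j) \<longleftrightarrow> j = Suc i \<or> i = Suc j)"

text \<open>True of the empty set, which is what lies behind \<open>R\<close> at the first layer;
  nonemptiness is therefore stated separately.\<close>

definition conn :: "'a set \<Rightarrow> bool" where
  "conn C \<longleftrightarrow> (\<forall>u\<in>C. \<forall>v\<in>C. (\<lambda>x y. E x y \<and> x \<in> C \<and> y \<in> C)\<^sup>*\<^sup>* u v)"

lemma rtranclp_imp_walk:
  assumes "(\<lambda>x y. E x y \<and> x \<in> C \<and> y \<in> C)\<^sup>*\<^sup>* u v" "u \<in> C"
  shows "\<exists>zs. zs \<noteq> [] \<and> hd zs = u \<and> last zs = v \<and> set zs \<subseteq> C \<and> successively E zs"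
  using assms
proof (induction rule: rtranclp_induct)
  case base
  then show ?case by (intro exI[of _ "[u]"]) auto
next
  case (step y z)
  then obtain zs where "zs \<noteq> []" "hd zs = u" "last zs = y" "set zs \<subseteq> C" "successively E zs" by blast
  then show ?case using step by (intro exI[of _ "zs @ [z]"]) (auto simp: successively_append_iff)
qed

text \<open>A shortest walk in \<open>Y\<close> from a neighbour of the last path vertex to a
  neighbour of the first is an induced path that meets the two neighbourhoods only in its ends.
  Together with \<open>ps\<close> it forms a hole longer than \<open>ps\<close>.\<close>

lemma close_path:
  assumes ps: "ind_path ps" "2 \<le> length ps" "\<not> E (hd ps) (last ps)"
    and Y: "conn Y" "Y \<inter> set ps = {}"
    and ends: "y1 \<in> Y" "E (last ps) y1" "y0 \<in> Y" "E (hd ps) y0"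
    and inner: "\<And>i y. 0 < i \<Longrightarrow> Suc i < length ps \<Longrightarrow> y \<in> Y \<Longrightarrow> \<not> E (ps ! i) y"
  shows "length ps < t"
proof -
  \<comment> \<open>The end vertices are not fixed to \<open>y1\<close> and \<open>y0\<close>:
    minimising over them as well is what excludes further edges to the two ends of
    \<open>ps\<close>.\<close>
  define good where "good zs \<longleftrightarrow> zs \<noteq> [] \<and> set zs \<subseteq> Y \<and> successively E zs \<and>
    E (last ps) (hd zs) \<and> E (hd ps) (last zs)" for zs
  have "(\<lambda>x y. E x y \<and> x \<in> Y \<and> y \<in> Y)\<^sup>*\<^sup>* y1 y0" using Y(1) ends unfolding conn_def by blast
  from rtranclp_imp_walk[OF this ends(1)] obtain zs0
    where "zs0 \<noteq> []" "hd zs0 = y1" "last zs0 = y0" "set zs0 \<subseteq> Y" "successively E zs0" by blast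
  then have "good zs0" using ends by (simp add: good_def)
  then obtain zs where zs: "good zs" and min: "\<And>ys. good ys \<Longrightarrow> length zs \<le> length ys"
    using ex_has_least_nat[of good zs0 length] by blast
  define p where "p = length ps"
  define m where "m = length zs"
  have z: "zs \<noteq> []" "set zs \<subseteq> Y" "successively E zs" "E (last ps) (hd zs)" "E (hd ps) (last zs)"
    using zs by (auto simp: good_def)
  have mpos: "0 < m" using z by (simp add: m_def)
  have parts: "successively E (take i zs)" "successively E (drop i zs)" for i
    using z(3) successively_append_iff[of E "take i zs" "drop i zs"] by auto
  have subs: "set (take i zs) \<subseteq> Y" "set (drop i zs) \<subseteq> Y" for i
    using z(2) set_take_subset set_drop_subset by fastforce+
  have psne: "ps \<noteq> []" using ps(2) by auto
  have lastp: "last ps = ps ! (p - 1)" "hd ps = ps ! 0"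
    using psne by (auto simp: p_def last_conv_nth hd_conv_nth)
  have hdz: "hd zs = zs ! 0" "last zs = zs ! (m - 1)" using z by (auto simp: m_def last_conv_nth hd_conv_nth)
  have zz: "j = Suc i" if "i < j" "j < m" "E (zs ! i) (zs ! j)" for i j
  proof (rule ccontr)
    assume "j \<noteq> Suc i"
    let ?ys = "take (Suc i) zs @ drop j zs"
    have "last (take (Suc i) zs) = zs ! i" using that by (simp add: m_def take_Suc_conv_app_nth)
    then have "good ?ys" using that parts subs z
      by (auto simp: good_def successively_append_iff m_def hd_drop_conv_nth hd_append dest: in_set_takeD in_set_dropD)
    then have "m \<le> length ?ys" unfolding m_def by (rule min)
    then show False using that \<open>j \<noteq> Suc i\<close> by (simp add: m_def)
  qed
  have "zs ! i \<noteq> zs ! j" if "i < j" "j < m" for i j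
  proof
    assume eq: "zs ! i = zs ! j"
    let ?ys = "take i zs @ drop j zs"
    have "good ?ys"
    proof (cases i)
      case 0
      then show ?thesis using that parts subs z eq
        by (auto simp: good_def m_def hd_drop_conv_nth hdz)
    next
      case (Suc i')
      have "last (take i zs) = zs ! i'" using that Suc by (simp add: m_def take_Suc_conv_app_nth)
      moreover have "E (zs ! i') (zs ! i)" using z(3) Suc that by (auto simp: successively_conv_nth m_def)
      ultimately show ?thesis using that parts subs z eq Suc
        by (auto simp: good_def successively_append_iff m_def hd_drop_conv_nth hd_append dest: in_set_takeD in_set_dropD)
    qed
    then have "m \<le> length ?ys" unfolding m_def by (rule min)
    then show False using that by (simp add: m_def)
  qed
  then have dz: "distinct zs" unfolding distinct_conv_nth m_def by (metis linorder_neqE_nat)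
  have lz: "i = 0" if "i < m" "E (last ps) (zs ! i)" for i
  proof (rule ccontr)
    assume "i \<noteq> 0"
    have "good (drop i zs)" using that parts subs z
      by (auto simp: good_def m_def hd_drop_conv_nth dest: in_set_dropD)
    then have "m \<le> length (drop i zs)" unfolding m_def by (rule min)
    then show False using that \<open>i \<noteq> 0\<close> by (simp add: m_def)
  qed
  have hz: "i = m - 1" if "i < m" "E (hd ps) (zs ! i)" for i
  proof (rule ccontr)
    assume "i \<noteq> m - 1"
    have "last (take (Suc i) zs) = zs ! i" using that by (simp add: m_def take_Suc_conv_app_nth)
    then have "good (take (Suc i) zs)" using that parts subs z
      by (auto simp: good_def m_def dest: in_set_takeD)
    then have "m \<le> length (take (Suc i) zs)" unfolding m_def by (rule min)
    then show False using that \<open>i \<noteq> m - 1\<close> by (simp add: m_def)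
  qed
  define n where "n = p + m"
  define c where "c i = (if i < p then ps ! i else zs ! (i - p))" for i
  have zY: "zs ! i \<in> Y" if "i < m" for i using z(2) that by (auto simp: m_def)
  have adj: "E (c i) (c j) \<longleftrightarrow> j = Suc i \<or> i = 0 \<and> j = n - 1" if ij: "i < j" "j < n" for i j
  proof -
    consider (1) "j < p" | (2) "p \<le> i" | (3) "i < p" "p \<le> j" by linarith
    then show ?thesis
    proof cases
      case 1
      then have "E (c i) (c j) \<longleftrightarrow> j = Suc i \<or> i = Suc j"
        using ps(1) ij by (simp add: c_def ind_path_def p_def)
      then show ?thesis using ij 1 mpos by (auto simp: n_def)
    next
      case 2
      have "E (c i) (c j) \<longleftrightarrow> j = Suc i"
      proof
        assume "E (c i) (c j)"
        then have "j - p = Suc (i - p)" using 2 ij zz[of "i - p" "j - p"] by (simp add: c_def n_def)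
        then show "j = Suc i" using 2 ij by simp
      next
        assume "j = Suc i"
        then show "E (c i) (c j)" using z(3) 2 ij
          by (auto simp: c_def successively_conv_nth Suc_diff_le n_def m_def)
      qed
      then show ?thesis using 2 ps(2) ij by (auto simp: p_def)
    next
      case 3
      then have jm: "j - p < m" using ij by (simp add: n_def)
      have ce: "c i = ps ! i" "c j = zs ! (j - p)" using 3 by (auto simp: c_def)
      consider (a) "i = 0" | (b) "i = p - 1" "i \<noteq> 0" | (c) "0 < i" "Suc i < p" using 3 by linarith
      then show ?thesis
      proof cases
        case a
        have "E (c i) (c j) \<longleftrightarrow> j - p = m - 1"
          unfolding ce using hz[OF jm] z(5) a by (auto simp: lastp hdz)
        then show ?thesis using a 3 ps(2) ij mpos by (auto simp: n_def p_def)
      next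
        case b
        have "E (c i) (c j) \<longleftrightarrow> j - p = 0"
          unfolding ce using lz[OF jm] z(4) b by (auto simp: lastp hdz)
        then show ?thesis using b 3 by auto
      next
        case c
        then have "\<not> E (c i) (c j)" using inner[of i "c j"] zY[OF jm] by (simp add: ce p_def)
        then show ?thesis using c 3 by auto
      qed
    qed
  qed
  have "inj_on c {..<n}"
  proof -
    have "c = (!) (ps @ zs)" by (auto simp: c_def nth_append p_def)
    moreover have "distinct (ps @ zs)" using ps(1) dz z(2) Y(2) by (auto simp: ind_path_def)
    ultimately show ?thesis by (auto simp: inj_on_def nth_eq_iff_index_eq n_def p_def m_def)
  qed
  moreover have "E (c i) (c j) \<longleftrightarrow> j = Suc i mod n \<or> i = Suc j mod n" if ij: "i < n" "j < n" for i j
  proof -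
    have n3: "3 \<le> n" using ps(2) mpos by (simp add: n_def p_def)
    consider "i < j" | "j < i" | "i = j" by linarith
    then show ?thesis
    proof cases
      case 1
      then show ?thesis using adj[OF 1] ij n3 by (auto simp: Suc_mod_eq)
    next
      case 2
      then show ?thesis using adj[OF 2] ij n3 E_comm[of "c i" "c j"] by (auto simp: Suc_mod_eq)
    next
      case 3
      then show ?thesis using E_irrefl ij n3 by (auto simp: Suc_mod_eq)
    qed
  qed
  ultimately have "ind_cycle E c n" using ps(2) mpos by (simp add: ind_cycle_def n_def p_def)
  then show ?thesis using no_hole[of c n] by (simp add: n_def p_def)
qed

lemma conn_Un:
  assumes "conn A" "conn B" "a \<in> A" "b \<in> B" "E a b"
  shows "conn (A \<union> B)"
proof -
  let ?r = "\<lambda>x y. E x y \<and> x \<in> A \<union> B \<and> y \<in> A \<union> B"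
  have up: "?r\<^sup>*\<^sup>* u v" if "K \<subseteq> A \<union> B" "(\<lambda>x y. E x y \<and> x \<in> K \<and> y \<in> K)\<^sup>*\<^sup>* u v" for K u v
    using that(2) by (rule rtranclp_mono[THEN predicate2D, rotated]) (use that(1) in auto)
  have AA: "?r\<^sup>*\<^sup>* u v" if "u \<in> A" "v \<in> A" for u v
    using up[of A u v] assms(1) that by (auto simp: conn_def)
  have BB: "?r\<^sup>*\<^sup>* u v" if "u \<in> B" "v \<in> B" for u v
    using up[of B u v] assms(2) that by (auto simp: conn_def)
  have ab: "?r\<^sup>*\<^sup>* a b" "?r\<^sup>*\<^sup>* b a" using assms E_sym by (auto intro!: r_into_rtranclp)
  show ?thesis unfolding conn_def
  proof (intro ballI)
    fix u v assume "u \<in> A \<union> B" "v \<in> A \<union> B"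
    then show "?r\<^sup>*\<^sup>* u v"
      using AA BB ab assms(3,4) by (elim UnE) (meson rtranclp_trans)+
  qed
qed

lemma conn_singleton: "conn {q}" by (simp add: conn_def)

lemma conn_exit:
  assumes "conn C" "K \<subseteq> C" "u \<in> K" "v \<in> C - K"
  obtains x y where "x \<in> K" "y \<in> C - K" "E x y"
proof -
  have "(\<lambda>x y. E x y \<and> x \<in> C \<and> y \<in> C)\<^sup>*\<^sup>* u v" using assms by (auto simp: conn_def)
  then have "v \<in> K \<or> (\<exists>x\<in>K. \<exists>y\<in>C - K. E x y)"
    by (induction rule: rtranclp_induct) (use assms in auto)
  then show thesis using that assms by blast
qed

end

subsection \<open>Weighted graphs\<close>

text \<open>Ordered pairs are counted, so for symmetric \<open>G\<close> this is the sum of the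
  degrees inside \<open>C\<close>.\<close>

definition ec :: "('a \<Rightarrow> 'a \<Rightarrow> bool) \<Rightarrow> 'a set \<Rightarrow> nat" where
  "ec G C = card {(u, v) \<in> C \<times> C. G u v}"

lemma ec_altdef: "finite C \<Longrightarrow> ec G C = (\<Sum>u\<in>C. card {v \<in> C. G u v})"
proof -
  assume C: "finite C"
  have "{(u, v) \<in> C \<times> C. G u v} = Sigma C (\<lambda>u. {v \<in> C. G u v})" by auto
  then show ?thesis using C by (simp add: ec_def)
qed

lemma finite_ec_set: "finite C \<Longrightarrow> finite {(u, v) \<in> C \<times> C. G u v}"
  by (rule finite_subset[of _ "C \<times> C"]) auto

lemma ec_mono:
  assumes "finite D" "C \<subseteq> D" "\<And>u v. u \<in> C \<Longrightarrow> v \<in> C \<Longrightarrow> G u v \<Longrightarrow> G' u v"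
  shows "ec G C \<le> ec G' D"
proof -
  have "{(u, v) \<in> C \<times> C. G u v} \<subseteq> {(u, v) \<in> D \<times> D. G' u v}"
    using assms(2,3) by auto
  then show ?thesis unfolding ec_def by (rule card_mono[OF finite_ec_set[OF assms(1)]])
qed

lemma ec_split:
  assumes "finite C" "K \<subseteq> C" "\<And>u v. u \<in> K \<Longrightarrow> v \<in> C - K \<Longrightarrow> \<not> G u v \<and> \<not> G v u"
  shows "ec G C = ec G K + ec G (C - K)"
proof -
  have "{(u, v) \<in> C \<times> C. G u v} = {(u, v) \<in> K \<times> K. G u v} \<union> {(u, v) \<in> (C - K) \<times> (C - K). G u v}"
    using assms by blast
  moreover have "card \<dots> = ec G K + ec G (C - K)"
    unfolding ec_def using assms
    by (intro card_Un_disjoint finite_ec_set) (auto intro: finite_subset)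
  ultimately show ?thesis by (simp add: ec_def)
qed

context thin_graph
begin

lemma ind_path_snoc:
  assumes ps: "ind_path ps" "p \<notin> set ps" and E: "\<And>i. i < length ps \<Longrightarrow> E (ps ! i) p \<longleftrightarrow> Suc i = length ps"
  shows "ind_path (ps @ [p])"
proof -
  have E': "E p (ps ! i) \<longleftrightarrow> Suc i = length ps" if "i < length ps" for i
    using E[OF that] E_sym by blast
  have "E ((ps @ [p]) ! i) ((ps @ [p]) ! j) \<longleftrightarrow> j = Suc i \<or> i = Suc j"
    if "i < Suc (length ps)" "j < Suc (length ps)" for i j
    using that ps E[of i] E'[of j] E_irrefl[of p] unfolding ind_path_def
    by (cases "i < length ps"; cases "j < length ps") (auto simp: nth_append)
  then show ?thesis using ps by (simp add: ind_path_def)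
qed

lemma ind_path_Cons:
  assumes ps: "ind_path ps" "p \<notin> set ps" and E: "\<And>i. i < length ps \<Longrightarrow> E p (ps ! i) \<longleftrightarrow> i = 0"
  shows "ind_path (p # ps)"
proof -
  have E': "E (ps ! i) p \<longleftrightarrow> i = 0" if "i < length ps" for i
    using E[OF that] E_sym by blast
  have "E ((p # ps) ! i) ((p # ps) ! j) \<longleftrightarrow> j = Suc i \<or> i = Suc j"
    if "i < Suc (length ps)" "j < Suc (length ps)" for i j
    using that ps E E' E_irrefl[of p] unfolding ind_path_def
    by (cases i; cases j) auto
  then show ?thesis using ps by (simp add: ind_path_def)
qed

lemma conn_subset_component:
  assumes "x \<in> C"
  defines "K \<equiv> {y. (\<lambda>x y. E x y \<and> x \<in> C \<and> y \<in> C)\<^sup>*\<^sup>* x y}"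
  shows "x \<in> K \<and> K \<subseteq> C \<and> (\<forall>u\<in>K. \<forall>v\<in>C. E u v \<longrightarrow> v \<in> K)"
proof -
  let ?r = "\<lambda>x y. E x y \<and> x \<in> C \<and> y \<in> C"
  have closed: "y \<in> C" if "?r\<^sup>*\<^sup>* x y" for y
    using that assms(1) by (induction rule: rtranclp_induct) auto
  have sub: "K \<subseteq> C"
  proof
    fix y assume "y \<in> K"
    then have "?r\<^sup>*\<^sup>* x y" by (simp add: K_def)
    then show "y \<in> C" by (rule closed)
  qed
  have "v \<in> K" if u: "u \<in> K" "v \<in> C" "E u v" for u v
  proof -
    have "u \<in> C" by (rule subsetD[OF sub u(1)])
    then have "?r u v" using u by simp
    moreover have "?r\<^sup>*\<^sup>* x u" using u(1) by (simp add: K_def)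
    ultimately have "?r\<^sup>*\<^sup>* x v" by (rule rtranclp.rtrancl_into_rtrancl[rotated])
    then show ?thesis by (simp add: K_def)
  qed
  moreover have "x \<in> K" by (simp add: K_def)
  ultimately show ?thesis using sub by blast
qed

text \<open>Take a smallest dense subset closed under \<open>E\<close> within \<open>C\<close>. If
  it split into two parts without \<open>E\<close>-edges between them, pair counts and weights would
  both add up, and one part would still be dense. Connectivity refers to \<open>E\<close> although
  \<open>G\<close> is counted, because holes are induced with respect to \<open>E\<close>.\<close>

lemma dense_component:
  fixes w :: "'a \<Rightarrow> real" and c :: real
  assumes fin: "finite C" and GE: "\<And>u v. G u v \<Longrightarrow> E u v"
    and dense: "c * sum w C < ec G C"
  shows "\<exists>C'\<subseteq>C. C' \<noteq> {} \<and> conn C' \<and> (\<forall>u\<in>C'. \<forall>v\<in>C. E u v \<longrightarrow> v \<in> C') \<and> c * sum w C' < ec G C'"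
proof -
  define P where "P D \<longleftrightarrow> D \<subseteq> C \<and> (\<forall>u\<in>D. \<forall>v\<in>C. E u v \<longrightarrow> v \<in> D) \<and> c * sum w D < ec G D" for D
  have "P C" using dense by (auto simp: P_def)
  then obtain D where D: "P D" and min: "\<And>D'. P D' \<Longrightarrow> card D \<le> card D'"
    using ex_has_least_nat[of P C card] by blast
  have fD: "finite D" using D fin finite_subset by (auto simp: P_def)
  have ne: "D \<noteq> {}" using D by (auto simp: P_def ec_def)
  have "conn D"
  proof (rule ccontr)
    assume "\<not> conn D"
    then obtain x y where xy: "x \<in> D" "y \<in> D" "\<not> (\<lambda>x y. E x y \<and> x \<in> D \<and> y \<in> D)\<^sup>*\<^sup>* x y"
      by (auto simp: conn_def)
    define K where "K = {y. (\<lambda>x y. E x y \<and> x \<in> D \<and> y \<in> D)\<^sup>*\<^sup>* x y}"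
    have K: "x \<in> K" "K \<subseteq> D" "\<And>u v. u \<in> K \<Longrightarrow> v \<in> D \<Longrightarrow> E u v \<Longrightarrow> v \<in> K"
      using conn_subset_component[OF xy(1)] unfolding K_def by blast+
    have yK: "y \<in> D - K" using xy by (simp add: K_def)
    have eD: "ec G D = ec G K + ec G (D - K)"
      using K GE E_sym fD by (intro ec_split) blast+
    have wD: "sum w D = sum w K + sum w (D - K)"
      using K fD by (simp add: sum.subset_diff[OF K(2) fD])
    have "c * sum w K < ec G K \<or> c * sum w (D - K) < ec G (D - K)"
      using D unfolding P_def eD wD by (auto simp: distrib_left)
    then have "P K \<or> P (D - K)" using D K E_sym unfolding P_def by blast
    moreover have "card K < card D" using yK K fD by (intro psubset_card_mono) auto
    moreover have "card (D - K) < card D" using xy K fD by (intro psubset_card_mono) auto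
    ultimately show False using min by (meson not_le)
  qed
  then show ?thesis using D ne unfolding P_def by blast
qed

end

text \<open>As \<open>w\<close> bounds the degrees, deleting the neighbourhood of a vertex destroys at most \<open>\<W>\<close> edges
  of \<open>F\<close>.\<close>

locale weighted_graph = thin_graph +
  fixes F :: "'a \<Rightarrow> 'a \<Rightarrow> bool" and U :: "'a set" and w :: "'a \<Rightarrow> real" and \<W> :: real
  assumes t_ge: "3 \<le> t"
    and U_sub: "U \<subseteq> V"
    and F_E: "F u v \<Longrightarrow> E u v"
    and F_sym: "F u v \<Longrightarrow> F v u"
    and deg_w: "u \<in> U \<Longrightarrow> card {v \<in> U. F u v} \<le> w u"
    and nb_w: "v \<in> U \<Longrightarrow> sum w (nb v \<inter> U) \<le> \<W>"
    and W_pos: "0 < \<W>"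
begin

lemma finite_U: "finite U" using U_sub finite_V finite_subset by blast

lemma w_nonneg: "u \<in> U \<Longrightarrow> 0 \<le> w u"
  using deg_w[of u] of_nat_0_le_iff order_trans by blast

lemma sum_w_mono: "A \<subseteq> B \<Longrightarrow> B \<subseteq> U \<Longrightarrow> sum w A \<le> sum w B"
  using finite_U w_nonneg by (intro sum_mono2) (auto intro: finite_subset)

lemma ec_touching:
  assumes C: "C \<subseteq> U" and GF: "\<And>u v. G u v \<Longrightarrow> F u v"
    and D: "\<And>u v. u \<in> C \<Longrightarrow> v \<in> C \<Longrightarrow> G u v \<Longrightarrow> u \<in> D \<or> v \<in> D"
  shows "ec G C \<le> 2 * sum w (D \<inter> C)"
proof -
  have fC: "finite C" using C finite_U finite_subset by blast
  define P where "P = Sigma (D \<inter> C) (\<lambda>u. {v \<in> U. F u v})"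
  have fP: "finite P" using fC finite_U by (auto simp: P_def)
  have "{(u, v) \<in> C \<times> C. G u v} \<subseteq> P \<union> (\<lambda>(u, v). (v, u)) ` P"
  proof clarsimp
    fix u v assume *: "u \<in> C" "v \<in> C" "G u v" "(u, v) \<notin> (\<lambda>(u, v). (v, u)) ` P"
    have "(v, u) \<notin> P" using *(4) by force
    then show "(u, v) \<in> P" using * D[of u v] GF[of u v] F_sym C by (auto simp: P_def)
  qed
  then have "ec G C \<le> card (P \<union> (\<lambda>(u, v). (v, u)) ` P)" unfolding ec_def using fP by (intro card_mono) auto
  also have "\<dots> \<le> card P + card P"
    using card_Un_le[of P "(\<lambda>(u, v). (v, u)) ` P"] card_image_le[OF fP, of "\<lambda>(u, v). (v, u)"] by linarith
  also have "card P = (\<Sum>u\<in>D \<inter> C. card {v \<in> U. F u v})" unfolding P_def using fC finite_U by (intro card_SigmaI) auto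
  finally have "real (ec G C) \<le> 2 * (\<Sum>u\<in>D \<inter> C. real (card {v \<in> U. F u v}))"
    by (simp flip: of_nat_sum)
  also have "(\<Sum>u\<in>D \<inter> C. real (card {v \<in> U. F u v})) \<le> sum w (D \<inter> C)"
    using deg_w C by (intro sum_mono) auto
  finally show ?thesis by simp
qed

lemma ec_delete:
  assumes C: "C \<subseteq> U" and GF: "\<And>u v. G u v \<Longrightarrow> F u v"
  shows "ec G C \<le> ec G (C - D) + 2 * sum w (D \<inter> C)"
proof -
  have fC: "finite C" using C finite_U finite_subset by blast
  define G' where "G' u v \<longleftrightarrow> G u v \<and> (u \<in> D \<or> v \<in> D)" for u v
  have "{(u, v) \<in> C \<times> C. G u v} = {(u, v) \<in> (C - D) \<times> (C - D). G u v} \<union> {(u, v) \<in> C \<times> C. G' u v}"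
    by (auto simp: G'_def)
  then have "ec G C \<le> ec G (C - D) + ec G' C" by (simp add: ec_def card_Un_le)
  moreover have "ec G' C \<le> 2 * sum w (D \<inter> C)" using C GF by (intro ec_touching) (auto simp: G'_def)
  ultimately show ?thesis by linarith
qed

text \<open>One step of an induced path whose end \<open>v\<close> sees the dense connected set
  \<open>C\<close>. Deleting \<open>nb v\<close> lowers the density by at most
  \<open>\<epsilon>\<close>, so the rest has a dense component \<open>C'\<close>. As
  \<open>C\<close> is connected, some edge leaves \<open>C'\<close> within \<open>C\<close>, and it
  must lead into \<open>nb v\<close> because \<open>C'\<close> is a full component of the rest. Its
  end \<open>p\<close> continues the path: \<open>p\<close> sees \<open>C'\<close>, which
  \<open>v\<close> does not.\<close>

lemma path_step:
  fixes c \<epsilon> :: real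
  assumes C: "C \<subseteq> U" "conn C" "c * sum w C < ec G C" and GF: "\<And>u v. G u v \<Longrightarrow> F u v"
    and v: "v \<in> U" "u \<in> C" "E v u" and big: "2 * \<W> \<le> \<epsilon> * sum w C" and c: "\<epsilon> \<le> c"
  obtains C' p where "C' \<subseteq> C - nb v" "C' \<noteq> {}" "conn C'" "(c - \<epsilon>) * sum w C' < ec G C'"
    "p \<in> C" "E v p" "\<exists>u\<in>C'. E p u"
proof -
  have fC: "finite C" using C finite_U finite_subset by blast
  have "ec G C \<le> ec G (C - nb v) + 2 * sum w (nb v \<inter> C)" using C GF by (intro ec_delete) auto
  also have "sum w (nb v \<inter> C) \<le> sum w (nb v \<inter> U)" using C by (intro sum_w_mono) auto
  also have "\<dots> \<le> \<W>" using v nb_w by blast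
  finally have "ec G C \<le> ec G (C - nb v) + 2 * \<W>" by simp
  then have "(c - \<epsilon>) * sum w C < ec G (C - nb v)" using C(3) big by (simp add: left_diff_distrib)
  moreover have "(c - \<epsilon>) * sum w (C - nb v) \<le> (c - \<epsilon>) * sum w C"
    using c C sum_w_mono[of "C - nb v" C] by (intro mult_left_mono) auto
  ultimately have "(c - \<epsilon>) * sum w (C - nb v) < ec G (C - nb v)" by linarith
  then have "\<exists>C'\<subseteq>C - nb v. C' \<noteq> {} \<and> conn C' \<and>
      (\<forall>u\<in>C'. \<forall>x\<in>C - nb v. E u x \<longrightarrow> x \<in> C') \<and> (c - \<epsilon>) * sum w C' < ec G C'"
    using fC GF F_E by (intro dense_component) auto
  then obtain C' where C': "C' \<subseteq> C - nb v" "C' \<noteq> {}" "conn C'"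
    "\<And>u x. u \<in> C' \<Longrightarrow> x \<in> C - nb v \<Longrightarrow> E u x \<Longrightarrow> x \<in> C'" "(c - \<epsilon>) * sum w C' < ec G C'"
    by blast
  obtain u' where u': "u' \<in> C'" using C' by blast
  have "u \<in> C - C'" using v C' by auto
  then obtain x y where xy: "x \<in> C'" "y \<in> C - C'" "E x y"
    using conn_exit[OF C(2), of C' u' u] C' u' by blast
  then have vy: "E v y" using C'(4)[of x y] by auto
  have "\<exists>u\<in>C'. E y u" using xy E_sym by blast
  then show thesis using that[OF C'(1,2,3,5) _ vy] xy(2) by blast
qed

text \<open>The invariant is that the last path vertex sees \<open>C'\<close> while all earlier ones
  are anticomplete to it, so a vertex of \<open>C'\<close> adjacent to the last one extends the path
  to an induced one. The density never falls below the floor \<open>b\<close>, above which sets are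
  heavy enough for a deletion to cost at most \<open>\<epsilon>\<close>.\<close>

lemma long_path:
  fixes b c \<epsilon> :: real
  assumes C: "C \<subseteq> U" "conn C" "c * sum w C < ec G C" and GF: "\<And>u v. G u v \<Longrightarrow> F u v"
    and v: "v \<in> U - C" "u \<in> C" "E v u"
    and big: "\<And>D. D \<subseteq> C \<Longrightarrow> b * sum w D < ec G D \<Longrightarrow> 2 * \<W> \<le> \<epsilon> * sum w D"
    and c: "b + n * \<epsilon> \<le> c" "0 \<le> b" "0 \<le> \<epsilon>"
  shows "\<exists>ps C'. length ps = Suc n \<and> hd ps = v \<and> ind_path ps \<and> set (tl ps) \<subseteq> C - C' \<and>
    C' \<subseteq> C \<and> conn C' \<and> C' \<noteq> {} \<and> (\<exists>u\<in>C'. E (last ps) u) \<and> (\<forall>i<n. C' \<inter> nb (ps ! i) = {}) \<and>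
    (c - n * \<epsilon>) * sum w C' < ec G C'"
  using c(1)
proof (induction n)
  case 0
  show ?case using C v by (intro exI[of _ "[v]"] exI[of _ C]) (auto simp: ind_path_def E_irrefl)
next
  case (Suc n)
  have "b + n * \<epsilon> \<le> c" using Suc.prems c by (simp add: distrib_right)
  then obtain ps C' where IH: "length ps = Suc n" "hd ps = v" "ind_path ps" "set (tl ps) \<subseteq> C - C'"
    "C' \<subseteq> C" "conn C'" "C' \<noteq> {}" "\<exists>u\<in>C'. E (last ps) u" "\<And>i. i < n \<Longrightarrow> C' \<inter> nb (ps ! i) = {}"
    "(c - n * \<epsilon>) * sum w C' < ec G C'"
    using Suc.IH by blast
  have psne: "ps \<noteq> []" using IH by auto
  have setps: "set ps = insert v (set (tl ps))" using psne IH(2) by (cases ps) auto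
  have lastU: "last ps \<in> U" "last ps \<notin> C'" using last_in_set[OF psne] setps IH(4,5) C v by auto
  have "b \<le> c - n * \<epsilon>" using Suc.prems c by (simp add: distrib_right)
  then have "b * sum w C' \<le> (c - n * \<epsilon>) * sum w C'"
    using IH C w_nonneg by (intro mult_right_mono sum_nonneg) auto
  then have big': "2 * \<W> \<le> \<epsilon> * sum w C'" using IH big by auto
  obtain u' where u': "u' \<in> C'" "E (last ps) u'" using IH by blast
  have "\<epsilon> \<le> c - n * \<epsilon>" using Suc.prems c by (simp add: distrib_right)
  note eps = this
  have C'U: "C' \<subseteq> U" using IH(5) C(1) by blast
  obtain C'' p where p: "C'' \<subseteq> C' - nb (last ps)" "C'' \<noteq> {}" "conn C''"
    "(c - n * \<epsilon> - \<epsilon>) * sum w C'' < ec G C''" "p \<in> C'" "E (last ps) p" "\<exists>u\<in>C''. E p u"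
    by (rule path_step[OF C'U IH(6) IH(10) GF lastU(1) u' big' eps]) (assumption | (rule that; assumption))+
  have lastn: "last ps = ps ! n" using psne IH(1) by (simp add: last_conv_nth)
  have pn: "E (ps ! i) p \<longleftrightarrow> i = n" if "i < Suc n" for i
    using IH(9)[of i] p(5,6) that lastn by (cases "i = n") auto
  have "p \<notin> set ps" using setps p(5) IH(4,5) v by auto
  then have "ind_path (ps @ [p])"
    using IH(1,3) pn by (intro ind_path_snoc) auto
  moreover have "p \<notin> C''" using p(1,6) by auto
  moreover have "set (tl (ps @ [p])) \<subseteq> C - C''"
  proof -
    have "set (tl (ps @ [p])) = insert p (set (tl ps))" using psne by (cases ps) auto
    then show ?thesis using IH(4,5) p(1,5) \<open>p \<notin> C''\<close> by auto
  qed
  moreover have "C'' \<inter> nb ((ps @ [p]) ! i) = {}" if "i < Suc n" for i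
  proof (cases "i = n")
    case True
    then show ?thesis using p(1) IH(1) lastn by (auto simp: nth_append)
  next
    case False
    then have "C' \<inter> nb (ps ! i) = {}" using that IH(9) by simp
    then show ?thesis using that False p(1) IH(1) by (auto simp: nth_append)
  qed
  moreover have "(c - Suc n * \<epsilon>) * sum w C'' < ec G C''"
  proof -
    have eq: "c - Suc n * \<epsilon> = c - n * \<epsilon> - \<epsilon>" by (simp add: algebra_simps)
    show ?thesis unfolding eq by (rule p(4))
  qed
  moreover have "C'' \<subseteq> C" using p(1) IH(5) by blast
  moreover have "hd (ps @ [p]) = v" using IH(2) psne by simp
  moreover have "length (ps @ [p]) = Suc (Suc n)" "\<exists>u\<in>C''. E (last (ps @ [p])) u"
    using IH(1) p(7) by simp_all
  ultimately show ?case using p(2,3) by blast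
qed

end

text \<open>\<open>T\<close> is a connected set behind \<open>R\<close> and anticomplete to
  \<open>S\<close>, through which two vertices of \<open>R\<close> can be joined without touching a
  path in \<open>S\<close>. \<open>R_T\<close> speaks of distinct vertices so as to cover the first
  layer, where \<open>R\<close> is the root alone and \<open>T\<close> is empty.\<close>

locale layered_graph = weighted_graph +
  fixes T R S :: "'a set" and G :: "'a \<Rightarrow> 'a \<Rightarrow> bool" and b \<epsilon> :: real
  assumes conn_T: "conn T"
    and disj: "T \<inter> S = {}" "T \<inter> R = {}" "R \<inter> S = {}"
    and T_S: "\<And>x y. x \<in> T \<Longrightarrow> y \<in> S \<Longrightarrow> \<not> E x y"
    and R_sub: "R \<subseteq> U" and S_sub: "S \<subseteq> U"
    and R_T: "\<And>q q'. q \<in> R \<Longrightarrow> q' \<in> R \<Longrightarrow> q \<noteq> q' \<Longrightarrow> \<exists>y\<in>T. E q y"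
    and G_F: "\<And>u v. G u v \<Longrightarrow> F u v"
    and b_ge: "0 \<le> b" and eps_ge: "0 \<le> \<epsilon>"
    and big: "\<And>D. D \<subseteq> S \<Longrightarrow> b * sum w D < ec G D \<Longrightarrow> 2 * \<W> \<le> \<epsilon> * sum w D"
    and start: "\<And>D. D \<subseteq> S \<Longrightarrow> b * sum w D < ec G D \<Longrightarrow> \<exists>q\<in>R. \<exists>u\<in>D. E q u"
begin

text \<open>An induced path leaving \<open>R\<close> into \<open>S\<close> forces every vertex of \<open>R\<close> that sees the remaining
  component \<open>C'\<close> to see the path as well: otherwise the path closes up to a long hole through \<open>C'\<close>
  or through \<open>T \<union> C'\<close>.\<close>

lemma path_catches:
  fixes c :: real
  assumes C: "C \<subseteq> S" "conn C" "c * sum w C < ec G C"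
    and q1: "q1 \<in> R" "u \<in> C" "E q1 u"
    and c: "b + t * \<epsilon> \<le> c"
  shows "\<exists>P C'. C' \<subseteq> C \<and> conn C' \<and> C' \<noteq> {} \<and> P \<subseteq> C - C' \<and> card P = t \<and>
    (c - t * \<epsilon>) * sum w C' < ec G C' \<and> (\<forall>q\<in>R. (\<exists>u\<in>C'. E q u) \<longrightarrow> (\<exists>p\<in>P. E q p))"
proof -
  have CU: "C \<subseteq> U" and q1C: "q1 \<in> U - C" using C S_sub q1 R_sub disj by auto
  have bigC: "2 * \<W> \<le> \<epsilon> * sum w D" if "D \<subseteq> C" "b * sum w D < ec G D" for D
    using big[of D] that C by auto
  have "\<exists>ps C'. length ps = Suc t \<and> hd ps = q1 \<and> ind_path ps \<and> set (tl ps) \<subseteq> C - C' \<and>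
    C' \<subseteq> C \<and> conn C' \<and> C' \<noteq> {} \<and> (\<exists>u\<in>C'. E (last ps) u) \<and> (\<forall>i<t. C' \<inter> nb (ps ! i) = {}) \<and>
    (c - t * \<epsilon>) * sum w C' < ec G C'"
    by (rule long_path[OF CU C(2,3) G_F q1C q1(2,3) bigC c b_ge eps_ge])
  then obtain ps C' where ps: "length ps = Suc t" "hd ps = q1" "ind_path ps" "set (tl ps) \<subseteq> C - C'"
    and C': "C' \<subseteq> C" "conn C'" "C' \<noteq> {}" "\<exists>u\<in>C'. E (last ps) u"
      "\<And>i. i < t \<Longrightarrow> C' \<inter> nb (ps ! i) = {}" "(c - t * \<epsilon>) * sum w C' < ec G C'"
    by blast
  define P where "P = set (tl ps)"
  have psne: "ps \<noteq> []" using ps(1) by auto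
  have ps0: "ps ! 0 = q1" using ps(2) psne by (simp add: hd_conv_nth)
  have lastn: "last ps = ps ! t" using ps(1) psne by (simp add: last_conv_nth)
  have psP: "ps ! i \<in> P" if i: "0 < i" "i < Suc t" for i
  proof -
    obtain i' where i': "i = Suc i'" using i by (cases i) auto
    have "ps ! i = tl ps ! i'" using i ps(1) by (simp add: i' nth_tl)
    moreover have "i' < length (tl ps)" using i ps(1) by (simp add: i')
    ultimately show ?thesis by (simp add: P_def)
  qed
  have setps: "set ps = insert q1 P" using psne ps(2) by (cases ps) (auto simp: P_def)
  have PC: "P \<subseteq> C - C'" using ps(4) by (simp add: P_def)
  obtain y1 where y1: "y1 \<in> C'" "E (last ps) y1" using C' by blast
  have "\<exists>p\<in>P. E q p" if q: "q \<in> R" and u': "u' \<in> C'" "E q u'" for q u'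
  proof (rule ccontr)
    assume "\<not> ?thesis"
    then have noP: "\<And>p. p \<in> P \<Longrightarrow> \<not> E q p" by blast
    have "C' \<inter> nb (ps ! 0) = {}" using C'(5)[of 0] t_ge by simp
    then have qq1: "q \<noteq> q1" using u' ps0 by auto
    have qS: "q \<notin> S" using q disj by blast
    have PS: "P \<subseteq> S" "C' \<subseteq> S" using PC C C' by auto
    have qps: "q \<notin> set ps" using setps qq1 qS PS by auto
    have Cps: "C' \<inter> set ps = {}" using setps PC q1C C'(1) by auto
    have inner: "\<not> E (ps ! i) y" if "i < t" "y \<in> C'" for i y using C'(5)[OF that(1)] that(2) by auto
    have lastP: "last ps \<in> P" using psP[of t] t_ge lastn by simp
    show False
    proof (cases "E q q1")
      \<comment> \<open>Here \<open>q\<close> is put in front of \<open>q1\<close>, and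
        \<open>C'\<close> closes the longer path.\<close>
      case True
      have Eps: "E q (ps ! i) \<longleftrightarrow> i = 0" if "i < length ps" for i
        using psP[of i] noP[of "ps ! i"] that ps(1) ps0 True by (cases "i = 0") auto
      have ip: "ind_path (q # ps)" using ps(3) qps Eps by (rule ind_path_Cons)
      have "length (q # ps) < t"
      proof (rule close_path[OF ip _ _ C'(2) _ y1(1) _ u'(1)])
        show "\<not> E (hd (q # ps)) (last (q # ps))" using noP[OF lastP] psne by simp
        show "C' \<inter> set (q # ps) = {}" using Cps qS PS by auto
        show "\<not> E ((q # ps) ! i) y" if "0 < i" "Suc i < length (q # ps)" "y \<in> C'" for i y
          using inner[of "i - 1" y] that ps(1) by (cases i) auto
      qed (use ps(1) y1 u' psne in auto)
      then show False using ps(1) by simp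
    next
      \<comment> \<open>Here \<open>T\<close> leads from a neighbour of \<open>q1\<close> to
        \<open>q\<close>, and \<open>q\<close> leads on to \<open>C'\<close>, which the end of the
        path sees; no inner vertex of the path sees \<open>T\<close>, \<open>q\<close> or
        \<open>C'\<close>.\<close>
      case False
      obtain y where y: "y \<in> T" "E q y" using R_T[OF q q1(1) qq1] by blast
      obtain y0 where y0: "y0 \<in> T" "E q1 y0" using R_T[OF q1(1) q] qq1 by blast
      have cq: "conn ({q} \<union> C')" using u' by (intro conn_Un[of _ _ q u'] conn_singleton C'(2)) auto
      have con: "conn (T \<union> ({q} \<union> C'))"
        by (rule conn_Un[OF conn_T cq y(1), of q]) (use y(2) E_sym in auto)
      have "length ps < t"
      proof (rule close_path[OF ps(3) _ _ con _ _ y1(2)])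
        have "E (ps ! 0) (ps ! t) \<longleftrightarrow> t = Suc 0 \<or> 0 = Suc t"
          using ps(3) by (simp add: ind_path_def ps(1))
        then show "\<not> E (hd ps) (last ps)" using ps(2) ps0 lastn t_ge by simp
        show "(T \<union> ({q} \<union> C')) \<inter> set ps = {}" using Cps qps setps disj PS q1(1) by auto
        show "y0 \<in> T \<union> ({q} \<union> C')" "E (hd ps) y0" using y0 ps(2) by auto
        show "y1 \<in> T \<union> ({q} \<union> C')" using y1 by auto
        show "2 \<le> length ps" using ps(1) t_ge by simp
        show "\<not> E (ps ! i) z" if "0 < i" "Suc i < length ps" "z \<in> T \<union> ({q} \<union> C')" for i z
        proof -
          have piP: "ps ! i \<in> P" using psP that ps(1) by simp
          have "\<not> E (ps ! i) z" if "z \<in> T" using T_S[of z "ps ! i"] that piP PS E_sym by blast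
          moreover have "\<not> E (ps ! i) q" using noP[OF piP] E_sym by blast
          moreover have "\<not> E (ps ! i) z" if "z \<in> C'" using inner[of i z] that \<open>Suc i < length ps\<close> ps(1) by simp
          ultimately show ?thesis using that(3) by blast
        qed
      qed
      then show False using ps(1) by simp
    qed
  qed
  moreover have "card P = t"
  proof -
    have "distinct (tl ps)" using ps(3) by (simp add: ind_path_def distinct_tl)
    then show ?thesis using ps(1) by (simp add: P_def distinct_card)
  qed
  ultimately show ?thesis using PC C'(1-3,6) by blast
qed

text \<open>Each round works inside the component left by the previous one, so the paths are
  disjoint, and a vertex of \<open>R\<close> that sees the final \<open>C'\<close> sees all earlier
  components too. It therefore has a neighbour on each of the \<open>m\<close> paths.\<close>

lemma many_paths_catch:
  fixes c :: real
  assumes C: "C \<subseteq> S" "conn C" "C \<noteq> {}" "c * sum w C < ec G C"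
    and c: "b + m * t * \<epsilon> \<le> c"
  shows "\<exists>Q C'. C' \<subseteq> C \<and> conn C' \<and> C' \<noteq> {} \<and> Q \<subseteq> C - C' \<and> card Q = t * m \<and>
    (c - m * t * \<epsilon>) * sum w C' < ec G C' \<and> (\<forall>q\<in>R. (\<exists>u\<in>C'. E q u) \<longrightarrow> m \<le> card (nb q \<inter> Q))"
  using c
proof (induction m)
  case 0
  show ?case using C by (intro exI[of _ "{}"] exI[of _ C]) auto
next
  case (Suc m)
  have pos: "0 \<le> t * \<epsilon>" using eps_ge by simp
  have sp: "Suc m * t * \<epsilon> = m * t * \<epsilon> + t * \<epsilon>" by (simp add: algebra_simps)
  have "b + m * t * \<epsilon> \<le> c" using Suc.prems pos unfolding sp by linarith
  then obtain Q C' where IH: "C' \<subseteq> C" "conn C'" "C' \<noteq> {}" "Q \<subseteq> C - C'" "card Q = t * m"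
    "(c - m * t * \<epsilon>) * sum w C' < ec G C'"
    "\<And>q u. q \<in> R \<Longrightarrow> u \<in> C' \<Longrightarrow> E q u \<Longrightarrow> m \<le> card (nb q \<inter> Q)"
    using Suc.IH by blast
  have C'S: "C' \<subseteq> S" using IH C by blast
  have c': "b + t * \<epsilon> \<le> c - m * t * \<epsilon>" using Suc.prems unfolding sp by linarith
  have "b * sum w C' \<le> (c - m * t * \<epsilon>) * sum w C'"
    using c' pos C'S S_sub w_nonneg by (intro mult_right_mono sum_nonneg) auto
  then have "b * sum w C' < ec G C'" using IH(6) by linarith
  then obtain q1 u where q1: "q1 \<in> R" "u \<in> C'" "E q1 u" using start C'S by blast
  obtain P C'' where P: "C'' \<subseteq> C'" "conn C''" "C'' \<noteq> {}" "P \<subseteq> C' - C''" "card P = t"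
    "(c - m * t * \<epsilon> - t * \<epsilon>) * sum w C'' < ec G C''"
    "\<forall>q\<in>R. (\<exists>u\<in>C''. E q u) \<longrightarrow> (\<exists>p\<in>P. E q p)"
    using path_catches[OF C'S IH(2,6) q1 c'] by blast
  have fC: "finite C" using C S_sub finite_U finite_subset by meson
  have "Q \<subseteq> C" "P \<subseteq> C" using IH(1,4) P(4) by auto
  then have fin: "finite Q" "finite P" by (auto intro: finite_subset[OF _ fC])
  have dis: "Q \<inter> P = {}" using IH(4) P(4) by blast
  have "card (Q \<union> P) = t * Suc m" using card_Un_disjoint[OF fin dis] IH(5) P(5) by simp
  moreover have "Suc m \<le> card (nb q \<inter> (Q \<union> P))" if q: "q \<in> R" "u \<in> C''" "E q u" for q u
  proof -
    have "m \<le> card (nb q \<inter> Q)" using IH(7) q P(1) by blast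
    moreover obtain p where "p \<in> P" "E q p" using P(7) q by blast
    then have "nb q \<inter> P \<noteq> {}" by auto
    then have "1 \<le> card (nb q \<inter> P)" using fin by (simp add: Suc_le_eq card_gt_0_iff)
    moreover have "card (nb q \<inter> (Q \<union> P)) = card (nb q \<inter> Q) + card (nb q \<inter> P)"
      unfolding Int_Un_distrib using fin dis by (intro card_Un_disjoint) auto
    ultimately show ?thesis by linarith
  qed
  moreover have "(c - Suc m * t * \<epsilon>) * sum w C'' < ec G C''"
  proof -
    have eq: "c - Suc m * t * \<epsilon> = c - m * t * \<epsilon> - t * \<epsilon>" unfolding sp by simp
    show ?thesis unfolding eq by (rule P(6))
  qed
  moreover have "Q \<union> P \<subseteq> C - C''" "C'' \<subseteq> C" using IH(1,4) P(1,4) by auto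
  ultimately show ?case using P(2,3) by blast
qed

end

section \<open>Breadth-first layers of a dense weighted graph\<close>

context weighted_graph
begin

text \<open>The paths give \<open>Q\<close> with \<open>t * m\<close> vertices, at least
  \<open>m\<close> of them seen by each vertex of \<open>R'\<close>: a pair of density at least
  \<open>1 / t\<close>. Weights show that \<open>R'\<close> is large. The pairs in \<open>G\<close>
  have an end in \<open>L\<close>, vertices of \<open>L\<close> in \<open>S\<close> have neighbours
  in \<open>R\<close>, and a single vertex of \<open>R\<close> sees weight at most
  \<open>\<W>\<close>; so a set of weight \<open>\<W> * H\<close> and density above
  \<open>c / 2\<close> is seen by more than \<open>c * H / 4\<close> vertices of
  \<open>R\<close>.\<close>

lemma no_dense_layer:
  fixes c H :: real
  assumes T: "conn T" "T \<inter> S = {}" "T \<inter> R = {}" "\<And>x y. x \<in> T \<Longrightarrow> y \<in> S \<Longrightarrow> \<not> E x y"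
    and R: "R \<subseteq> U" "R \<inter> S = {}" "\<And>q q'. q \<in> R \<Longrightarrow> q' \<in> R \<Longrightarrow> q \<noteq> q' \<Longrightarrow> \<exists>y\<in>T. E q y"
    and S: "S \<subseteq> U" "c * sum w S < ec G S" and GF: "\<And>u v. G u v \<Longrightarrow> F u v"
    and L: "\<And>u v. G u v \<Longrightarrow> u \<in> L \<or> v \<in> L" "\<And>x. x \<in> L \<Longrightarrow> x \<in> S \<Longrightarrow> \<exists>q\<in>R. E q x"
    and bigS: "\<And>D. D \<subseteq> S \<Longrightarrow> c / 2 * sum w D < ec G D \<Longrightarrow> \<W> * H \<le> sum w D"
    and k: "3 \<le> k" "t \<le> 2 * k" and m: "m = (8 * k * l * t) ^ (k * k + 2 * k + 5)"
    and H: "4 * real m * t \<le> c * H" "0 < c"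
  shows False
proof -
  have mpos: "0 < m" using k l_ge t_ge by (simp add: m)
  then have "0 < 4 * real m * t" using t_ge by simp
  then have "0 < c * H" using H by linarith
  then have Hpos: "0 < H" using H(2) by (simp add: zero_less_mult_iff)
  \<comment> \<open>One deletion costs up to \<open>2 * \<W>\<close> pairs, which is a loss of
    density \<open>2 / H\<close> in a set of weight \<open>\<W> * H\<close>; the
    \<open>m * t\<close> deletions together cost at most \<open>c / 2\<close>.\<close>
  define \<epsilon> where "\<epsilon> = 2 / H"
  have mt: "m * t * \<epsilon> \<le> c / 2" using H Hpos by (simp add: \<epsilon>_def field_simps)
  have GE: "G u v \<Longrightarrow> E u v" for u v using GF F_E by blast
  have fS: "finite S" using S finite_U finite_subset by blast
  obtain C where C: "C \<subseteq> S" "C \<noteq> {}" "conn C" "c * sum w C < ec G C"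
    using dense_component[OF fS GE S(2)] by blast
  have start: "\<exists>q\<in>R. \<exists>u\<in>D. E q u" if D: "D \<subseteq> S" "c / 2 * sum w D < ec G D" for D
  proof -
    have "0 \<le> c / 2 * sum w D" using H(2) D S w_nonneg by (intro mult_nonneg_nonneg sum_nonneg) auto
    then have "ec G D \<noteq> 0" using D(2) by linarith
    then have "{(u, v) \<in> D \<times> D. G u v} \<noteq> {}" unfolding ec_def by (metis card.empty)
    then obtain u v where "u \<in> D" "v \<in> D" "G u v" by blast
    then show ?thesis using L D(1) by blast
  qed
  have big': "2 * \<W> \<le> \<epsilon> * sum w D" if "D \<subseteq> S" "c / 2 * sum w D < ec G D" for D
    using bigS[OF that] Hpos by (simp add: \<epsilon>_def field_simps)
  have c': "c / 2 + m * t * \<epsilon> \<le> c" using mt by linarith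
  have "layered_graph V E l t F U w \<W> T R S G (c / 2) \<epsilon>"
    using T R S(1) GF start big' H(2) Hpos
    by (intro layered_graph.intro layered_graph_axioms.intro local.weighted_graph_axioms) (simp_all add: \<epsilon>_def)
  then interpret layered_graph V E l t F U w \<W> T R S G "c / 2" \<epsilon> .
  obtain Q C' where Q: "C' \<subseteq> C" "Q \<subseteq> C - C'" "card Q = t * m" "(c - m * t * \<epsilon>) * sum w C' < ec G C'"
    "\<And>q. q \<in> R \<Longrightarrow> \<exists>u\<in>C'. E q u \<Longrightarrow> m \<le> card (nb q \<inter> Q)"
    using many_paths_catch[OF C(1,3,2,4) c'] by blast
  have C'S: "C' \<subseteq> S" using Q C by blast
  have "c / 2 * sum w C' \<le> (c - m * t * \<epsilon>) * sum w C'"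
    using mt C'S S w_nonneg by (intro mult_right_mono sum_nonneg) auto
  then have e: "c / 2 * sum w C' < ec G C'" using Q(4) by linarith
  define R' where "R' = {q \<in> R. \<exists>u\<in>C'. E q u}"
  have fR': "finite R'" using R(1) finite_U by (auto simp: R'_def intro: finite_subset)
  have fLC: "finite (L \<inter> C')" using C'S fS finite_subset by blast
  have C'U: "C' \<subseteq> U" using C'S S by blast
  have "sum w (L \<inter> C') \<le> (\<Sum>x\<in>L \<inter> C'. \<Sum>q\<in>R'. if E q x then w x else 0)"
  proof (rule sum_mono)
    fix x assume x: "x \<in> L \<inter> C'"
    then obtain q where q: "q \<in> R" "E q x" using L(2) C'S by blast
    then have "q \<in> R'" using x by (auto simp: R'_def)
    moreover have "0 \<le> w x" using x C'U w_nonneg by auto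
    ultimately show "w x \<le> (\<Sum>q\<in>R'. if E q x then w x else 0)"
      using fR' q member_le_sum[of q R' "\<lambda>q. if E q x then w x else 0"] by auto
  qed
  also have "\<dots> = (\<Sum>q\<in>R'. \<Sum>x\<in>L \<inter> C'. if E q x then w x else 0)" by (rule sum.swap)
  also have "\<dots> \<le> (\<Sum>q\<in>R'. \<W>)"
  proof (rule sum_mono)
    fix q assume q: "q \<in> R'"
    have "(\<Sum>x\<in>L \<inter> C'. if E q x then w x else 0) = sum w ((L \<inter> C') \<inter> {x. E q x})"
      by (simp add: sum.inter_restrict[OF fLC])
    also have "\<dots> \<le> sum w (nb q \<inter> U)" using C'U by (intro sum_w_mono) auto
    also have "\<dots> \<le> \<W>" using q R(1) by (intro nb_w) (auto simp: R'_def)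
    finally show "(\<Sum>x\<in>L \<inter> C'. if E q x then w x else 0) \<le> \<W>" .
  qed
  finally have wL: "sum w (L \<inter> C') \<le> card R' * \<W>" by simp
  have "ec G C' \<le> 2 * sum w (L \<inter> C')" using C'U GF L(1) by (intro ec_touching) auto
  then have up: "c / 2 * sum w C' < 2 * (card R' * \<W>)" using wL e by linarith
  have "c / 2 * (\<W> * H) \<le> c / 2 * sum w C'" using bigS[OF C'S e] H(2) by (intro mult_left_mono) auto
  then have "(c * H) * \<W> < (4 * card R') * \<W>" using up by (simp add: mult_ac)
  then have "c * H < 4 * card R'" using W_pos by (simp add: mult_less_cancel_right)
  then have "4 * real m * t < 4 * real (card R')" using H by linarith
  then have "m * t < card R'" by (simp flip: of_nat_mult)
  moreover have "m * 1 \<le> m * t" using t_ge by (intro mult_le_mono2) simp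
  ultimately have mR: "m \<le> card R'" by linarith
  have QV: "Q \<subseteq> V" using Q(2) C S U_sub by blast
  have "card R' * m \<le> card {(x, y) \<in> R' \<times> Q. E x y}"
  proof -
    have "(\<Sum>q\<in>R'. m) \<le> (\<Sum>q\<in>R'. card (nb q \<inter> Q))" using Q(5) by (intro sum_mono) (auto simp: R'_def)
    also have "\<dots> = card (Sigma R' (\<lambda>q. nb q \<inter> Q))" using fR' by simp
    also have "Sigma R' (\<lambda>q. nb q \<inter> Q) = {(x, y) \<in> R' \<times> Q. E x y}" by auto
    finally show ?thesis by simp
  qed
  then have "t * (card R' * m) \<le> t * card {(x, y) \<in> R' \<times> Q. E x y}" by (rule mult_le_mono2)
  then have dense: "card R' * card Q \<le> t * card {(x, y) \<in> R' \<times> Q. E x y}" by (simp add: Q(3) mult_ac)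
  show False
  proof (rule no_dense_pair[OF _ QV _ k dense])
    show "R' \<subseteq> V" using R(1) U_sub by (auto simp: R'_def)
    have "m * 1 \<le> t * m" using t_ge by simp
    then show "(8 * k * l * t) ^ (k * k + 2 * k + 5) \<le> card Q" using Q(3) by (simp flip: m)
  qed (use mR t_ge in \<open>auto simp: m\<close>)
qed

text \<open>Each edge of the component belongs to one \<open>G i\<close>, and each layer to at most
  two of the sets \<open>S i\<close>. If all \<open>S i\<close> with \<open>1 \<le> i\<close> had
  density at most \<open>\<kappa> / 8\<close>, the total would be at most
  \<open>\<kappa> / 4\<close> times the weight, up to \<open>2 * \<W>\<close> for the edges at the
  root; the component is too heavy for that.\<close>

lemma no_dense_weighted:
  fixes \<kappa> H :: real
  assumes dense: "\<kappa> * sum w U < ec F U" "0 < \<kappa>"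
    and big: "\<And>D. D \<subseteq> U \<Longrightarrow> \<kappa> / 16 * sum w D < ec F D \<Longrightarrow> \<W> * H \<le> sum w D"
    and k: "3 \<le> k" "t \<le> 2 * k" and m: "m = (8 * k * l * t) ^ (k * k + 2 * k + 5)"
    and H: "32 * real m * t \<le> \<kappa> * H"
  shows False
proof -
  obtain V0 where V0: "V0 \<subseteq> U" "V0 \<noteq> {}" "conn V0" "\<kappa> * sum w V0 < ec F V0"
    using dense_component[OF finite_U F_E dense(1)] by blast
  obtain r where r: "r \<in> V0" using V0 by blast
  have fV0: "finite V0" using V0 finite_U finite_subset by blast
  define rel where "rel x y \<longleftrightarrow> E x y \<and> x \<in> V0 \<and> y \<in> V0" for x y
  define lay where "lay v = (LEAST n. (rel ^^ n) r v)" for v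
  have rel_sym: "rel y x" if "rel x y" for x y using that E_sym by (auto simp: rel_def)
  have ex: "(rel ^^ lay v) r v" if "v \<in> V0" for v
  proof -
    have "(\<lambda>x y. E x y \<and> x \<in> V0 \<and> y \<in> V0) = rel" by (auto simp: rel_def fun_eq_iff)
    then have "rel\<^sup>*\<^sup>* r v" using V0(3) r that by (auto simp: conn_def)
    then obtain n where "(rel ^^ n) r v" using rtranclp_imp_relpowp by metis
    then show ?thesis unfolding lay_def by (rule LeastI)
  qed
  have lay_le: "lay v \<le> n" if "(rel ^^ n) r v" for v n
    unfolding lay_def using that by (rule Least_le)
  have lay0: "lay v = 0 \<longleftrightarrow> v = r" if "v \<in> V0" for v
    using ex[OF that] lay_le[of 0 r] by auto
  have lay_edge: "lay v \<le> Suc (lay u)" if "rel u v" for u v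
  proof -
    have "u \<in> V0" using that by (simp add: rel_def)
    then have "(rel ^^ Suc (lay u)) r v" using ex[of u] that by auto
    then show ?thesis by (rule lay_le)
  qed
  have lay_pred: "\<exists>u. rel u v \<and> lay u = n" if v: "v \<in> V0" "lay v = Suc n" for v n
  proof -
    have "(rel ^^ Suc n) r v" using ex[OF v(1)] v(2) by simp
    then obtain u where u: "(rel ^^ n) r u" "rel u v" by auto
    then have "lay u = n" using lay_le[OF u(1)] lay_edge[OF u(2)] v(2) by linarith
    then show ?thesis using u by blast
  qed
  \<comment> \<open>\<open>Suc (lay v) < i\<close> describes the layers before \<open>i - 1\<close>
    without subtraction. They form \<open>T\<close>, layer \<open>i - 1\<close> is \<open>R\<close>,
    and layers \<open>i\<close> and \<open>i + 1\<close> form \<open>S i\<close>.\<close>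
  have conn_low: "conn {v \<in> V0. Suc (lay v) < i}" for i
  proof -
    let ?T = "{v \<in> V0. Suc (lay v) < i}"
    let ?r = "\<lambda>x y. E x y \<and> x \<in> ?T \<and> y \<in> ?T"
    have reach: "?r\<^sup>*\<^sup>* r v \<and> ?r\<^sup>*\<^sup>* v r" if "v \<in> V0" "lay v = n" "Suc n < i" for v n
      using that
    proof (induction n arbitrary: v)
      case 0
      then show ?case using lay0 by simp
    next
      case (Suc n)
      obtain u where u: "rel u v" "lay u = n" using lay_pred[OF Suc.prems(1,2)] by blast
      have "u \<in> V0" using u by (simp add: rel_def)
      then have IH: "?r\<^sup>*\<^sup>* r u \<and> ?r\<^sup>*\<^sup>* u r" using Suc.IH[of u] u Suc.prems by simp
      have uv: "?r u v" and vu: "?r v u" using u Suc.prems E_sym by (auto simp: rel_def)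
      show ?case
        using rtranclp.rtrancl_into_rtrancl[where r = ?r, OF conjunct1[OF IH] uv]
          converse_rtranclp_into_rtranclp[where r = ?r, OF vu conjunct2[OF IH]] by blast
    qed
    show ?thesis unfolding conn_def
    proof (intro ballI)
      fix u v assume "u \<in> ?T" "v \<in> ?T"
      then have "?r\<^sup>*\<^sup>* u r" "?r\<^sup>*\<^sup>* r v" using reach[of u] reach[of v] by auto
      then show "?r\<^sup>*\<^sup>* u v" by (rule rtranclp_trans)
    qed
  qed
  define S where "S i = {v \<in> V0. lay v = i \<or> lay v = Suc i}" for i
  \<comment> \<open>An edge is assigned to the lower layer of its ends. So each pair in
    \<open>G i\<close> has an end in layer \<open>i\<close>, which for \<open>1 \<le> i\<close> has
    a neighbour in the previous layer; edges inside layer \<open>i + 1\<close> are left to the next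
    index.\<close>
  define G where "G i u v \<longleftrightarrow> F u v \<and> u \<in> V0 \<and> v \<in> V0 \<and> min (lay u) (lay v) = i" for i u v
  have G_rel: "rel u v" if "G i u v" for i u v using that F_E by (auto simp: G_def rel_def)
  have G_S: "u \<in> S i \<and> v \<in> S i" if "G i u v" for i u v
    using that lay_edge[OF G_rel[OF that]] lay_edge[OF rel_sym[OF G_rel[OF that]]]
    by (auto simp: G_def S_def min_def split: if_splits)
  have eS: "ec (G i) V0 = ec (G i) (S i)" for i
  proof -
    have "{(u, v) \<in> V0 \<times> V0. G i u v} = {(u, v) \<in> S i \<times> S i. G i u v}"
      using G_S by (auto simp: G_def)
    then show ?thesis by (simp add: ec_def)
  qed
  have layer: "ec (G i) (S i) \<le> \<kappa> / 8 * sum w (S i)" if i: "1 \<le> i" for i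
  proof (rule ccontr)
    assume "\<not> ?thesis"
    then have dS: "\<kappa> / 8 * sum w (S i) < ec (G i) (S i)" by simp
    show False
    proof (rule no_dense_layer[where T = "{v \<in> V0. Suc (lay v) < i}" and R = "{v \<in> V0. Suc (lay v) = i}"
          and S = "S i" and G = "G i" and c = "\<kappa> / 8" and L = "{v. lay v = i}" and H = H,
          OF conn_low _ _ _ _ _ _ _ dS _ _ _ _ k m])
      show "\<not> E x y" if "x \<in> {v \<in> V0. Suc (lay v) < i}" "y \<in> S i" for x y
        using that lay_edge[of x y] by (auto simp: rel_def S_def)
      show "\<exists>y\<in>{v \<in> V0. Suc (lay v) < i}. E q y"
        if q: "q \<in> {v \<in> V0. Suc (lay v) = i}" "q' \<in> {v \<in> V0. Suc (lay v) = i}" "q \<noteq> q'" for q q'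
      proof -
        have "lay q \<noteq> 0" using q lay0[of q] lay0[of q'] by auto
        then obtain n where n: "lay q = Suc n" by (cases "lay q") auto
        then obtain u where "rel u q" "lay u = n" using lay_pred[of q n] q by auto
        then show ?thesis using n q E_sym by (auto simp: rel_def)
      qed
      show "\<exists>q\<in>{v \<in> V0. Suc (lay v) = i}. E q x" if x: "x \<in> {v. lay v = i}" "x \<in> S i" for x
      proof -
        obtain n where n: "i = Suc n" using i by (cases i) auto
        then obtain u where "rel u x" "lay u = n" using lay_pred[of x n] x by (auto simp: S_def)
        then show ?thesis using n by (auto simp: rel_def)
      qed
      show "\<W> * H \<le> sum w D" if D: "D \<subseteq> S i" "\<kappa> / 8 / 2 * sum w D < ec (G i) D" for D
      proof (rule big)
        show DU: "D \<subseteq> U" using D(1) V0(1) by (auto simp: S_def)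
        have "ec (G i) D \<le> ec F D"
          using DU finite_U by (intro ec_mono) (auto simp: G_def intro: finite_subset)
        then show "\<kappa> / 16 * sum w D < ec F D" using D(2) by simp
      qed
    qed (use V0(1) dense(2) H in \<open>auto simp: S_def G_def min_def split: if_splits\<close>)
  qed
  \<comment> \<open>No layer precedes the root, so \<open>i = 0\<close> is estimated directly: all
    these edges meet \<open>r\<close>, whose weight is at most \<open>\<W>\<close> because
    \<open>r\<close> lies in the neighbourhood of some \<open>x\<close>.\<close>
  have root: "ec (G 0) V0 \<le> 2 * \<W>"
  proof (cases "ec (G 0) V0 = 0")
    case True
    then show ?thesis using W_pos by simp
  next
    case False
    then have "{(u, v) \<in> V0 \<times> V0. G 0 u v} \<noteq> {}" unfolding ec_def by (metis card.empty)
    then obtain u v where uv: "G 0 u v" by blast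
    have "u = r \<or> v = r" using uv lay0 by (auto simp: G_def min_def split: if_splits)
    then obtain x where x: "rel x r" using G_rel[OF uv] rel_sym by blast
    have "sum w ({r} \<inter> V0) = sum w {r}" using r by simp
    also have "\<dots> \<le> sum w (nb x \<inter> U)" using x V0(1) by (intro sum_w_mono) (auto simp: rel_def)
    also have "\<dots> \<le> \<W>" using x V0(1) by (intro nb_w) (auto simp: rel_def)
    finally have "sum w ({r} \<inter> V0) \<le> \<W>" .
    moreover have "ec (G 0) V0 \<le> 2 * sum w ({r} \<inter> V0)"
      using V0(1) lay0 by (intro ec_touching) (auto simp: G_def min_def split: if_splits)
    ultimately show ?thesis by linarith
  qed
  define N where "N = Suc (Max (lay ` V0))"
  have layN: "lay v < N" if "v \<in> V0" for v using that fV0 by (simp add: N_def less_Suc_eq_le)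
  define f where "f i = sum w {v \<in> V0. lay v = i}" for i
  have fnn: "0 \<le> f i" for i unfolding f_def using w_nonneg V0(1) by (intro sum_nonneg) auto
  have sumf: "(\<Sum>i<Suc N. f i) = sum w V0"
    unfolding f_def using fV0 layN by (intro sum.group) (auto simp: less_Suc_eq)
  have wS: "sum w (S i) = f i + f (Suc i)" for i
  proof -
    have "S i = {v \<in> V0. lay v = i} \<union> {v \<in> V0. lay v = Suc i}" by (auto simp: S_def)
    then show ?thesis unfolding f_def using fV0 by (simp add: sum.union_disjoint disjoint_iff)
  qed
  have sumS: "(\<Sum>i<N. sum w (S i)) \<le> 2 * sum w V0"
  proof -
    have "(\<Sum>i<N. f i) \<le> (\<Sum>i<Suc N. f i)" using fnn by simp
    moreover have "(\<Sum>i<N. f (Suc i)) \<le> (\<Sum>i<Suc N. f i)"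
      using fnn by (simp only: sum.lessThan_Suc_shift) simp
    ultimately show ?thesis using sumf by (simp add: wS sum.distrib)
  qed
  have "{(u, v) \<in> V0 \<times> V0. F u v} \<subseteq> (\<Union>i<N. {(u, v) \<in> V0 \<times> V0. G i u v})"
    using layN by (auto simp: G_def min_def)
  then have "ec F V0 \<le> card (\<Union>i<N. {(u, v) \<in> V0 \<times> V0. G i u v})"
    unfolding ec_def by (intro card_mono finite_UN_I finite_lessThan finite_ec_set fV0)
  also have "\<dots> \<le> (\<Sum>i<N. ec (G i) V0)" unfolding ec_def by (rule card_UN_le) simp
  finally have "real (ec F V0) \<le> (\<Sum>i<N. real (ec (G i) V0))" by (simp flip: of_nat_sum)
  also have "\<dots> \<le> (\<Sum>i<N. \<kappa> / 8 * sum w (S i) + (if i = 0 then 2 * \<W> else 0))"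
  proof (rule sum_mono)
    fix i
    have "0 \<le> \<kappa> / 8 * sum w (S i)" using dense(2) fnn by (simp add: wS)
    then show "real (ec (G i) V0) \<le> \<kappa> / 8 * sum w (S i) + (if i = 0 then 2 * \<W> else 0)"
      using root layer[of i] eS[of i] by (cases "i = 0") auto
  qed
  also have "\<dots> = \<kappa> / 8 * (\<Sum>i<N. sum w (S i)) + 2 * \<W>"
  proof -
    have "(\<Sum>i<N. if i = 0 then 2 * \<W> else 0) = 2 * \<W>" by (simp add: N_def)
    then show ?thesis by (simp only: sum.distrib sum_distrib_left)
  qed
  also have "\<dots> \<le> \<kappa> / 8 * (2 * sum w V0) + 2 * \<W>" using sumS dense(2) by simp
  finally have e1: "\<kappa> * sum w V0 < \<kappa> / 4 * sum w V0 + 2 * \<W>" using V0(4) by simp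
  have w0: "0 \<le> sum w V0" using V0(1) w_nonneg by (intro sum_nonneg) auto
  have "\<kappa> / 16 * sum w V0 \<le> \<kappa> * sum w V0" using dense(2) w0 by (intro mult_right_mono) auto
  then have "\<W> * H \<le> sum w V0" using big[OF V0(1)] V0(4) by linarith
  then have "\<kappa> * (\<W> * H) \<le> \<kappa> * sum w V0" using dense(2) by simp
  moreover have "32 * real m * t * \<W> \<le> \<kappa> * H * \<W>" using H W_pos by (intro mult_right_mono) auto
  moreover have "32 * \<W> \<le> 32 * real m * t * \<W>"
  proof -
    have "1 \<le> m * t" using m k l_ge t_ge by (simp add: Suc_le_eq)
    then have "1 \<le> real (m * t)" by (metis of_nat_1 of_nat_le_iff)
    then have "1 * (32 * \<W>) \<le> real (m * t) * (32 * \<W>)" using W_pos by (intro mult_right_mono) auto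
    then show ?thesis by (simp add: mult_ac)
  qed
  ultimately have "32 * \<W> \<le> \<kappa> * sum w V0" by (simp add: mult_ac)
  then show False using e1 W_pos by linarith
qed

end

subsection \<open>Unbalanced pairs\<close>

lemma ec_remove:
  assumes "finite X" "x \<in> X" "\<And>u v. G u v \<Longrightarrow> G v u"
  shows "ec G X \<le> ec G (X - {x}) + 2 * card {y \<in> X. G x y}"
proof -
  let ?N = "{y \<in> X. G x y}"
  have "{(u, v) \<in> X \<times> X. G u v} \<subseteq>
      {(u, v) \<in> (X - {x}) \<times> (X - {x}). G u v} \<union> (Pair x ` ?N \<union> (\<lambda>y. (y, x)) ` ?N)"
    using assms(2,3) by auto
  then have "ec G X \<le> card ({(u, v) \<in> (X - {x}) \<times> (X - {x}). G u v} \<union> (Pair x ` ?N \<union> (\<lambda>y. (y, x)) ` ?N))"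
    unfolding ec_def using assms(1) finite_ec_set[of "X - {x}" G] by (intro card_mono) auto
  also have "\<dots> \<le> ec G (X - {x}) + (card (Pair x ` ?N) + card ((\<lambda>y. (y, x)) ` ?N))"
    unfolding ec_def by (meson add_left_mono card_Un_le order_trans)
  also have "\<dots> \<le> ec G (X - {x}) + 2 * card ?N"
    using card_image_le[of ?N "Pair x"] card_image_le[of ?N "\<lambda>y. (y, x)"] assms(1) by simp
  finally show ?thesis .
qed

text \<open>Removing a vertex of degree at most \<open>c / 2\<close> would keep the density above
  \<open>c\<close>, which is impossible in a smallest dense subset.\<close>

lemma min_degree_subset:
  fixes c :: real
  assumes "finite K" "\<And>u v. G u v \<Longrightarrow> G v u" "c * card K < ec G K"
  shows "\<exists>X\<subseteq>K. X \<noteq> {} \<and> c * card X < ec G X \<and> (\<forall>x\<in>X. c < 2 * card {y \<in> X. G x y})"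
proof -
  define P where "P X \<longleftrightarrow> X \<subseteq> K \<and> c * card X < ec G X" for X
  have "P K" using assms by (simp add: P_def)
  then obtain X where X: "P X" and min: "\<And>Y. P Y \<Longrightarrow> card X \<le> card Y"
    using ex_has_least_nat[of P K card] by blast
  have fX: "finite X" using X assms(1) finite_subset by (auto simp: P_def)
  have "X \<noteq> {}" using X by (auto simp: P_def ec_def)
  moreover have "c < 2 * card {y \<in> X. G x y}" if x: "x \<in> X" for x
  proof -
    have cX: "card X = Suc (card (X - {x}))" using x fX by (metis card_Suc_Diff1)
    then have "card (X - {x}) < card X" by simp
    then have "\<not> P (X - {x})" using min by (meson not_le)
    then have le: "ec G (X - {x}) \<le> c * card (X - {x})" using X by (auto simp: P_def)
    have "real (card (X - {x})) = real (card X) - 1" using cX by simp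
    then have "ec G (X - {x}) \<le> c * card X - c" using le by (simp add: right_diff_distrib)
    moreover have "real (ec G X) \<le> real (ec G (X - {x}) + 2 * card {y \<in> X. G x y})"
      using ec_remove[OF fX x assms(2)] by (simp only: of_nat_le_iff)
    ultimately show ?thesis using X by (simp add: P_def)
  qed
  ultimately show ?thesis using X by (auto simp: P_def)
qed

text \<open>All neighbours of the first vertex of a longest path lie on that path, and the farthest
  of them closes a cycle. Chords do no harm in the application, where the edges of \<open>G\<close>
  stand for private common neighbours.\<close>

lemma long_cycle:
  assumes X: "finite X" "X \<noteq> {}" and sym: "\<And>u v. G u v \<Longrightarrow> G v u" and irr: "\<And>u. \<not> G u u"
    and deg: "\<And>x. x \<in> X \<Longrightarrow> L \<le> card {y \<in> X. G x y}" and L: "1 \<le> L"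
  shows "\<exists>cs. distinct cs \<and> set cs \<subseteq> X \<and> L < length cs \<and> successively G cs \<and> G (last cs) (hd cs)"
proof -
  define P where "P ps \<longleftrightarrow> ps \<noteq> [] \<and> distinct ps \<and> set ps \<subseteq> X \<and> successively G ps" for ps
  have len: "length ps < Suc (card X)" if "P ps" for ps
    using that X(1) card_mono[of X "set ps"] by (simp add: P_def distinct_card less_Suc_eq_le)
  obtain x0 where "x0 \<in> X" using X by blast
  then have "P [x0]" by (simp add: P_def)
  then obtain ps where ps: "P ps" and max: "\<And>qs. P qs \<Longrightarrow> length qs \<le> length ps"
    using ex_has_greatest_nat[of P "[x0]" length "Suc (card X)"] len by blast
  have p: "ps \<noteq> []" "distinct ps" "set ps \<subseteq> X" "successively G ps" using ps by (auto simp: P_def)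
  define x where "x = hd ps"
  have xX: "x \<in> X" using p by (auto simp: x_def)
  have nbs: "{y \<in> X. G x y} \<subseteq> set ps"
  proof (rule ccontr)
    assume "\<not> ?thesis"
    then obtain y where y: "y \<in> X" "G x y" "y \<notin> set ps" by blast
    then have "P (y # ps)" using p sym by (cases ps) (auto simp: P_def x_def)
    then show False using max by fastforce
  qed
  define I where "I = {i. i < length ps \<and> G x (ps ! i)}"
  have "{y \<in> X. G x y} \<subseteq> (!) ps ` I"
  proof
    fix y assume "y \<in> {y \<in> X. G x y}"
    then obtain i where "i < length ps" "y = ps ! i" "G x y" using nbs by (metis (mono_tags, lifting) in_set_conv_nth mem_Collect_eq subsetD)
    then show "y \<in> (!) ps ` I" by (auto simp: I_def)
  qed
  then have "card {y \<in> X. G x y} \<le> card I" using surj_card_le[of I] by (simp add: I_def)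
  then have LI: "L \<le> card I" using deg[OF xX] by linarith
  have fI: "finite I" by (simp add: I_def)
  have neI: "I \<noteq> {}" using LI L by auto
  define j where "j = Max I"
  have jI: "j \<in> I" using fI neI by (simp add: j_def)
  have "0 \<notin> I" using irr p(1) by (simp add: I_def x_def hd_conv_nth)
  then have "I \<subseteq> {1..j}" using fI by (auto simp: j_def Suc_le_eq intro: gr0I)
  then have "card I \<le> j" using card_mono[of "{1..j}" I] by simp
  then have Lj: "L \<le> j" using LI by linarith
  define cs where "cs = take (Suc j) ps"
  have jl: "j < length ps" "G x (ps ! j)" using jI by (auto simp: I_def)
  have "successively G cs"
    using p(4) successively_append_iff[of G "take (Suc j) ps" "drop (Suc j) ps"] by (simp add: cs_def)
  moreover have "last cs = ps ! j" using jl by (simp add: cs_def take_Suc_conv_app_nth)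
  moreover have "hd cs = x" using p(1) by (simp add: cs_def x_def hd_take)
  ultimately show ?thesis
    using p jl sym Lj by (intro exI[of _ cs]) (auto simp: cs_def dest: in_set_takeD)
qed

context thin_graph
begin

text \<open>Since \<open>ec\<close> is a degree sum, this bounds the average degree of every subset
  by \<open>D\<close>, and hence the degeneracy of \<open>A\<close>.\<close>

definition sparse :: "nat \<Rightarrow> 'a set \<Rightarrow> bool" where
  "sparse D A \<longleftrightarrow> (\<forall>Y\<subseteq>A. ec E Y \<le> D * card Y)"

lemma sparse_low_degree:
  assumes "sparse D A" "Y \<subseteq> A" "Y \<noteq> {}" "finite A"
  shows "\<exists>v\<in>Y. card {u \<in> Y. E v u} \<le> D"
proof (rule ccontr)
  assume "\<not> ?thesis"
  then have *: "D < card {u \<in> Y. E v u}" if "v \<in> Y" for v using that by force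
  have fY: "finite Y" using assms finite_subset by blast
  have "(\<Sum>v\<in>Y. D) < (\<Sum>v\<in>Y. card {u \<in> Y. E v u})" using * fY assms(3) by (intro sum_strict_mono) auto
  then show False using assms(1,2) ec_altdef[OF fY, of E] by (auto simp: sparse_def mult.commute dest!: spec[of _ Y])
qed

lemma sparse_subset: "sparse D A \<Longrightarrow> B \<subseteq> A \<Longrightarrow> sparse D B"
  by (auto simp: sparse_def)

text \<open>A vertex of degree at most \<open>D\<close> is placed last, with all its neighbours as
  predecessors, and the rest is ordered recursively; only the predecessor sets \<open>prv\<close>
  are kept of the order.\<close>

lemma degenerate_orientation:
  assumes "finite B" "sparse D B"
  shows "\<exists>prv. (\<forall>b\<in>B. prv b \<subseteq> nb b \<inter> B \<and> card (prv b) \<le> D) \<and>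
    (\<forall>b\<in>B. \<forall>b'\<in>B. E b b' \<longrightarrow> b \<in> prv b' \<or> b' \<in> prv b)"
  using assms
proof (induction "card B" arbitrary: B)
  case 0
  then show ?case by auto
next
  case (Suc n)
  then have "B \<noteq> {}" by auto
  then obtain v where v: "v \<in> B" "card {u \<in> B. E v u} \<le> D"
    using sparse_low_degree[OF Suc.prems(2) subset_refl] Suc.prems(1) by blast
  have "sparse D (B - {v})" using Suc.prems(2) by (rule sparse_subset) auto
  moreover have "n = card (B - {v})" using v(1) Suc.hyps(2) Suc.prems(1) by simp
  ultimately obtain prv where prv: "\<forall>b\<in>B - {v}. prv b \<subseteq> nb b \<inter> (B - {v}) \<and> card (prv b) \<le> D"
    "\<forall>b\<in>B - {v}. \<forall>b'\<in>B - {v}. E b b' \<longrightarrow> b \<in> prv b' \<or> b' \<in> prv b"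
    using Suc.hyps(1)[of "B - {v}"] Suc.prems(1) by blast
  define prv' where "prv' = prv(v := {u \<in> B. E v u})"
  have "\<forall>b\<in>B. prv' b \<subseteq> nb b \<inter> B \<and> card (prv' b) \<le> D"
    using prv(1) v(2) by (auto simp: prv'_def)
  moreover have "b \<in> prv' b' \<or> b' \<in> prv' b" if b: "b \<in> B" "b' \<in> B" "E b b'" for b b'
  proof (cases "b = v \<or> b' = v")
    case True
    then show ?thesis using b E_sym E_irrefl by (auto simp: prv'_def)
  next
    case False
    then show ?thesis using b prv(2) by (auto simp: prv'_def)
  qed
  ultimately show ?case by blast
qed

lemma sparse_independent_subset:
  assumes "finite A" "sparse D A"
  shows "\<exists>I\<subseteq>A. (\<forall>a\<in>I. \<forall>a'\<in>I. \<not> E a a') \<and> card A \<le> (D + 1) * card I"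
  using assms
proof (induction "card A" arbitrary: A rule: less_induct)
  case less
  show ?case
  proof (cases "A = {}")
    case True
    then show ?thesis by simp
  next
    case False
    then obtain v where v: "v \<in> A" "card {u \<in> A. E v u} \<le> D"
      using sparse_low_degree[OF less.prems(2) subset_refl] less.prems(1) by blast
    define A' where "A' = A - nbc v"
    have "A' \<subset> A" using v by (auto simp: A'_def nbc_def)
    then have "card A' < card A" using less.prems(1) by (rule psubset_card_mono[rotated])
    moreover have "sparse D A'" using less.prems(2) by (rule sparse_subset) (auto simp: A'_def)
    ultimately obtain I where I: "I \<subseteq> A'" "\<forall>a\<in>I. \<forall>a'\<in>I. \<not> E a a'" "card A' \<le> (D + 1) * card I"
      using less.hyps[of A'] less.prems(1) by (auto simp: A'_def)
    have fI: "finite I" using I(1) less.prems(1) by (auto simp: A'_def intro: finite_subset)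
    have "A = A' \<union> insert v {u \<in> A. E v u}" using v by (auto simp: A'_def nbc_def)
    then have "card A \<le> card A' + card (insert v {u \<in> A. E v u})" by (metis card_Un_le)
    also have "card (insert v {u \<in> A. E v u}) \<le> D + 1"
      using v(2) less.prems(1) by (simp add: card_insert_if)
    finally have "card A \<le> (D + 1) * (card I + 1)" using I(3) by simp
    moreover have "v \<notin> I" using I(1) by (auto simp: A'_def nbc_def)
    moreover have "\<forall>a\<in>insert v I. \<forall>a'\<in>insert v I. \<not> E a a'"
      using I(1,2) E_irrefl E_sym by (auto simp: A'_def nbc_def)
    moreover have "insert v I \<subseteq> A" using I(1) v(1) by (auto simp: A'_def)
    ultimately show ?thesis using fI by (intro exI[of _ "insert v I"]) simp
  qed
qed

text \<open>A vertex \<open>b\<close> with fewer than \<open>x\<close> neighbours in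
  \<open>A\<close> is discarded together with these neighbours, which preserves
  \<open>x * card B < card A\<close>. The surviving vertices of \<open>A\<close> lose no neighbour
  in \<open>B\<close>, because every neighbour of a discarded \<open>b\<close> goes with it.\<close>

lemma prune_unbalanced:
  assumes "finite A" "finite B" "x * card B < card A"
  shows "\<exists>A' B'. A' \<subseteq> A \<and> B' \<subseteq> B \<and> A' \<noteq> {} \<and> (\<forall>a\<in>A'. nb a \<inter> B \<subseteq> B') \<and> (\<forall>b\<in>B'. x \<le> card (nb b \<inter> A'))"
  using assms
proof (induction "card B" arbitrary: A B rule: less_induct)
  case less
  show ?case
  proof (cases "\<forall>b\<in>B. x \<le> card (nb b \<inter> A)")
    case True
    then show ?thesis using less.prems by (intro exI[of _ A] exI[of _ B]) auto
  next
    case False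
    then obtain b where b: "b \<in> B" "card (nb b \<inter> A) < x" by force
    have cB: "card B = Suc (card (B - {b}))" using b(1) less.prems(2) by (metis card_Suc_Diff1)
    have "card A \<le> card (A - nb b) + card (nb b \<inter> A)"
      using card_Un_le[of "A - nb b" "nb b \<inter> A"] by (simp add: Un_Diff_Int Int_commute)
    moreover have "x * card B = x * card (B - {b}) + x" by (simp add: cB)
    ultimately have "x * card (B - {b}) < card (A - nb b)" using less.prems(3) b(2) by linarith
    moreover have "card (B - {b}) < card B" by (simp add: cB)
    ultimately obtain A' B' where *: "A' \<subseteq> A - nb b" "B' \<subseteq> B - {b}" "A' \<noteq> {}"
      "\<forall>a\<in>A'. nb a \<inter> (B - {b}) \<subseteq> B'" "\<forall>b\<in>B'. x \<le> card (nb b \<inter> A')"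
      using less.hyps[of "B - {b}" "A - nb b"] less.prems(1,2) by blast
    have "nb a \<inter> B \<subseteq> B'" if "a \<in> A'" for a
    proof
      fix y assume y: "y \<in> nb a \<inter> B"
      have "a \<notin> nb b" using that *(1) by auto
      then have "y \<noteq> b" using y E_sym by auto
      then show "y \<in> B'" using y that *(4) by blast
    qed
    then show ?thesis using * by (intro exI[of _ A'] exI[of _ B']) auto
  qed
qed

end

text \<open>The probability \<open>1 / q ^ card Z\<close> that a random colouring vanishes on
  \<open>Z\<close>, scaled by the number of colourings; the expectations and the union bound below
  are computed in this form.\<close>

lemma card_vanishing:
  assumes "finite B" "Z \<subseteq> B" "0 < q"
  shows "real (card {f \<in> PiE B (\<lambda>_. {..<q}). \<forall>z\<in>Z. f z = 0}) = real q ^ card B / real q ^ card Z"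
proof -
  have "{f \<in> PiE B (\<lambda>_. {..<q}). \<forall>z\<in>Z. f z = 0} = PiE B (\<lambda>z. if z \<in> Z then {0} else {..<q})"
    using assms(2,3) by (auto simp: PiE_def Pi_def split: if_splits)
  then have "card {f \<in> PiE B (\<lambda>_. {..<q}). \<forall>z\<in>Z. f z = 0} = (\<Prod>z\<in>B. card (if z \<in> Z then {0} else {..<q}))"
    using assms(1) by (simp add: card_PiE)
  also have "\<dots> = (\<Prod>z\<in>B. if z \<in> Z then 1 else q)" by (intro prod.cong) auto
  also have "\<dots> = (\<Prod>z\<in>B - Z. q)"
    using assms(1,2) by (intro prod.mono_neutral_cong_right) auto
  also have "\<dots> = q ^ (card B - card Z)"
    using assms(1,2) by (simp add: card_Diff_subset finite_subset)
  finally have "real (card {f \<in> PiE B (\<lambda>_. {..<q}). \<forall>z\<in>Z. f z = 0}) = real q ^ (card B - card Z)" by simp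
  moreover have "card Z \<le> card B" using assms card_mono by blast
  ultimately show ?thesis using assms(3) by (simp add: power_diff)
qed

lemma double_count:
  assumes "finite A" "finite B"
  shows "(\<Sum>a\<in>A. card {b \<in> B. r a b}) = (\<Sum>b\<in>B. card {a \<in> A. r a b})"
proof -
  have "card {b \<in> B. r a b} = (\<Sum>b\<in>B. if r a b then 1 else 0)" for a
    using assms(2) by (simp add: sum.If_cases Int_def)
  moreover have "card {a \<in> A. r a b} = (\<Sum>a\<in>A. if r a b then 1 else 0)" for b
    using assms(1) by (simp add: sum.If_cases Int_def)
  ultimately show ?thesis by (simp only: sum.swap[of _ A B])
qed

context thin_graph
begin

text \<open>Colour \<open>B\<close> uniformly at random with \<open>q\<close> colours. In a degenerate order of \<open>B\<close>, the vertices of colour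
  \<open>0\<close> none of whose predecessors has colour \<open>0\<close> form an independent set. If there were many pairs,
  then many of them would lie in this set and have a common neighbour in \<open>A\<close> that sees nothing else
  of it; a long cycle of such pairs is a hole.\<close>

lemma few_common_neighbour_pairs:
  assumes AB: "A \<subseteq> V" "B \<subseteq> V" and indA: "\<And>a a'. a \<in> A \<Longrightarrow> a' \<in> A \<Longrightarrow> \<not> E a a'"
    and sp: "sparse D B" and hi: "\<And>a. a \<in> A \<Longrightarrow> card (nb a \<inter> B) \<le> hi"
    and q: "q = 2 * (hi + 2 * D)" "0 < q" and k: "3 \<le> k" "t \<le> 2 * k"
  shows "card {(b, b') \<in> B \<times> B. b \<noteq> b' \<and> \<not> E b b' \<and> (\<exists>a\<in>A. E a b \<and> E a b')} \<le> 4 * k * q * card B"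
proof (rule ccontr)
  define P where "P = {(b, b') \<in> B \<times> B. b \<noteq> b' \<and> \<not> E b b' \<and> (\<exists>a\<in>A. E a b \<and> E a b')}"
  assume "\<not> ?thesis"
  then have many: "4 * k * q * card B < card P" by (simp add: P_def)
  have fB: "finite B" using AB finite_V finite_subset by blast
  have fP: "finite P" unfolding P_def by (rule finite_subset[of _ "B \<times> B"]) (use fB in auto)
  obtain prv where prv': "\<forall>b\<in>B. prv b \<subseteq> nb b \<inter> B \<and> card (prv b) \<le> D"
    "\<forall>b\<in>B. \<forall>b'\<in>B. E b b' \<longrightarrow> b \<in> prv b' \<or> b' \<in> prv b"
    using degenerate_orientation[OF fB sp] by blast
  have prv: "\<And>b. b \<in> B \<Longrightarrow> prv b \<subseteq> nb b \<inter> B" "\<And>b. b \<in> B \<Longrightarrow> card (prv b) \<le> D"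
    "\<And>b b'. b \<in> B \<Longrightarrow> b' \<in> B \<Longrightarrow> E b b' \<Longrightarrow> b \<in> prv b' \<or> b' \<in> prv b"
    using prv' by auto
  define \<Omega> where "\<Omega> = PiE B (\<lambda>_. {..<q})"
  have f\<Omega>: "finite \<Omega>" using fB by (auto simp: \<Omega>_def intro: finite_PiE)
  define K where "K f = {b \<in> B. f b = 0 \<and> (\<forall>z\<in>prv b. f z \<noteq> (0::nat))}" for f
  define J where "J f u v \<longleftrightarrow> u \<in> K f \<and> v \<in> K f \<and> u \<noteq> v \<and> (\<exists>a\<in>A. nb a \<inter> K f = {u, v})" for f u v
  define N where "N = real q ^ card B"
  have Npos: "0 < N" using q(2) by (simp add: N_def)
  have vanish: "real (card {f \<in> \<Omega>. \<forall>z\<in>Z. f z = 0}) = N / real q ^ card Z" if "Z \<subseteq> B" for Z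
    unfolding \<Omega>_def N_def using card_vanishing[OF fB that q(2)] .
  have good: "N / (2 * real q ^ 2) \<le> card {f \<in> \<Omega>. J f b b'}" if p: "(b, b') \<in> P" for b b'
  proof -
    obtain a where a: "a \<in> A" "E a b" "E a b'" using p by (auto simp: P_def)
    have b: "b \<in> B" "b' \<in> B" "b \<noteq> b'" "\<not> E b b'" using p by (auto simp: P_def)
    \<comment> \<open>If \<open>b\<close> and \<open>b'\<close> have colour \<open>0\<close> and no
      vertex of \<open>Z\<close> has, then \<open>b\<close> and \<open>b'\<close> lie in
      \<open>K f\<close> and are all that \<open>a\<close> sees of it. Since \<open>Z\<close> has at
      most \<open>q / 2\<close> vertices, each of colour \<open>0\<close> with probability
      \<open>1 / q\<close>, this happens with at least half of the probability
      \<open>1 / q ^ 2\<close>.\<close>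
    define Z where "Z = (nb a \<inter> B \<union> (prv b \<union> prv b')) - {b, b'}"
    have fZ: "finite Z" and ZB: "Z \<subseteq> B" using prv(1)[OF b(1)] prv(1)[OF b(2)] fB
      by (auto simp: Z_def intro: finite_subset)
    have fin: "finite (nb a \<inter> B)" "finite (prv b \<union> prv b')"
      using prv(1)[OF b(1)] prv(1)[OF b(2)] fB by (auto intro: finite_subset)
    have "card Z \<le> card (nb a \<inter> B \<union> (prv b \<union> prv b'))" unfolding Z_def using fin by (intro card_mono) auto
    also have "\<dots> \<le> card (nb a \<inter> B) + (card (prv b) + card (prv b'))"
      by (meson add_left_mono card_Un_le order_trans)
    also have "\<dots> \<le> hi + (D + D)" using hi[OF a(1)] prv(2)[OF b(1)] prv(2)[OF b(2)] by linarith
    finally have cZ: "2 * card Z \<le> q" using q(1) by simp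
    let ?A = "{f \<in> \<Omega>. \<forall>z\<in>{b, b'}. f z = 0}"
    let ?B = "\<lambda>z. {f \<in> \<Omega>. \<forall>z\<in>{b, b', z}. f z = 0}"
    have sub: "?A \<subseteq> {f \<in> \<Omega>. J f b b'} \<union> (\<Union>z\<in>Z. ?B z)"
    proof
      fix f assume f: "f \<in> ?A"
      show "f \<in> {f \<in> \<Omega>. J f b b'} \<union> (\<Union>z\<in>Z. ?B z)"
      proof (cases "\<exists>z\<in>Z. f z = 0")
        case True
        then show ?thesis using f by auto
      next
        case False
        then have nz: "\<And>z. z \<in> Z \<Longrightarrow> f z \<noteq> 0" by auto
        have "b \<notin> prv b" "b' \<notin> prv b'" "b \<notin> prv b'" "b' \<notin> prv b"
          using prv(1)[OF b(1)] prv(1)[OF b(2)] E_irrefl b(4) E_sym by auto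
        then have bK: "b \<in> K f" "b' \<in> K f" using f nz b by (auto simp: K_def Z_def)
        have yb: "y = b \<or> y = b'" if "E a y" "y \<in> K f" for y
        proof (rule ccontr)
          assume "\<not> ?thesis"
          then have "y \<in> Z" using that by (auto simp: Z_def K_def)
          then show False using nz[of y] that by (auto simp: K_def)
        qed
        have "nb a \<inter> K f \<subseteq> {b, b'}"
        proof
          fix y assume "y \<in> nb a \<inter> K f"
          then show "y \<in> {b, b'}" using yb[of y] by simp
        qed
        then have "nb a \<inter> K f = {b, b'}" using a bK by auto
        then have "J f b b'" using bK a(1) b(3) unfolding J_def by blast
        then show ?thesis using f by simp
      qed
    qed
    have fin2: "finite {f \<in> \<Omega>. J f b b'}" "finite (\<Union>z\<in>Z. ?B z)" using f\<Omega> fZ by auto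
    have "card ?A \<le> card ({f \<in> \<Omega>. J f b b'} \<union> (\<Union>z\<in>Z. ?B z))"
      using sub fin2 by (intro card_mono) auto
    also have "\<dots> \<le> card {f \<in> \<Omega>. J f b b'} + card (\<Union>z\<in>Z. ?B z)" by (rule card_Un_le)
    also have "card (\<Union>z\<in>Z. ?B z) \<le> (\<Sum>z\<in>Z. card (?B z))" by (rule card_UN_le[OF fZ])
    finally have "real (card ?A) \<le> real (card {f \<in> \<Omega>. J f b b'} + (\<Sum>z\<in>Z. card (?B z)))"
      by (simp only: of_nat_le_iff)
    also have "\<dots> = card {f \<in> \<Omega>. J f b b'} + (\<Sum>z\<in>Z. real (card (?B z)))" by simp
    also have "(\<Sum>z\<in>Z. real (card (?B z))) = (\<Sum>z\<in>Z. N / real q ^ 3)"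
    proof (rule sum.cong)
      fix z assume "z \<in> Z"
      then have "z \<in> B" "z \<noteq> b" "z \<noteq> b'" using ZB by (auto simp: Z_def)
      then show "real (card (?B z)) = N / real q ^ 3"
        using vanish[of "{b, b', z}"] b by (simp add: numeral_3_eq_3)
    qed simp
    also have "real (card ?A) = N / real q ^ 2"
      using vanish[of "{b, b'}"] b by (simp add: numeral_2_eq_2)
    finally have e: "N / real q ^ 2 \<le> card {f \<in> \<Omega>. J f b b'} + card Z * (N / real q ^ 3)" by simp
    have "real (card Z) * (N / real q ^ 3) \<le> real q / 2 * (N / real q ^ 3)"
      using cZ Npos by (intro mult_right_mono) auto
    also have "\<dots> = N / (2 * real q ^ 2)" using q(2) by (simp add: power2_eq_square power3_eq_cube)
    finally have "real (card Z) * (N / real q ^ 3) \<le> N / (2 * real q ^ 2)" .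
    moreover have "N / real q ^ 2 = N / (2 * real q ^ 2) + N / (2 * real q ^ 2)" by simp
    ultimately show ?thesis using e by linarith
  qed
  define w where "w f = card {p \<in> P. J f (fst p) (snd p)}" for f
  have sumw: "card P * (N / (2 * real q ^ 2)) \<le> (\<Sum>f\<in>\<Omega>. real (w f))"
  proof -
    have "(\<Sum>f\<in>\<Omega>. w f) = (\<Sum>p\<in>P. card {f \<in> \<Omega>. J f (fst p) (snd p)})"
      unfolding w_def by (rule double_count[OF f\<Omega> fP])
    then have "(\<Sum>f\<in>\<Omega>. real (w f)) = (\<Sum>p\<in>P. real (card {f \<in> \<Omega>. J f (fst p) (snd p)}))"
      by (simp only: of_nat_sum[symmetric])
    moreover have "(\<Sum>p\<in>P. N / (2 * real q ^ 2)) \<le> (\<Sum>p\<in>P. real (card {f \<in> \<Omega>. J f (fst p) (snd p)}))"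
      using good by (intro sum_mono) auto
    ultimately show ?thesis by simp
  qed
  have sumK: "(\<Sum>f\<in>\<Omega>. real (card (K f))) \<le> card B * (N / q)"
  proof -
    have "(\<Sum>f\<in>\<Omega>. card (K f)) \<le> (\<Sum>f\<in>\<Omega>. card {b \<in> B. f b = 0})"
      using fB by (intro sum_mono card_mono) (auto simp: K_def)
    also have "\<dots> = (\<Sum>b\<in>B. card {f \<in> \<Omega>. f b = 0})" by (rule double_count[OF f\<Omega> fB])
    finally have "(\<Sum>f\<in>\<Omega>. real (card (K f))) \<le> (\<Sum>b\<in>B. real (card {f \<in> \<Omega>. f b = 0}))"
      by (simp only: of_nat_sum[symmetric] of_nat_le_iff)
    also have "\<dots> = (\<Sum>b\<in>B. N / q)" using vanish[of "{b}" for b] by (intro sum.cong) auto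
    finally show ?thesis by simp
  qed
  \<comment> \<open>On average at least \<open>card P / (2 * q ^ 2)\<close> pairs survive and at
    most \<open>card B / q\<close> vertices are kept. The assumed size of \<open>P\<close> makes the
    first average more than \<open>2 * k\<close> times the bound on the second.\<close>
  have "\<exists>f\<in>\<Omega>. 2 * k * real (card (K f)) < w f"
  proof (rule ccontr)
    assume "\<not> ?thesis"
    then have "(\<Sum>f\<in>\<Omega>. real (w f)) \<le> (\<Sum>f\<in>\<Omega>. 2 * k * real (card (K f)))" by (intro sum_mono) auto
    also have "\<dots> = 2 * k * (\<Sum>f\<in>\<Omega>. real (card (K f)))" by (simp add: sum_distrib_left)
    also have "\<dots> \<le> 2 * k * (card B * (N / q))" using sumK by (intro mult_left_mono) auto
    finally have "card P * (N / (2 * real q ^ 2)) \<le> 2 * k * (card B * (N / q))" using sumw by linarith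
    then have "real (card P) \<le> real (4 * k * q * card B)"
      using Npos q(2) by (simp add: field_simps power2_eq_square)
    then show False using many by (simp only: of_nat_le_iff)
  qed
  then obtain f where f: "2 * real k * card (K f) < w f" by auto
  have fK: "finite (K f)" using fB by (auto simp: K_def)
  have JK: "u \<in> K f \<and> v \<in> K f" if "J f u v" for u v using that unfolding J_def by blast
  have "{p \<in> P. J f (fst p) (snd p)} \<subseteq> {(u, v) \<in> K f \<times> K f. J f u v}" using JK by fastforce
  then have "w f \<le> ec (J f) (K f)" unfolding w_def ec_def by (rule card_mono[OF finite_ec_set[OF fK]])
  then have dense: "2 * real k * card (K f) < ec (J f) (K f)" using f by linarith
  have Jsym: "J f u v \<Longrightarrow> J f v u" for u v unfolding J_def by (metis insert_commute)
  obtain X where X: "X \<subseteq> K f" "X \<noteq> {}" "\<And>x. x \<in> X \<Longrightarrow> 2 * real k < 2 * card {y \<in> X. J f x y}"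
    using min_degree_subset[OF fK Jsym dense] by blast
  have Jirr: "\<not> J f u u" for u by (simp add: J_def)
  have degX: "k \<le> card {y \<in> X. J f x y}" if "x \<in> X" for x using X(3)[OF that] by linarith
  have fX: "finite X" using X(1) fK finite_subset by blast
  have "\<exists>cs. distinct cs \<and> set cs \<subseteq> X \<and> k < length cs \<and> successively (J f) cs \<and> J f (last cs) (hd cs)"
    by (rule long_cycle[OF fX X(2)]) (use Jsym Jirr degX k(1) in simp_all)
  then obtain cs where cs: "distinct cs" "set cs \<subseteq> X" "k < length cs" "successively (J f) cs" "J f (last cs) (hd cs)"
    by blast
  define n where "n = length cs"
  have n: "k < n" "3 \<le> n" using cs(3) k by (auto simp: n_def)
  have csK: "cs ! i \<in> K f" if "i < n" for i
  proof -
    have "cs ! i \<in> set cs" using that by (simp add: n_def)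
    then show ?thesis using cs(2) X(1) by blast
  qed
  have "J f (cs ! i) (cs ! (Suc i mod n))" if i: "i < n" for i
  proof (cases "Suc i = n")
    case True
    have "cs \<noteq> []" using i by (auto simp: n_def)
    then have "last cs = cs ! (n - 1)" "hd cs = cs ! 0" by (simp_all add: n_def last_conv_nth hd_conv_nth)
    moreover have "n - 1 = i" using True by simp
    ultimately have "last cs = cs ! i" "hd cs = cs ! 0" by simp_all
    then show ?thesis using cs(5) True by simp
  next
    case False
    then show ?thesis using i cs(4) by (auto simp: successively_conv_nth n_def)
  qed
  then have "\<forall>i<n. \<exists>a\<in>A. nb a \<inter> K f = {cs ! i, cs ! (Suc i mod n)}" unfolding J_def by blast
  then obtain y where y: "\<And>i. i < n \<Longrightarrow> y i \<in> A" "\<And>i. i < n \<Longrightarrow> nb (y i) \<inter> K f = {cs ! i, cs ! (Suc i mod n)}"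
    by metis
  have cs_eq: "cs ! i = cs ! j \<longleftrightarrow> i = j" if "i < n" "j < n" for i j
    using that cs(1) by (simp add: nth_eq_iff_index_eq n_def)
  have ml: "Suc i mod n < n" for i using n by simp
  have "\<exists>c. ind_cycle E c (2 * n)"
  proof (rule subdivided_ind_cycle[of n E "(!) cs" y])
    show "inj_on ((!) cs) {..<n}" using cs_eq by (auto simp: inj_on_def)
    show "inj_on y {..<n}"
    proof (rule inj_onI)
      fix i j assume ij: "i \<in> {..<n}" "j \<in> {..<n}" "y i = y j"
      then have "{cs ! i, cs ! (Suc i mod n)} = {cs ! j, cs ! (Suc j mod n)}" using y(2)[of i] y(2)[of j] by simp
      then have "i = j \<or> i = Suc j mod n \<and> j = Suc i mod n"
        using cs_eq ml ij by (auto simp: doubleton_eq_iff)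
      then show "i = j" using ij n by (auto simp: Suc_mod_eq split: if_splits)
    qed
    show "E (cs ! i) (y j) \<longleftrightarrow> i = j \<or> i = Suc j mod n" if ij: "i < n" "j < n" for i j
    proof -
      have "E (cs ! i) (y j) \<longleftrightarrow> cs ! i \<in> nb (y j) \<inter> K f" using csK[OF ij(1)] E_sym by auto
      also have "\<dots> \<longleftrightarrow> cs ! i = cs ! j \<or> cs ! i = cs ! (Suc j mod n)" unfolding y(2)[OF ij(2)] by simp
      finally show ?thesis using cs_eq ij ml by simp
    qed
    show "\<not> E (cs ! i) (cs ! j)" if ij: "i < n" "j < n" for i j
    proof
      assume e: "E (cs ! i) (cs ! j)"
      have *: "b \<in> B" "f b = 0" "\<And>z. z \<in> prv b \<Longrightarrow> f z \<noteq> 0" if "b \<in> K f" for b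
        using that by (auto simp: K_def)
      have "cs ! i \<in> prv (cs ! j) \<or> cs ! j \<in> prv (cs ! i)"
        by (rule prv(3)[OF *(1)[OF csK[OF ij(1)]] *(1)[OF csK[OF ij(2)]] e])
      then show False
        using *(3)[OF csK[OF ij(2)], of "cs ! i"] *(3)[OF csK[OF ij(1)], of "cs ! j"]
          *(2)[OF csK[OF ij(1)]] *(2)[OF csK[OF ij(2)]] by argo
    qed
    show "\<not> E (y i) (y j)" if "i < n" "j < n" for i j using indA y(1) that by blast
    show "E u v \<Longrightarrow> E v u" for u v by (rule E_sym)
  qed (use n in simp)
  then show False using no_hole n k by fastforce
qed

text \<open>Averaging over \<open>B'\<close> finds \<open>b\<close>: nonadjacent pairs with a common
  neighbour are few by the colouring argument, adjacent ones by sparsity. The set \<open>Y\<close>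
  contains all neighbours in \<open>B\<close> of each vertex of \<open>X\<close>, at least
  \<open>lo\<close> in number, while \<open>h\<close> is chosen to make
  \<open>card Y \<le> h * lo\<close>; hence density \<open>1 / h\<close>.\<close>

lemma no_unbalanced_pair:
  assumes AB: "A \<subseteq> V" "B \<subseteq> V" and indA: "\<And>a a'. a \<in> A \<Longrightarrow> a' \<in> A \<Longrightarrow> \<not> E a a'"
    and sp: "sparse D B" and lo: "\<And>a. a \<in> A \<Longrightarrow> lo \<le> card (nb a \<inter> B)"
    and hi: "\<And>a. a \<in> A \<Longrightarrow> card (nb a \<inter> B) \<le> hi"
    and k: "3 \<le> k" "t \<le> 2 * k" and h: "8 * k * (hi + 2 * D) + D + 2 \<le> h * lo"
    and big: "(8 * k * l * h) ^ (k * k + 2 * k + 5) \<le> x" "(8 * k * l * h) ^ (k * k + 2 * k + 5) \<le> lo"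
    and unb: "x * card B < card A"
  shows False
proof -
  have fAB: "finite A" "finite B" using AB finite_V finite_subset by blast+
  obtain A' B' where A': "A' \<subseteq> A" "B' \<subseteq> B" "A' \<noteq> {}" "\<And>a. a \<in> A' \<Longrightarrow> nb a \<inter> B \<subseteq> B'"
    "\<And>b. b \<in> B' \<Longrightarrow> x \<le> card (nb b \<inter> A')"
    using prune_unbalanced[OF fAB unb] by blast
  have hpos: "0 < h" using h by (cases h) auto
  have "1 \<le> (8 * k * l * h) ^ (k * k + 2 * k + 5)" using k l_ge hpos by simp
  then have lo1: "1 \<le> lo" using big(2) by linarith
  have nbB: "nb a \<inter> B' = nb a \<inter> B" if "a \<in> A'" for a using A'(2,4) that by blast
  obtain a0 where a0: "a0 \<in> A'" using A'(3) by blast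
  then have "nb a0 \<inter> B \<noteq> {}" using lo[of a0] A'(1) lo1 by fastforce
  then have B'ne: "B' \<noteq> {}" using A'(4)[OF a0] by auto
  have fB': "finite B'" using A'(2) fAB finite_subset by blast
  define q where "q = 2 * (hi + 2 * D)"
  have "lo \<le> hi" using lo[of a0] hi[of a0] a0 A'(1) by fastforce
  then have q0: "0 < q" using lo1 by (simp add: q_def)
  define \<Gamma> where "\<Gamma> b = {b' \<in> B'. b' \<noteq> b \<and> (\<exists>a\<in>A'. E a b \<and> E a b')}" for b
  define P where "P = {(b, b') \<in> B' \<times> B'. b \<noteq> b' \<and> \<not> E b b' \<and> (\<exists>a\<in>A'. E a b \<and> E a b')}"
  have few: "card P \<le> 4 * k * q * card B'" unfolding P_def
  proof (rule few_common_neighbour_pairs[where D = D and hi = hi, OF _ _ _ _ _ q_def q0 k])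
    show "sparse D B'" using sp A'(2) by (rule sparse_subset)
    show "card (nb a \<inter> B') \<le> hi" if "a \<in> A'" for a using hi[of a] A'(1) that nbB[OF that] by auto
    show "\<not> E a a'" if "a \<in> A'" "a' \<in> A'" for a a' using indA that A'(1) by blast
  qed (use AB A'(1,2) in auto)
  have "\<exists>b\<in>B'. card (\<Gamma> b) \<le> 4 * k * q + D"
  proof (rule ccontr)
    assume "\<not> ?thesis"
    then have gt: "4 * k * q + D < card (\<Gamma> b)" if "b \<in> B'" for b using that by force
    have "(\<Sum>b\<in>B'. 4 * k * q + D) < (\<Sum>b\<in>B'. card (\<Gamma> b))" using gt fB' B'ne by (intro sum_strict_mono) auto
    also have "\<dots> = card (Sigma B' \<Gamma>)" using fB' by (intro card_SigmaI[symmetric]) (auto simp: \<Gamma>_def)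
    also have "\<dots> \<le> card (P \<union> {(u, v) \<in> B' \<times> B'. E u v})"
    proof (rule card_mono)
      have "finite P" unfolding P_def by (rule finite_subset[of _ "B' \<times> B'"]) (use fB' in auto)
      then show "finite (P \<union> {(u, v) \<in> B' \<times> B'. E u v})" using finite_ec_set[OF fB', of E] by simp
      show "Sigma B' \<Gamma> \<subseteq> P \<union> {(u, v) \<in> B' \<times> B'. E u v}" by (auto simp: \<Gamma>_def P_def)
    qed
    also have "\<dots> \<le> card P + ec E B'" unfolding ec_def by (rule card_Un_le)
    also have "\<dots> \<le> 4 * k * q * card B' + D * card B'"
      using few sp A'(2) by (intro add_mono) (auto simp: sparse_def)
    finally show False by (simp add: algebra_simps)
  qed
  then obtain b where b: "b \<in> B'" "card (\<Gamma> b) \<le> 4 * k * q + D" by blast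
  define X where "X = nb b \<inter> A'"
  define Y where "Y = insert b (\<Gamma> b)"
  have f\<Gamma>: "finite (\<Gamma> b)" using fB' by (auto simp: \<Gamma>_def)
  have XY: "X \<subseteq> V" "Y \<subseteq> V" using nb_sub A'(2) AB b(1) by (auto simp: X_def Y_def \<Gamma>_def)
  have fX: "finite X" using XY(1) finite_V finite_subset by blast
  have xX: "x \<le> card X" using A'(5)[OF b(1)] by (simp add: X_def)
  have nbY: "nb a \<inter> B \<subseteq> Y" if "a \<in> X" for a
  proof
    fix y assume y: "y \<in> nb a \<inter> B"
    have a: "a \<in> A'" "E a b" using that E_sym by (auto simp: X_def)
    moreover have "y \<in> B'" using y A'(4)[OF a(1)] by auto
    ultimately show "y \<in> Y" using y by (auto simp: Y_def \<Gamma>_def)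
  qed
  have fY: "finite Y" using f\<Gamma> by (simp add: Y_def)
  have loX: "lo \<le> card {y \<in> Y. E a y}" if a: "a \<in> X" for a
  proof -
    have "lo \<le> card (nb a \<inter> B)" using lo[of a] a A'(1) by (auto simp: X_def)
    also have "\<dots> \<le> card {y \<in> Y. E a y}" using nbY[OF a] fY by (intro card_mono) auto
    finally show ?thesis .
  qed
  have "1 \<le> x" using \<open>1 \<le> (8 * k * l * h) ^ (k * k + 2 * k + 5)\<close> big(1) by linarith
  then have "X \<noteq> {}" using xX by auto
  then obtain a where a: "a \<in> X" by blast
  have "card {y \<in> Y. E a y} \<le> card Y" using fY by (intro card_mono) auto
  then have loY: "lo \<le> card Y" using loX[OF a] by linarith
  have "card Y \<le> 4 * k * q + D + 1" using b(2) f\<Gamma> by (simp add: Y_def card_insert_if)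
  also have "\<dots> \<le> h * lo" using h by (simp add: q_def algebra_simps)
  finally have Yh: "card Y \<le> h * lo" .
  have "card X * lo \<le> (\<Sum>a\<in>X. card {y \<in> Y. E a y})" using sum_mono[of X "\<lambda>_. lo"] loX by simp
  also have "\<dots> = card (Sigma X (\<lambda>a. {y \<in> Y. E a y}))" using fX fY by simp
  also have "Sigma X (\<lambda>a. {y \<in> Y. E a y}) = {(x, y) \<in> X \<times> Y. E x y}" by auto
  finally have "h * (card X * lo) \<le> h * card {(x, y) \<in> X \<times> Y. E x y}" by (rule mult_le_mono2)
  moreover have "card X * card Y \<le> card X * (h * lo)" using Yh by (rule mult_le_mono2)
  moreover have "card X * (h * lo) = h * (card X * lo)" by simp
  ultimately have "card X * card Y \<le> h * card {(x, y) \<in> X \<times> Y. E x y}" by linarith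
  then show False using no_dense_pair[OF XY hpos k] big xX loY by linarith
qed

end

subsection \<open>Critical graphs\<close>

lemma ec_cross:
  assumes "finite L" "finite H" "\<And>u v. G u v \<Longrightarrow> G v u"
  shows "ec G (L \<union> H) \<le> ec G L + 2 * (\<Sum>a\<in>L. card {y \<in> H. G a y}) + ec G H"
proof -
  let ?S = "Sigma L (\<lambda>a. {y \<in> H. G a y})"
  have fS: "finite ?S" using assms by auto
  have "{(u, v) \<in> (L \<union> H) \<times> (L \<union> H). G u v} \<subseteq>
      {(u, v) \<in> L \<times> L. G u v} \<union> (?S \<union> prod.swap ` ?S) \<union> {(u, v) \<in> H \<times> H. G u v}"
    using assms(3) by (auto simp: image_iff)
  then have "ec G (L \<union> H) \<le> card ({(u, v) \<in> L \<times> L. G u v} \<union> (?S \<union> prod.swap ` ?S) \<union> {(u, v) \<in> H \<times> H. G u v})"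
    unfolding ec_def using assms fS finite_ec_set[of L G] finite_ec_set[of H G] by (intro card_mono) auto
  also have "\<dots> \<le> card ({(u, v) \<in> L \<times> L. G u v} \<union> (?S \<union> prod.swap ` ?S)) + ec G H"
    unfolding ec_def by (rule card_Un_le)
  also have "card ({(u, v) \<in> L \<times> L. G u v} \<union> (?S \<union> prod.swap ` ?S)) \<le> ec G L + card (?S \<union> prod.swap ` ?S)"
    unfolding ec_def by (rule card_Un_le)
  also have "card (?S \<union> prod.swap ` ?S) \<le> card ?S + card (prod.swap ` ?S)" by (rule card_Un_le)
  also have "card (prod.swap ` ?S) \<le> card ?S" using fS by (rule card_image_le)
  also have "card ?S = (\<Sum>a\<in>L. card {y \<in> H. G a y})" using assms by (intro card_SigmaI) auto
  finally show ?thesis by simp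
qed

lemma cross_le_ec:
  assumes "finite L" "finite H" "L \<inter> H = {}" "\<And>u v. G u v \<Longrightarrow> G v u"
  shows "2 * (\<Sum>a\<in>L. card {y \<in> H. G a y}) \<le> ec G (L \<union> H)"
proof -
  let ?S = "Sigma L (\<lambda>a. {y \<in> H. G a y})"
  have fS: "finite ?S" using assms by auto
  have "card ?S + card (prod.swap ` ?S) = card (?S \<union> prod.swap ` ?S)"
    using fS assms(3) by (intro card_Un_disjoint[symmetric]) auto
  also have "\<dots> \<le> ec G (L \<union> H)"
    unfolding ec_def using assms finite_ec_set[of "L \<union> H" G] by (intro card_mono) auto
  finally have "card ?S + card (prod.swap ` ?S) \<le> ec G (L \<union> H)" .
  moreover have "card (prod.swap ` ?S) = card ?S" by (rule card_image) (auto simp: inj_on_def)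
  moreover have "card ?S = (\<Sum>a\<in>L. card {y \<in> H. G a y})" using assms by (intro card_SigmaI) auto
  ultimately show ?thesis by simp
qed

lemma power_interval:
  fixes m s M :: nat
  assumes "1 \<le> m" "m < s ^ M"
  shows "\<exists>j<M. s ^ j \<le> m \<and> m < s ^ Suc j"
  using assms(2)
proof (induction M)
  case 0
  then show ?case using assms(1) by simp
next
  case (Suc M)
  then show ?case
  proof (cases "m < s ^ M")
    case True
    then show ?thesis using Suc.IH less_Suc_eq by blast
  next
    case False
    then show ?thesis using Suc.prems by (intro exI[of _ M]) auto
  qed
qed

text \<open>Proper subsets of a smallest dense subset \<open>Y\<close> have density at most
  \<open>d\<close>. For \<open>Y\<close> itself one vertex is removed, whose degree is at most
  \<open>card Y - 1\<close>; as \<open>2 \<le> d\<close>, it adds at most another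
  \<open>d * card Y\<close>. This is the factor \<open>2\<close> in the sparsity.\<close>

lemma (in thin_graph) critical_subset:
  assumes X: "finite X" "X \<noteq> {}" and d: "2 \<le> d" and dense: "d * card X \<le> ec E X"
  shows "\<exists>Y\<subseteq>X. Y \<noteq> {} \<and> d * card Y \<le> ec E Y \<and> sparse (2 * d) Y"
proof -
  define P where "P Y \<longleftrightarrow> Y \<subseteq> X \<and> Y \<noteq> {} \<and> d * card Y \<le> ec E Y" for Y
  have "P X" using assms by (simp add: P_def)
  then obtain Y where Y: "P Y" and min: "\<And>Z. P Z \<Longrightarrow> card Y \<le> card Z"
    using ex_has_least_nat[of P X card] by blast
  have fY: "finite Y" using Y X(1) finite_subset by (auto simp: P_def)
  have sub: "ec E Z \<le> d * card Z" if Z: "Z \<subset> Y" for Z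
  proof (cases "Z = {}")
    case False
    have "card Z < card Y" using Z fY by (rule psubset_card_mono[rotated])
    then have "\<not> P Z" using min[of Z] by auto
    then show ?thesis using False Z Y by (auto simp: P_def)
  qed (simp add: ec_def)
  have "ec E Z \<le> 2 * d * card Z" if Z: "Z \<subseteq> Y" for Z
  proof (cases "Z = Y")
    case False
    then have "ec E Z \<le> d * card Z" using sub Z by blast
    then show ?thesis by simp
  next
    case True
    obtain x where x: "x \<in> Y" using Y by (auto simp: P_def)
    have cY: "card Y = Suc (card (Y - {x}))" using x fY by (metis card_Suc_Diff1)
    have "{y \<in> Y. E x y} \<subseteq> Y - {x}" using E_irrefl by auto
    then have "card {y \<in> Y. E x y} \<le> card (Y - {x})" using fY by (intro card_mono) auto
    moreover have "ec E Y \<le> ec E (Y - {x}) + 2 * card {y \<in> Y. E x y}" using fY x E_sym by (rule ec_remove)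
    moreover have "ec E (Y - {x}) \<le> d * card (Y - {x})" using x by (intro sub) auto
    moreover have "2 * card (Y - {x}) \<le> d * card (Y - {x})" using d by simp
    moreover have "d * card (Y - {x}) \<le> d * card Y" using cY by simp
    ultimately have "ec E Y \<le> d * card Y + d * card Y" by linarith
    then show ?thesis using True by simp
  qed
  then have "sparse (2 * d) Y" by (simp add: sparse_def)
  then show ?thesis using Y by (auto simp: P_def)
qed

locale critical_graph = thin_graph +
  fixes X :: "'a set" and d :: nat
  assumes t_ge: "3 \<le> t" and X_sub: "X \<subseteq> V" and X_ne: "X \<noteq> {}"
    and sparse_X: "sparse (2 * d) X" and dense_X: "d * card X \<le> ec E X"
    and d_ge: "8192 \<le> d"
begin

definition deg :: "'a \<Rightarrow> nat" where "deg v = card {y \<in> X. E v y}"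
text \<open>The exponent \<open>4\<close> leaves \<open>Hi\<close> at most
  \<open>2 * card X / d ^ 3\<close> vertices, so an independent set of order
  \<open>card X / d\<close> still exceeds it by more than the factor \<open>d\<close> required of an
  unbalanced pair.\<close>

definition Hi :: "'a set" where "Hi = {v \<in> X. d ^ 4 \<le> deg v}"
definition Lo :: "'a set" where "Lo = X - Hi"

lemma finite_X: "finite X" using X_sub finite_V finite_subset by blast

lemma fin: "finite Hi" "finite Lo" using finite_X by (auto simp: Hi_def Lo_def)

lemma sub: "Hi \<subseteq> X" "Lo \<subseteq> X" "Lo \<union> Hi = X" "Lo \<inter> Hi = {}" by (auto simp: Hi_def Lo_def)

lemma card_X_pos: "0 < card X" using finite_X X_ne by (simp add: card_gt_0_iff)

lemma ec_le: "Y \<subseteq> X \<Longrightarrow> ec E Y \<le> 2 * d * card Y" using sparse_X by (simp add: sparse_def)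

lemma sum_deg: "(\<Sum>v\<in>X. deg v) \<le> 2 * d * card X"
  using ec_le[of X] ec_altdef[OF finite_X, of E] by (simp add: deg_def)

lemma card_mult_le_sum_deg:
  assumes "Y \<subseteq> X" "\<And>v. v \<in> Y \<Longrightarrow> c \<le> deg v"
  shows "card Y * c \<le> 2 * d * card X"
proof -
  have "card Y * c \<le> (\<Sum>v\<in>Y. deg v)" using sum_mono[of Y "\<lambda>_. c" deg] assms(2) by simp
  also have "\<dots> \<le> (\<Sum>v\<in>X. deg v)" using assms(1) finite_X by (intro sum_mono2) auto
  also note sum_deg
  finally show ?thesis .
qed

lemma card_Hi: "card Hi * d ^ 3 \<le> 2 * card X"
proof -
  have "card Hi * d ^ 4 \<le> 2 * d * card X" by (rule card_mult_le_sum_deg) (auto simp: Hi_def)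
  then have "d * (card Hi * d ^ 3) \<le> d * (2 * card X)" by (simp add: power4_eq_xxxx power3_eq_cube mult_ac)
  then show ?thesis using d_ge by simp
qed

lemma card_Hi_small: "64 * card Hi \<le> card X"
proof -
  have "128 * 1 \<le> d * d ^ 2" using d_ge by (intro mult_mono) auto
  then have "card Hi * 128 \<le> card Hi * d ^ 3" by (simp add: power3_eq_cube power2_eq_square mult_ac)
  then show ?thesis using card_Hi by linarith
qed

abbreviation cross :: nat where "cross \<equiv> (\<Sum>a\<in>Lo. card {y \<in> Hi. E a y})"

text \<open>By sparsity the small set \<open>Hi\<close> spans at most \<open>d * card X / 32\<close>
  ordered pairs, so the pairs across or those inside \<open>Lo\<close> make up a constant
  share.\<close>

lemma cases_Lo_Hi: "d * card X \<le> 4 * cross \<or> d * card X \<le> 4 * ec E Lo"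
proof (rule ccontr)
  assume "\<not> ?thesis"
  then have 1: "4 * cross < d * card X" "4 * ec E Lo < d * card X" by auto
  have 2: "ec E X \<le> ec E Lo + 2 * cross + ec E Hi"
    using ec_cross[OF fin(2,1), of E] E_sym sub(3) by simp
  have "ec E Hi \<le> 2 * d * card Hi" using sub by (intro ec_le)
  moreover have "d * (64 * card Hi) \<le> d * card X" using card_Hi_small by (rule mult_le_mono2)
  moreover have "d * (64 * card Hi) = 32 * (2 * d * card Hi)" by simp
  ultimately have "32 * ec E Hi \<le> d * card X" by linarith
  then show False using 1 2 dense_X by linarith
qed

lemma no_heavy_cross:
  assumes big: "(8 * t * l * (16 * (544 * t + 4))) ^ (t * t + 2 * t + 5) \<le> d div 8"
  shows "4 * cross < d * card X"
proof (rule ccontr)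
  define n where "n = card X"
  define g where "g a = card {y \<in> Hi. E a y}" for a
  assume "\<not> ?thesis"
  then have heavy: "d * n \<le> 4 * (\<Sum>a\<in>Lo. g a)" by (simp add: n_def g_def)
  \<comment> \<open>Only \<open>A1\<close> matters. Vertices of \<open>A0\<close> contribute at most
    \<open>d * n / 8\<close>. Those of \<open>A2\<close> have degree above \<open>64 * d\<close>, so
    the degree sum allows at most \<open>n / 32\<close> of them, and sparsity of
    \<open>A2 \<union> Hi\<close> limits their contribution to \<open>d * n / 16\<close>.\<close>
  define A0 where "A0 = {a \<in> Lo. 8 * g a < d}"
  define A1 where "A1 = {a \<in> Lo. d \<le> 8 * g a \<and> g a \<le> 64 * d}"
  define A2 where "A2 = {a \<in> Lo. 64 * d < g a}"
  have fA: "finite A0" "finite A1" "finite A2" using fin by (auto simp: A0_def A1_def A2_def)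
  have Lo: "Lo = A0 \<union> (A1 \<union> A2)" by (auto simp: A0_def A1_def A2_def)
  have "(\<Sum>a\<in>Lo. g a) = (\<Sum>a\<in>A0. g a) + (\<Sum>a\<in>A1 \<union> A2. g a)"
    unfolding Lo using fA by (intro sum.union_disjoint) (auto simp: A0_def A1_def A2_def)
  also have "(\<Sum>a\<in>A1 \<union> A2. g a) = (\<Sum>a\<in>A1. g a) + (\<Sum>a\<in>A2. g a)"
    using fA by (intro sum.union_disjoint) (auto simp: A1_def A2_def)
  finally have split: "(\<Sum>a\<in>Lo. g a) = (\<Sum>a\<in>A0. g a) + ((\<Sum>a\<in>A1. g a) + (\<Sum>a\<in>A2. g a))" .
  have cL: "card Y \<le> n" if "Y \<subseteq> Lo" for Y
    using that sub finite_X unfolding n_def by (intro card_mono) auto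
  have s0: "8 * (\<Sum>a\<in>A0. g a) \<le> d * n"
  proof -
    have "(\<Sum>a\<in>A0. 8 * g a) \<le> (\<Sum>a\<in>A0. d)" by (intro sum_mono) (auto simp: A0_def)
    moreover have "card A0 * d \<le> n * d" using cL[of A0] by (intro mult_le_mono1) (auto simp: A0_def)
    moreover have "8 * (\<Sum>a\<in>A0. g a) = (\<Sum>a\<in>A0. 8 * g a)" by (rule sum_distrib_left)
    moreover have "(\<Sum>a\<in>A0. d) = card A0 * d" "n * d = d * n" by simp_all
    ultimately show ?thesis by linarith
  qed
  have g_deg: "g a \<le> deg a" for a unfolding g_def deg_def using finite_X sub(1) by (intro card_mono) auto
  have c2: "32 * card A2 \<le> n"
  proof -
    have "card A2 * (64 * d) \<le> 2 * d * card X"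
    proof (rule card_mult_le_sum_deg)
      show "64 * d \<le> deg v" if "v \<in> A2" for v using that g_deg[of v] by (auto simp: A2_def)
    qed (use sub in \<open>auto simp: A2_def\<close>)
    then have "(2 * d) * (32 * card A2) \<le> (2 * d) * n" by (simp add: n_def mult_ac)
    then show ?thesis using d_ge by simp
  qed
  have s2: "16 * (\<Sum>a\<in>A2. g a) \<le> d * n"
  proof -
    have "2 * (\<Sum>a\<in>A2. g a) \<le> ec E (A2 \<union> Hi)"
      unfolding g_def using fA fin sub(4) E_sym by (intro cross_le_ec) (auto simp: A2_def)
    also have "\<dots> \<le> 2 * d * card (A2 \<union> Hi)" using sub by (intro ec_le) (auto simp: A2_def)
    also have "\<dots> \<le> 2 * d * (card A2 + card Hi)" by (intro mult_le_mono2 card_Un_le)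
    finally have "8 * (2 * (\<Sum>a\<in>A2. g a)) \<le> 8 * (2 * d * (card A2 + card Hi))" by (rule mult_le_mono2)
    also have "\<dots> = d * (16 * (card A2 + card Hi))" by simp
    also have "\<dots> \<le> d * n" using c2 card_Hi_small by (intro mult_le_mono2) (simp add: n_def)
    finally show ?thesis by simp
  qed
  have s1: "d * n \<le> 16 * (\<Sum>a\<in>A1. g a)" using heavy split s0 s2 by linarith
  also have "\<dots> \<le> 16 * (\<Sum>a\<in>A1. 64 * d)" by (intro mult_le_mono2 sum_mono) (auto simp: A1_def)
  finally have "d * n \<le> d * (1024 * card A1)" by simp
  then have n1: "n \<le> 1024 * card A1" using d_ge by simp
  have sp1: "sparse (2 * d) A1" using sparse_X by (rule sparse_subset) (use sub in \<open>auto simp: A1_def\<close>)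
  obtain A where A: "A \<subseteq> A1" "\<forall>a\<in>A. \<forall>a'\<in>A. \<not> E a a'" "card A1 \<le> (2 * d + 1) * card A"
    using sparse_independent_subset[OF fA(2) sp1] by blast
  have "(2 * d + 1) * card A \<le> 3 * d * card A" using d_ge by (intro mult_le_mono1) simp
  with A(3) have "card A1 \<le> 3 * d * card A" by (rule order_trans)
  then have "1024 * card A1 \<le> 1024 * (3 * d * card A)" by (rule mult_le_mono2)
  then have n2: "n \<le> 3072 * d * card A" using n1 by simp
  \<comment> \<open>\<open>A\<close> has at least \<open>n / (3072 * d)\<close> vertices and
    \<open>Hi\<close> at most \<open>2 * n / d ^ 3\<close>; the ratio \<open>d ^ 2 / 6144\<close>
    exceeds \<open>d\<close> because \<open>8192 \<le> d\<close>.\<close>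
  have unb: "d * card Hi < card A"
  proof (rule ccontr)
    assume "\<not> ?thesis"
    then have le: "card A \<le> d * card Hi" by simp
    have "d * (d * (d * card Hi)) = card Hi * d ^ 3" by (simp add: power3_eq_cube mult_ac)
    also have "\<dots> \<le> 2 * n" using card_Hi by (simp add: n_def)
    also have "\<dots> \<le> d * (6144 * (d * card Hi))"
    proof -
      have "3072 * d * card A \<le> 3072 * d * (d * card Hi)" using le by (rule mult_le_mono2)
      moreover have "2 * (3072 * d * (d * card Hi)) = d * (6144 * (d * card Hi))" by simp
      ultimately show ?thesis using n2 by linarith
    qed
    finally have "d * (d * (d * card Hi)) \<le> d * (6144 * (d * card Hi))" .
    then have "d * (d * card Hi) \<le> 6144 * (d * card Hi)" using d_ge by simp
    moreover have "8192 * (d * card Hi) \<le> d * (d * card Hi)" using d_ge by (rule mult_le_mono1)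
    ultimately have "d * card Hi = 0" by linarith
    then have "card A = 0" using le by linarith
    then show False using n2 card_X_pos by (simp add: n_def)
  qed
  have nbg: "card (nb a \<inter> Hi) = g a" for a
  proof -
    have "nb a \<inter> Hi = {y \<in> Hi. E a y}" by auto
    then show ?thesis by (simp add: g_def)
  qed
  show False
  proof (rule no_unbalanced_pair[where A = A and B = Hi and D = "2 * d" and lo = "d div 8" and hi = "64 * d"
        and k = t and h = "16 * (544 * t + 4)" and x = d])
    show "A \<subseteq> V" "Hi \<subseteq> V" using A(1) sub X_sub by (auto simp: A1_def)
    show "sparse (2 * d) Hi" using sparse_X sub(1) by (rule sparse_subset)
    show "d div 8 \<le> card (nb a \<inter> Hi)" if "a \<in> A" for a
      using that A(1) unfolding nbg by (auto simp: A1_def)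
    show "card (nb a \<inter> Hi) \<le> 64 * d" if "a \<in> A" for a
      using that A(1) unfolding nbg by (auto simp: A1_def)
    \<comment> \<open>\<open>64 * d + 2 * (2 * d) = 68 * d\<close> and \<open>8 * 68 = 544\<close>;
      the factor \<open>16\<close> makes up for \<open>d div 8\<close> with its rounding.\<close>
    show "8 * t * (64 * d + 2 * (2 * d)) + 2 * d + 2 \<le> 16 * (544 * t + 4) * (d div 8)"
    proof -
      have "d \<le> 16 * (d div 8)" using d_ge by linarith
      then have "(544 * t + 4) * d \<le> (544 * t + 4) * (16 * (d div 8))" by (rule mult_le_mono2)
      moreover have "8 * t * (64 * d + 2 * (2 * d)) + 2 * d + 2 \<le> (544 * t + 4) * d"
        using d_ge by (simp add: algebra_simps)
      moreover have "(544 * t + 4) * (16 * (d div 8)) = 16 * (544 * t + 4) * (d div 8)" by simp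
      ultimately show ?thesis by linarith
    qed
    show "(8 * t * l * (16 * (544 * t + 4))) ^ (t * t + 2 * t + 5) \<le> d" using big by linarith
  qed (use A(2) unb big t_ge in auto)
qed

end

section \<open>The nearly regular case: two degree classes\<close>

lemma finite_related_pairs: "finite A \<Longrightarrow> finite B \<Longrightarrow> finite {(a, b) \<in> A \<times> B. Q a b}"
  by (rule finite_subset[of _ "A \<times> B"]) auto

lemma pigeonhole_pairs:
  assumes S: "S \<subseteq> (\<Union>i<M. \<Union>j<M. P i j)" and fin: "\<And>i j. finite (P i j)" and ne: "S \<noteq> {}"
  shows "\<exists>i<M. \<exists>j<M. card S \<le> M * M * card (P i j)"
proof (rule ccontr)
  assume "\<not> ?thesis"
  then have lt: "M * M * card (P i j) < card S" if "i < M" "j < M" for i j using that by force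
  have M: "0 < M" using S ne by auto
  have "card S \<le> card (\<Union>i<M. \<Union>j<M. P i j)" using S fin by (intro card_mono) auto
  also have "\<dots> \<le> (\<Sum>i<M. card (\<Union>j<M. P i j))" by (rule card_UN_le) simp
  also have "\<dots> \<le> (\<Sum>i<M. \<Sum>j<M. card (P i j))" by (intro sum_mono card_UN_le) simp
  finally have "M * M * card S \<le> M * M * (\<Sum>i<M. \<Sum>j<M. card (P i j))" by (rule mult_le_mono2)
  also have "\<dots> = (\<Sum>i<M. \<Sum>j<M. M * M * card (P i j))" by (simp only: sum_distrib_left)
  also have "\<dots> < (\<Sum>i<M. \<Sum>j<M. card S)"
    using lt M by (intro sum_strict_mono) auto
  finally show False by simp
qed

context critical_graph
begin

text \<open>Degrees in \<open>Lo\<close> are less than \<open>d\<^sup>4 = s\<^bsup>4N\<^esup>\<close>, so there are just \<open>(4N)\<^sup>2\<close> pairs of classes.\<close>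

lemma degree_classes:
  assumes d: "d = s ^ N" and s: "1 < s" and dense: "d * card X \<le> 4 * ec E Lo"
  defines "C \<equiv> (\<lambda>j. {v \<in> X. s ^ j \<le> deg v \<and> deg v < s ^ Suc j})"
  shows "\<exists>i j. i \<le> j \<and> d * card X \<le> 4 * (4 * N) * (4 * N) * card {(a, b) \<in> C i \<times> C j. E a b}"
proof -
  define M where "M = 4 * N"
  have cls: "\<exists>j<M. v \<in> C j" if v: "v \<in> Lo" "1 \<le> deg v" for v
  proof -
    have "deg v < s ^ M"
    proof -
      have "deg v < d ^ 4" using v by (auto simp: Lo_def Hi_def)
      also have "d ^ 4 = s ^ (N * 4)" unfolding d by (simp only: power_mult)
      finally show ?thesis by (simp add: M_def mult.commute)
    qed
    then show ?thesis using power_interval[of "deg v" s M] v sub(2) by (auto simp: C_def)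
  qed
  have deg1: "1 \<le> deg u" if "u \<in> X" "v \<in> X" "E u v" for u v
  proof -
    have "v \<in> {y \<in> X. E u y}" using that by simp
    moreover have "finite {y \<in> X. E u y}" using finite_X by simp
    ultimately have "0 < card {y \<in> X. E u y}" by (metis card_gt_0_iff empty_iff)
    then show ?thesis by (simp add: deg_def)
  qed
  let ?S = "{(u, v) \<in> Lo \<times> Lo. E u v}"
  have ne: "?S \<noteq> {}"
  proof
    assume e: "?S = {}"
    have "ec E Lo = 0" unfolding ec_def e by simp
    then show False using dense d_ge card_X_pos by simp
  qed
  have incl: "?S \<subseteq> (\<Union>i<M. \<Union>j<M. {(a, b) \<in> C i \<times> C j. E a b})"
  proof clarify
    fix u v assume uv: "u \<in> Lo" "v \<in> Lo" "E u v"
    then have "u \<in> X" "v \<in> X" using sub by auto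
    then obtain i j where "i < M" "u \<in> C i" "j < M" "v \<in> C j"
      using cls[of u] cls[of v] deg1[of u v] deg1[of v u] uv E_sym by metis
    then show "(u, v) \<in> (\<Union>i<M. \<Union>j<M. {(a, b) \<in> C i \<times> C j. E a b})" using uv by blast
  qed
  have fC: "finite {(a, b) \<in> C i \<times> C j. E a b}" for i j
    by (rule finite_subset[of _ "X \<times> X"]) (use finite_X in \<open>auto simp: C_def\<close>)
  obtain i j where ij: "card ?S \<le> M * M * card {(a, b) \<in> C i \<times> C j. E a b}"
    using pigeonhole_pairs[OF incl fC ne] by blast
  have "d * card X \<le> 4 * (M * M * card {(a, b) \<in> C i \<times> C j. E a b})"
    using dense ij unfolding ec_def by linarith
  then have *: "d * card X \<le> 4 * M * M * card {(a, b) \<in> C i \<times> C j. E a b}" by simp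
  show ?thesis
  proof (cases "i \<le> j")
    case True
    then show ?thesis using * by (auto simp: M_def)
  next
    case False
    have "{(a, b) \<in> C j \<times> C i. E a b} = prod.swap ` {(a, b) \<in> C i \<times> C j. E a b}"
      using E_sym by (auto simp: image_iff)
    then have "card {(a, b) \<in> C j \<times> C i. E a b} = card {(a, b) \<in> C i \<times> C j. E a b}"
      by (simp add: card_image)
    then show ?thesis using * False by (intro exI[of _ j] exI[of _ i]) (auto simp: M_def)
  qed
qed

text \<open>The value \<open>16 * e + 5\<close> comes from the dense pairs to be excluded. With
  \<open>h = 64 * s ^ 14\<close> the base \<open>8 * t * l * h\<close> is at most
  \<open>s ^ 16\<close>, so the sides need \<open>s ^ (16 * e)\<close> vertices; they have at least
  \<open>d / (8 * s ^ 4)\<close>, and \<open>s ^ 5\<close> covers \<open>8 * s ^ 4\<close>.\<close>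

lemma no_light:
  assumes d: "d = s ^ N" and N: "N = 16 * e + 5" and e: "e = t * t + 2 * t + 5"
    and s: "64 \<le> s" "8 * (4 * N) * (4 * N) \<le> s" "32 * t \<le> s" "(8 * t * l * t) ^ e \<le> s" "8 * t * l \<le> s"
  shows "4 * ec E Lo < d * card X"
proof (rule ccontr)
  define n where "n = card X"
  assume "\<not> ?thesis"
  then have "d * card X \<le> 4 * ec E Lo" by simp
  with d s(1) obtain i j where ij: "i \<le> j"
    and heavy: "d * n \<le> 4 * (4 * N) * (4 * N) * card {(a, b) \<in> {v \<in> X. s ^ i \<le> deg v \<and> deg v < s ^ Suc i} \<times>
      {v \<in> X. s ^ j \<le> deg v \<and> deg v < s ^ Suc j}. E a b}"
    unfolding n_def using degree_classes[of s N] by fastforce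
  define A where "A = {v \<in> X. s ^ i \<le> deg v \<and> deg v < s ^ Suc i}"
  define B where "B = {v \<in> X. s ^ j \<le> deg v \<and> deg v < s ^ Suc j}"
  define f where "f = card {(a, b) \<in> A \<times> B. E a b}"
  have fAB: "finite A" "finite B" and ABX: "A \<subseteq> X" "B \<subseteq> X" using finite_X by (auto simp: A_def B_def)
  have s0: "0 < s" using s by simp
  have pw: "s ^ 5 = s ^ 4 * s" "s ^ 6 = s ^ 5 * s" "s ^ 14 = s ^ 6 * s ^ 8" "s ^ 15 = s ^ 14 * s"
    "s ^ 16 = s ^ 15 * s" "s ^ 6 = s ^ 2 * s ^ 4"
    using power_add[of s 4 1] power_add[of s 5 1] power_add[of s 6 8] power_add[of s 14 1]
      power_add[of s 15 1] power_add[of s 2 4] by simp_all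
  have f1: "2 * (d * n) \<le> s * f"
  proof -
    have "2 * (d * n) \<le> 2 * (4 * (4 * N) * (4 * N) * f)" using heavy by (simp add: A_def B_def f_def)
    also have "\<dots> = 8 * (4 * N) * (4 * N) * f" by simp
    also have "\<dots> \<le> s * f" using s(2) by (rule mult_le_mono1)
    finally show ?thesis .
  qed
  have "card A * s ^ i \<le> 2 * d * card X" by (rule card_mult_le_sum_deg) (auto simp: A_def)
  then have cA: "card A * s ^ i \<le> s * f" using f1 by (simp add: n_def)
  have "card B * s ^ j \<le> 2 * d * card X" by (rule card_mult_le_sum_deg) (auto simp: B_def)
  then have cB: "card B * s ^ j \<le> s * f" using f1 by (simp add: n_def)
  have n0: "0 < n" using card_X_pos by (simp add: n_def)
  have "0 < d * n" using n0 d_ge by simp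
  then have f0: "0 < f" using f1 by (cases f) auto
  \<comment> \<open>Even the lower class has degrees not much below \<open>d\<close>, since at most
    \<open>n\<close> vertices of degree less than \<open>s ^ Suc i\<close> account for all
    \<open>f\<close> pairs.\<close>
  have di: "d \<le> s ^ (i + 2)"
  proof -
    have "f = (\<Sum>a\<in>A. card {b \<in> B. E a b})"
    proof -
      have "{(a, b) \<in> A \<times> B. E a b} = Sigma A (\<lambda>a. {b \<in> B. E a b})" by auto
      then show ?thesis using fAB by (simp add: f_def)
    qed
    also have "\<dots> \<le> (\<Sum>a\<in>A. s ^ Suc i)"
    proof (rule sum_mono)
      fix a assume a: "a \<in> A"
      have "card {b \<in> B. E a b} \<le> deg a" unfolding deg_def using ABX finite_X by (intro card_mono) auto
      then show "card {b \<in> B. E a b} \<le> s ^ Suc i" using a by (auto simp: A_def)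
    qed
    also have "\<dots> = card A * s ^ Suc i" by simp
    also have "\<dots> \<le> n * s ^ Suc i" unfolding n_def using ABX finite_X by (intro mult_le_mono1 card_mono) auto
    finally have "s * f \<le> s * (n * s ^ Suc i)" by (rule mult_le_mono2)
    moreover have "s * (n * s ^ Suc i) = n * s ^ (i + 2)" by simp
    moreover have "n * d = d * n" by simp
    ultimately have "n * d \<le> n * s ^ (i + 2)" using f1 by linarith
    then show ?thesis using n0 by simp
  qed
  \<comment> \<open>A vertex with many neighbours inside \<open>B\<close> could have a neighbourhood
    of weight about \<open>q * q\<close> instead of \<open>p * q\<close>. Sparsity makes such
    vertices rare, and this \<open>K\<close> is large enough to lose at most half of
    \<open>f\<close> and small enough to stay below \<open>p\<close>.\<close>
  define K where "K = 4 * s ^ 2 * d"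
  define B' where "B' = {b \<in> B. card (nb b \<inter> B) \<le> K}"
  define f' where "f' = card {(a, b) \<in> A \<times> B'. E a b}"
  have fB': "finite B'" and B'X: "B' \<subseteq> X" and B'B: "B' \<subseteq> B" using fAB ABX by (auto simp: B'_def)
  have ff': "f \<le> 2 * f'"
  proof -
    have "card (B - B') * K \<le> (\<Sum>b\<in>B - B'. card {y \<in> B. E b y})"
    proof -
      have "nb b \<inter> B = {y \<in> B. E b y}" for b by auto
      then have "K \<le> card {y \<in> B. E b y}" if "b \<in> B - B'" for b using that by (auto simp: B'_def)
      then show ?thesis using sum_mono[of "B - B'" "\<lambda>_. K"] by simp
    qed
    also have "\<dots> \<le> (\<Sum>b\<in>B. card {y \<in> B. E b y})" using fAB by (intro sum_mono2) auto
    also have "\<dots> = ec E B" using fAB by (simp add: ec_altdef)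
    also have "\<dots> \<le> 2 * d * card B" using ABX by (intro ec_le)
    finally have "(2 * d) * (2 * s ^ 2 * card (B - B')) \<le> (2 * d) * card B" by (simp add: K_def mult_ac)
    then have few: "2 * s ^ 2 * card (B - B') \<le> card B" using d_ge by (simp add: mult_ac)
    have "{(a, b) \<in> A \<times> B. E a b} \<subseteq> {(a, b) \<in> A \<times> B'. E a b} \<union> prod.swap ` Sigma (B - B') (\<lambda>b. {a \<in> X. E b a})"
      using ABX E_sym by (auto simp: image_iff)
    then have "f \<le> card ({(a, b) \<in> A \<times> B'. E a b} \<union> prod.swap ` Sigma (B - B') (\<lambda>b. {a \<in> X. E b a}))"
      unfolding f_def using fAB fB' finite_X
      by (intro card_mono finite_UnI finite_related_pairs finite_imageI finite_SigmaI) auto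
    also have "\<dots> \<le> f' + card (prod.swap ` Sigma (B - B') (\<lambda>b. {a \<in> X. E b a}))"
      unfolding f'_def by (rule card_Un_le)
    also have "card (prod.swap ` Sigma (B - B') (\<lambda>b. {a \<in> X. E b a})) \<le> card (Sigma (B - B') (\<lambda>b. {a \<in> X. E b a}))"
      using fAB finite_X by (intro card_image_le) auto
    also have "\<dots> = (\<Sum>b\<in>B - B'. deg b)" using fAB finite_X by (simp add: deg_def)
    also have "\<dots> \<le> card (B - B') * s ^ Suc j"
      using sum_mono[of "B - B'" deg "\<lambda>_. s ^ Suc j"] by (auto simp: B_def)
    finally have fle: "f \<le> f' + card (B - B') * s ^ Suc j" by simp
    have "s * (2 * (card (B - B') * s ^ Suc j)) = 2 * s ^ 2 * card (B - B') * s ^ j"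
      by (simp add: power2_eq_square mult_ac)
    also have "\<dots> \<le> card B * s ^ j" using few by (rule mult_le_mono1)
    also have "\<dots> \<le> s * f" by (rule cB)
    finally have "2 * (card (B - B') * s ^ Suc j) \<le> f" using s0 by simp
    then show ?thesis using fle by linarith
  qed
  have f'0: "0 < f'" using ff' f0 by simp
  \<comment> \<open>The degree scales with slack: \<open>p\<close> must dominate \<open>K\<close>,
    and \<open>d \<le> s ^ (i + 2)\<close> turns \<open>4 * s ^ 2 * d\<close> into
    \<open>4 * s ^ (i + 4)\<close>.\<close>
  define p q where "p = 4 * s ^ (i + 4)" and "q = 4 * s ^ (j + 4)"
  have pq: "p \<le> q" unfolding p_def q_def using ij s0 by (intro mult_le_mono2 power_increasing) auto
  have Kp: "K \<le> p"
  proof -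
    have "K \<le> 4 * s ^ 2 * s ^ (i + 2)" unfolding K_def using di by (rule mult_le_mono2)
    also have "\<dots> = p" by (simp add: p_def power_add power2_eq_square power4_eq_xxxx mult_ac)
    finally show ?thesis .
  qed
  have ip: "s ^ Suc i \<le> p" "s ^ Suc j \<le> q"
  proof -
    have *: "s ^ Suc m \<le> 4 * s ^ (m + 4)" for m
    proof -
      have "s ^ Suc m \<le> s ^ (m + 4)" using s0 by (intro power_increasing) auto
      then show ?thesis by simp
    qed
    show "s ^ Suc i \<le> p" "s ^ Suc j \<le> q" unfolding p_def q_def by (rule *)+
  qed
  \<comment> \<open>Degree classes overlap only if they coincide, so a vertex on both sides has an
    unambiguous weight.\<close>
  have same: "p = q" if "v \<in> A" "v \<in> B'" for v
  proof -
    have v: "s ^ i \<le> deg v" "deg v < s ^ Suc i" "s ^ j \<le> deg v" "deg v < s ^ Suc j"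
      using that B'B by (auto simp: A_def B_def)
    have "s ^ i < s ^ Suc j" "s ^ j < s ^ Suc i" using v by linarith+
    then have "i < Suc j" "j < Suc i" using s(1) by (auto simp only: power_strict_increasing_iff)
    then have "i = j" by simp
    then show ?thesis by (simp add: p_def q_def)
  qed
  define U where "U = A \<union> B'"
  define w where "w v = (if v \<in> A then real p else real q)" for v
  define F where "F u v \<longleftrightarrow> E u v \<and> (u \<in> A \<and> v \<in> B' \<or> u \<in> B' \<and> v \<in> A)" for u v
  have wB: "w v = q" if "v \<in> B'" for v using same[OF _ that] by (auto simp: w_def)
  have wle: "w v \<le> q" for v using pq by (simp add: w_def)
  have UX: "U \<subseteq> X" using ABX B'X by (auto simp: U_def)
  have fU: "finite U" using UX finite_X finite_subset by blast
  have degU: "card (nb v \<inter> Y) \<le> deg v" if "Y \<subseteq> X" for v Y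
    unfolding deg_def using that finite_X by (intro card_mono) auto
  have degA: "deg v \<le> p" if "v \<in> A" for v using that ip by (auto simp: A_def)
  have degB: "deg v \<le> q" if "v \<in> B'" for v using that ip B'B by (auto simp: B_def)
  interpret weighted_graph V E l t F U w "2 * real p * real q"
  proof
    show "3 \<le> t" by (rule t_ge)
    show "U \<subseteq> V" using UX X_sub by blast
    show "F u v \<Longrightarrow> E u v" for u v by (simp add: F_def)
    show "F u v \<Longrightarrow> F v u" for u v using E_sym by (auto simp: F_def)
    show "real (card {v \<in> U. F u v}) \<le> w u" if "u \<in> U" for u
    proof -
      have "card {v \<in> U. F u v} \<le> card (nb u \<inter> U)" using fU by (intro card_mono) (auto simp: F_def)
      also have "\<dots> \<le> deg u" using UX by (rule degU)
      finally show ?thesis using that degA[of u] degB[of u] wB[of u] by (auto simp: U_def w_def)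
    qed
    show "sum w (nb v \<inter> U) \<le> 2 * real p * real q" if v: "v \<in> U" for v
    proof (cases "v \<in> A")
      case True
      have "sum w (nb v \<inter> U) \<le> (\<Sum>u\<in>nb v \<inter> U. real q)" using wle by (intro sum_mono)
      also have "\<dots> = card (nb v \<inter> U) * real q" by simp
      also have "\<dots> \<le> real p * real q"
        using degU[OF UX, of v] degA[OF True] by (intro mult_right_mono) auto
      also have "\<dots> \<le> 2 * real p * real q" by simp
      finally show ?thesis .
    next
      case False
      then have vB: "v \<in> B'" using v by (simp add: U_def)
      have "nb v \<inter> U = (nb v \<inter> A) \<union> (nb v \<inter> (B' - A))" by (auto simp: U_def)
      then have "sum w (nb v \<inter> U) = sum w (nb v \<inter> A) + sum w (nb v \<inter> (B' - A))"
        by (simp add: sum.union_disjoint disjoint_iff)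
      also have "sum w (nb v \<inter> A) = card (nb v \<inter> A) * real p" by (simp add: w_def)
      also have "\<dots> \<le> real q * real p"
        using degU[OF ABX(1), of v] degB[OF vB] by (intro mult_right_mono) auto
      also have "sum w (nb v \<inter> (B' - A)) \<le> (\<Sum>u\<in>nb v \<inter> (B' - A). real q)" using wle by (intro sum_mono)
      also have "\<dots> = card (nb v \<inter> (B' - A)) * real q" by simp
      also have "\<dots> \<le> real p * real q"
      proof (intro mult_right_mono)
        have "card (nb v \<inter> (B' - A)) \<le> card (nb v \<inter> B)" using B'B fAB by (intro card_mono) auto
        also have "\<dots> \<le> K" using vB by (simp add: B'_def)
        finally show "real (card (nb v \<inter> (B' - A))) \<le> real p" using Kp by simp
      qed simp
      finally show ?thesis by (simp add: mult_ac)
    qed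
    show "0 < 2 * real p * real q" using s0 by (simp add: p_def q_def)
  qed
  have dense: "1 / real s ^ 6 * sum w U < ec F U"
  proof -
    have "sum w (A \<union> B') + sum w (A \<inter> B') = sum w A + sum w B'"
      by (rule sum.union_inter[OF fAB(1) fB'])
    moreover have "0 \<le> sum w (A \<inter> B')" by (intro sum_nonneg) (simp add: w_def)
    moreover have "sum w A = real (card A * p)" by (simp add: w_def)
    moreover have "sum w B' = real (card B' * q)" using wB by simp
    ultimately have wU: "sum w U \<le> real (card A * p + card B' * q)" by (simp add: U_def)
    have 1: "card A * p \<le> 4 * s ^ 5 * f"
    proof -
      have "card A * p = 4 * s ^ 4 * (card A * s ^ i)" by (simp add: p_def power_add mult_ac)
      also have "\<dots> \<le> 4 * s ^ 4 * (s * f)" using cA by (rule mult_le_mono2)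
      also have "\<dots> = 4 * s ^ 5 * f" by (simp add: pw(1))
      finally show ?thesis .
    qed
    have 2: "card B' * q \<le> 4 * s ^ 5 * f"
    proof -
      have "card B' \<le> card B" using B'B fAB by (intro card_mono)
      then have "card B' * q \<le> card B * q" by (rule mult_le_mono1)
      also have "card B * q = 4 * s ^ 4 * (card B * s ^ j)" by (simp add: q_def power_add mult_ac)
      also have "\<dots> \<le> 4 * s ^ 4 * (s * f)" using cB by (rule mult_le_mono2)
      also have "\<dots> = 4 * s ^ 5 * f" by (simp add: pw(1))
      finally show ?thesis .
    qed
    have "card A * p + card B' * q \<le> 8 * s ^ 5 * f" using 1 2 by linarith
    also have "\<dots> \<le> 8 * s ^ 5 * (2 * f')" using ff' by (rule mult_le_mono2)
    also have "\<dots> = 16 * s ^ 5 * f'" by simp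
    also have "\<dots> < s ^ 6 * f'"
    proof -
      have "16 * s ^ 5 < s * s ^ 5" using s(1) by simp
      also have "s * s ^ 5 = s ^ 6" using pw(2) by simp
      finally have "16 * s ^ 5 < s ^ 6" .
      then show ?thesis using f'0 by simp
    qed
    also have "s ^ 6 * f' \<le> s ^ 6 * ec F U"
    proof (rule mult_le_mono2)
      have "{(a, b) \<in> A \<times> B'. E a b} \<subseteq> {(u, v) \<in> U \<times> U. F u v}" by (auto simp: F_def U_def)
      then show "f' \<le> ec F U" unfolding f'_def ec_def by (rule card_mono[OF finite_ec_set[OF fU]])
    qed
    finally have "real (card A * p + card B' * q) < real (s ^ 6 * ec F U)" by (simp only: of_nat_less_iff)
    then have "sum w U < real s ^ 6 * real (ec F U)" using wU by simp
    then show ?thesis using s0 by (simp add: field_simps)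
  qed
  \<comment> \<open>A dense \<open>D\<close> that is too light gives a dense pair \<open>a\<close>,
    \<open>b\<close>. Density forces \<open>p \<le> 32 * s ^ 6 * card b\<close> and
    \<open>q \<le> 32 * s ^ 6 * card a\<close>, while lightness bounds \<open>card b\<close> by
    \<open>2 * p * s ^ 8\<close>; combined with \<open>card a * p < 32 * s ^ 6 * g\<close> this is
    density \<open>1 / h\<close>.\<close>
  have big: "2 * real p * real q * real s ^ 8 \<le> sum w D"
    if D: "D \<subseteq> U" "1 / real s ^ 6 / 16 * sum w D < ec F D" for D
  proof (rule ccontr)
    assume "\<not> ?thesis"
    then have small: "sum w D < 2 * real p * real q * real s ^ 8" by simp
    define a where "a = D \<inter> A"
    define b where "b = D \<inter> B'"
    define g where "g = card {(x, y) \<in> a \<times> b. E x y}"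
    have fD: "finite D" using D fU finite_subset by blast
    have fab: "finite a" "finite b" using fD by (auto simp: a_def b_def)
    have "{(u, v) \<in> D \<times> D. F u v} \<subseteq> {(x, y) \<in> a \<times> b. E x y} \<union> prod.swap ` {(x, y) \<in> a \<times> b. E x y}"
      using E_sym by (auto simp: F_def a_def b_def image_iff)
    then have "ec F D \<le> card ({(x, y) \<in> a \<times> b. E x y} \<union> prod.swap ` {(x, y) \<in> a \<times> b. E x y})"
      unfolding ec_def using fab by (intro card_mono finite_UnI finite_related_pairs finite_imageI)
    also have "\<dots> \<le> g + card (prod.swap ` {(x, y) \<in> a \<times> b. E x y})" unfolding g_def by (rule card_Un_le)
    also have "card (prod.swap ` {(x, y) \<in> a \<times> b. E x y}) = g" unfolding g_def by (rule card_image) simp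
    finally have eg: "ec F D \<le> 2 * g" by simp
    then have "real (ec F D) \<le> 2 * real g" by linarith
    then have "1 / real s ^ 6 / 16 * sum w D < 2 * real g" using D(2) by linarith
    then have wg: "sum w D < 32 * real s ^ 6 * real g" using s0 by (simp add: field_simps)
    have wnn: "0 \<le> w v" for v by (simp add: w_def)
    have "sum w a \<le> sum w D" using fD wnn by (intro sum_mono2) (auto simp: a_def)
    moreover have "sum w a = real (card a * p)" by (simp add: a_def w_def)
    ultimately have ap: "real (card a * p) \<le> sum w D" by simp
    have "sum w b \<le> sum w D" using fD wnn by (intro sum_mono2) (auto simp: b_def)
    moreover have "sum w b = real (card b * q)" using wB by (simp add: b_def)
    ultimately have bq: "real (card b * q) \<le> sum w D" by simp
    have 1: "card a * p < 32 * s ^ 6 * g" "card b * q < 32 * s ^ 6 * g"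
    proof -
      have "real (card a * p) < real (32 * s ^ 6 * g)" "real (card b * q) < real (32 * s ^ 6 * g)"
        using ap bq wg by auto
      then show "card a * p < 32 * s ^ 6 * g" "card b * q < 32 * s ^ 6 * g" by (simp_all only: of_nat_less_iff)
    qed
    have 2: "card b * q < 2 * p * q * s ^ 8"
    proof -
      have "real (card b * q) < real (2 * p * q * s ^ 8)" using bq small by auto
      then show ?thesis by (simp only: of_nat_less_iff)
    qed
    have p0: "0 < p" "0 < q" using s0 by (auto simp: p_def q_def)
    have "q * card b < q * (2 * p * s ^ 8)" using 2 by (simp add: mult_ac)
    then have cb: "card b < 2 * p * s ^ 8" by simp
    have gab: "g \<le> card a * card b"
      unfolding g_def using fab card_mono[of "a \<times> b" "{(x, y) \<in> a \<times> b. E x y}"]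
      by (auto simp: card_cartesian_product)
    have g0: "0 < g" using 1(1) by (cases g) auto
    have a0: "0 < card a" "0 < card b" using gab g0 by (auto intro: gr0I)
    have sb: "p \<le> 32 * s ^ 6 * card b"
    proof -
      have "card a * p < 32 * s ^ 6 * (card a * card b)" using 1(1) gab by (meson mult_le_mono2 order_less_le_trans)
      then have "card a * p < card a * (32 * s ^ 6 * card b)" by (simp add: mult_ac)
      then show ?thesis by simp
    qed
    have sa: "q \<le> 32 * s ^ 6 * card a"
    proof -
      have "card b * q < 32 * s ^ 6 * (card a * card b)" using 1(2) gab by (meson mult_le_mono2 order_less_le_trans)
      then have "card b * q < card b * (32 * s ^ 6 * card a)" by (simp add: mult_ac)
      then show ?thesis by simp
    qed
    define h where "h = 64 * s ^ 14"
    have dens: "card a * card b \<le> h * g"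
    proof -
      have "card a * card b * p \<le> card a * p * (2 * p * s ^ 8)"
      proof -
        have "card a * p * card b \<le> card a * p * (2 * p * s ^ 8)" using cb by (intro mult_le_mono2) simp
        then show ?thesis by (simp add: mult_ac)
      qed
      also have "\<dots> \<le> 32 * s ^ 6 * g * (2 * p * s ^ 8)" using 1(1) by (intro mult_le_mono1) simp
      also have "\<dots> = h * g * p" unfolding h_def pw(3) by (simp only: mult_ac)
      finally show ?thesis using p0 by simp
    qed
    have hs: "(8 * t * l * h) ^ e * (8 * s ^ 4) \<le> d"
    proof -
      have "h \<le> s * s ^ 14" using s(1) by (simp add: h_def)
      also have "s * s ^ 14 = s ^ 15" using pw(4) by simp
      finally have "8 * t * l * h \<le> s * s ^ 15" using s(5) by (intro mult_le_mono)
      also have "s * s ^ 15 = s ^ 16" using pw(5) by simp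
      finally have "8 * t * l * h \<le> s ^ 16" .
      then have "(8 * t * l * h) ^ e \<le> (s ^ 16) ^ e" by (rule power_mono) simp
      also have "(s ^ 16) ^ e = s ^ (16 * e)" by (simp only: power_mult)
      finally have "(8 * t * l * h) ^ e * (8 * s ^ 4) \<le> s ^ (16 * e) * (s * s ^ 4)"
        using s(1) by (intro mult_le_mono) auto
      also have "\<dots> = d" using pw(1) by (simp add: d N power_add)
      finally show ?thesis .
    qed
    have size: "(8 * t * l * h) ^ e \<le> c" if "4 * s ^ (m + 4) \<le> 32 * s ^ 6 * c" "i \<le> m" for c m
    proof -
      have "s ^ (i + 2) \<le> s ^ (m + 2)" using that s0 by (intro power_increasing) auto
      then have "d \<le> s ^ (m + 2)" using di by linarith
      then have "(8 * t * l * h) ^ e * (8 * s ^ 4) \<le> s ^ (m + 2)" using hs by linarith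
      then have "4 * s ^ 2 * ((8 * t * l * h) ^ e * (8 * s ^ 4)) \<le> 4 * s ^ 2 * s ^ (m + 2)" by (rule mult_le_mono2)
      also have "\<dots> = 4 * s ^ (m + 4)" by (simp add: power_add power2_eq_square power4_eq_xxxx)
      also note that(1)
      also have "4 * s ^ 2 * ((8 * t * l * h) ^ e * (8 * s ^ 4)) = 32 * s ^ 6 * (8 * t * l * h) ^ e"
        unfolding pw(6) by (simp only: mult_ac)
      finally have "32 * s ^ 6 * (8 * t * l * h) ^ e \<le> 32 * s ^ 6 * c" .
      then show ?thesis by (rule mult_left_le_imp_le) (use s0 in simp)
    qed
    have h0: "0 < h" using s0 by (simp add: h_def)
    show False
    proof (rule no_dense_pair[of a b h t])
      show "a \<subseteq> V" "b \<subseteq> V" using UX X_sub D(1) by (auto simp: a_def b_def)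
      show "card a * card b \<le> h * card {(x, y) \<in> a \<times> b. E x y}" using dens by (simp add: g_def)
      show "(8 * t * l * h) ^ (t * t + 2 * t + 5) \<le> card a"
        using size[of j "card a"] sa ij by (simp add: q_def flip: e)
      show "(8 * t * l * h) ^ (t * t + 2 * t + 5) \<le> card b"
        using size[of i "card b"] sb by (simp add: p_def flip: e)
    qed (use h0 t_ge in auto)
  qed
  define m where "m = (8 * t * l * t) ^ (t * t + 2 * t + 5)"
  have "32 * m * t \<le> s ^ 2"
  proof -
    have "m * (32 * t) \<le> s * s" using s(3,4) by (intro mult_le_mono) (auto simp: m_def e)
    then show ?thesis by (simp add: power2_eq_square mult_ac)
  qed
  then have "real (32 * m * t) \<le> real (s ^ 2)" by (simp only: of_nat_le_iff)
  moreover have "1 / real s ^ 6 * real s ^ 8 = real s ^ 2"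
    using s0 by (simp add: power_diff[symmetric] divide_simps flip: power_add)
  ultimately have H: "32 * real m * t \<le> 1 / real s ^ 6 * real s ^ 8" by simp
  have k: "0 < 1 / real s ^ 6" using s0 by simp
  show False
    by (rule no_dense_weighted[OF dense k big t_ge _ m_def H]) simp_all
qed

end

section \<open>Combination of the cases and choice of the exponent\<close>

lemma (in thin_graph) no_min_degree_subset:
  assumes t: "3 \<le> t" and X: "X \<subseteq> V" "X \<noteq> {}" and deg: "\<And>x. x \<in> X \<Longrightarrow> s ^ N \<le> card {y \<in> X. E x y}"
    and N: "N = 16 * e + 5" and e: "e = t * t + 2 * t + 5"
    and s: "64 \<le> s" "8 * (4 * N) * (4 * N) \<le> s" "32 * t \<le> s" "(8 * t * l * t) ^ e \<le> s"
      "8 * t * l * (16 * (544 * t + 4)) \<le> s"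
  shows False
proof -
  define d where "d = s ^ N"
  have fX: "finite X" using X finite_V finite_subset by blast
  have "64 ^ 3 \<le> s ^ 3" using s(1) by (rule power_mono) simp
  also have "\<dots> \<le> d" unfolding d_def using s(1) N by (intro power_increasing) auto
  finally have d: "8192 \<le> d" by simp
  have "d * card X = (\<Sum>x\<in>X. d)" by simp
  also have "\<dots> \<le> (\<Sum>x\<in>X. card {y \<in> X. E x y})" using deg by (intro sum_mono) (simp add: d_def)
  also have "\<dots> = ec E X" using fX by (simp add: ec_altdef)
  finally have dense: "d * card X \<le> ec E X" .
  have "2 \<le> d" using d by simp
  then obtain Y where Y: "Y \<subseteq> X" "Y \<noteq> {}" "d * card Y \<le> ec E Y" "sparse (2 * d) Y"
    using critical_subset[OF fX X(2) _ dense] by blast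
  interpret critical_graph V E l t Y d
    by unfold_locales (use t X Y d in auto)
  have "s ^ e * 8 \<le> s ^ e * s" using s(1) by (intro mult_le_mono2) simp
  also have "\<dots> = s ^ (e + 1)" by simp
  also have "\<dots> \<le> d" unfolding d_def using s(1) N by (intro power_increasing) auto
  finally have "s ^ e \<le> d div 8" by linarith
  moreover have "(8 * t * l * (16 * (544 * t + 4))) ^ e \<le> s ^ e" using s(5) by (rule power_mono) simp
  ultimately have "4 * cross < d * card Y" using no_heavy_cross by (simp flip: e)
  moreover have "8 * t * l \<le> s"
  proof -
    have "8 * t * l * 1 \<le> 8 * t * l * (16 * (544 * t + 4))" by (intro mult_le_mono2) simp
    then show ?thesis using s(5) by linarith
  qed
  then have "4 * ec E Lo < d * card Y" using no_light[OF d_def N e s(1-4)] by blast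
  ultimately show False using cases_Lo_Hi by linarith
qed

text \<open>Each left-hand side is a constant times a factor of at most \<open>l ^ e\<close>.
  \<open>C\<close> collects the constants, and \<open>C \<le> 2 ^ C \<le> l ^ C\<close> for
  \<open>2 \<le> l\<close>.\<close>

lemma exponent_exists:
  fixes t e N :: nat
  assumes "1 \<le> t" "1 \<le> e"
  shows "\<exists>a\<ge>1. \<forall>l\<ge>2. 64 \<le> l ^ a \<and> 8 * (4 * N) * (4 * N) \<le> l ^ a \<and> 32 * t \<le> l ^ a \<and>
    (8 * t * l * t) ^ e \<le> l ^ a \<and> 8 * t * l * (16 * (544 * t + 4)) \<le> l ^ a"
proof -
  define C where "C = 64 + 8 * (4 * N) * (4 * N) + 32 * t + (8 * t * t) ^ e + 8 * t * (16 * (544 * t + 4))"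
  have "64 \<le> l ^ (C + e) \<and> 8 * (4 * N) * (4 * N) \<le> l ^ (C + e) \<and> 32 * t \<le> l ^ (C + e) \<and>
    (8 * t * l * t) ^ e \<le> l ^ (C + e) \<and> 8 * t * l * (16 * (544 * t + 4)) \<le> l ^ (C + e)" if l: "2 \<le> l" for l :: nat
  proof -
    have "C \<le> 2 ^ C" by simp
    also have "(2::nat) ^ C \<le> l ^ C" using l by (rule power_mono) simp
    finally have C: "C \<le> l ^ C" .
    have big: "c * b \<le> l ^ (C + e)" if "c \<le> C" "b \<le> l ^ e" for c b
      unfolding power_add using that C by (intro mult_le_mono) auto
    have le: "1 \<le> l ^ e" "l \<le> l ^ e" using assms(2) l by (simp_all add: self_le_power)
    have "(8 * t * l * t) ^ e = (8 * t * t) ^ e * l ^ e"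
      by (simp add: power_mult_distrib[symmetric] mult_ac)
    also have "\<dots> \<le> l ^ (C + e)" by (rule big) (simp_all add: C_def)
    finally have 1: "(8 * t * l * t) ^ e \<le> l ^ (C + e)" .
    have "8 * t * l * (16 * (544 * t + 4)) = 8 * t * (16 * (544 * t + 4)) * l" by simp
    also have "\<dots> \<le> l ^ (C + e)" by (rule big[OF _ le(2)]) (simp add: C_def)
    finally have 2: "8 * t * l * (16 * (544 * t + 4)) \<le> l ^ (C + e)" .
    have 3: "c \<le> l ^ (C + e)" if "c \<le> C" for c using big[OF that le(1)] by simp
    show ?thesis by (intro conjI 1 2 3) (simp_all add: C_def)
  qed
  then show ?thesis using assms(2) by (intro exI[of _ "C + e"]) auto
qed

section \<open>Transfer to the graphs of the library\<close>

text \<open>Keeping just the arcs whose ends are related realises a symmetric relation as a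
  subgraph; bicliques and holes are both obtained this way.\<close>

lemma subgraph_of_relation:
  assumes G: "graph G" and S: "S \<subseteq> verts G" and R: "R \<subseteq> arcs_ends G" "R \<subseteq> S \<times> S" "sym R"
  defines "H \<equiv> \<lparr>verts = S, arcs = {e \<in> arcs G. (tail G e, head G e) \<in> R}, tail = tail G, head = head G\<rparr>"
  shows "graph H" "subgraph H G" "arcs_ends H = R"
proof -
  interpret graph G by (rule G)
  show ends: "arcs_ends H = R" using R(1) by (auto simp: H_def arcs_ends_conv)
  interpret H: wf_digraph H by unfold_locales (use R(2) in \<open>auto simp: H_def\<close>)
  show "subgraph H G"
    using S by (auto simp: subgraph_def compatible_def H_def wf_digraph_axioms H.wf_digraph_axioms[unfolded H_def])
  show "graph H"
  proof unfold_locales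
    show "finite (verts H)" "finite (arcs H)" using S finite_subset[OF S] by (auto simp: H_def)
    show "tail H e \<noteq> head H e" if "e \<in> arcs H" for e using that no_loops by (auto simp: H_def)
    show "e1 = e2" if "e1 \<in> arcs H" "e2 \<in> arcs H" "arc_to_ends H e1 = arc_to_ends H e2" for e1 e2
      using that no_multi_arcs[of e1 e2] by (auto simp: H_def arc_to_ends_def)
    show "symmetric H" using R(3) by (simp add: symmetric_def ends)
  qed
qed

lemma biclique_subgraph:
  assumes G: "graph G" and XY: "X \<subseteq> verts G" "Y \<subseteq> verts G" "card X = l" "card Y = l"
    and adj: "\<And>x y. x \<in> X \<Longrightarrow> y \<in> Y \<Longrightarrow> (x, y) \<in> arcs_ends G"
  shows "\<exists>H. subgraph H G \<and> K\<^bsub>l,l\<^esub> H"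
proof -
  interpret graph G by (rule G)
  have disj: "X \<inter> Y = {}" using adj adj_not_same by blast
  have R: "X \<times> Y \<union> Y \<times> X \<subseteq> arcs_ends G" using adj arcs_ends_symmetric[OF sym_arcs] by blast
  let ?H = "\<lparr>verts = X \<union> Y, arcs = {e \<in> arcs G. (tail G e, head G e) \<in> X \<times> Y \<union> Y \<times> X}, tail = tail G, head = head G\<rparr>"
  have S: "X \<union> Y \<subseteq> verts G" "X \<times> Y \<union> Y \<times> X \<subseteq> (X \<union> Y) \<times> (X \<union> Y)" "sym (X \<times> Y \<union> Y \<times> X)"
    using XY by (auto simp: sym_def)
  note * = subgraph_of_relation[OF G S(1) R S(2,3)]
  have "K\<^bsub>l,l\<^esub> ?H"
    unfolding complete_bipartite_digraph_def using * disj XY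
    by (intro conjI exI[of _ X] exI[of _ Y]) auto
  then show ?thesis using *(2) by blast
qed

lemma cycle_induced_subgraph:
  assumes G: "graph G" and c: "ind_cycle (\<lambda>u v. (u, v) \<in> arcs_ends G) c n"
  shows "\<exists>H. induced_subgraph H G \<and> cycle_graph n H"
proof -
  interpret graph G by (rule G)
  have n: "3 \<le> n" and inj: "inj_on c {..<n}"
    and adj: "\<And>i j. i < n \<Longrightarrow> j < n \<Longrightarrow> (c i, c j) \<in> arcs_ends G \<longleftrightarrow> j = Suc i mod n \<or> i = Suc j mod n"
    using c by (auto simp: ind_cycle_def)
  have m: "Suc i mod n < n" for i using n by simp
  define S where "S = c ` {..<n}"
  define R where "R = arcs_ends G \<inter> S \<times> S"
  let ?H = "\<lparr>verts = S, arcs = {e \<in> arcs G. (tail G e, head G e) \<in> R}, tail = tail G, head = head G\<rparr>"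
  have "c i \<in> verts G" if "i < n" for i
    using adj[OF that m[of i]] adj_in_verts by blast
  then have S: "S \<subseteq> verts G" by (auto simp: S_def)
  have R: "R \<subseteq> arcs_ends G" "R \<subseteq> S \<times> S" "sym R"
    using arcs_ends_symmetric[OF sym_arcs] by (auto simp: R_def sym_def)
  note * = subgraph_of_relation[OF G S R]
  have "R = (\<Union>i<n. {(c i, c (Suc i mod n)), (c (Suc i mod n), c i)})"
  proof (intro equalityI subsetI)
    fix p assume "p \<in> R"
    then obtain i j where p: "p = (c i, c j)" "i < n" "j < n" "(c i, c j) \<in> arcs_ends G"
      by (auto simp: R_def S_def)
    then show "p \<in> (\<Union>i<n. {(c i, c (Suc i mod n)), (c (Suc i mod n), c i)})"
      using adj[of i j] by auto
  next
    fix p assume "p \<in> (\<Union>i<n. {(c i, c (Suc i mod n)), (c (Suc i mod n), c i)})"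
    then obtain i where "i < n" "p = (c i, c (Suc i mod n)) \<or> p = (c (Suc i mod n), c i)" by auto
    then show "p \<in> R" using adj[of i "Suc i mod n"] adj[of "Suc i mod n" i] m[of i] by (auto simp: R_def S_def)
  qed
  then have "cycle_graph n ?H"
    unfolding cycle_graph_def using *(1,3) n inj
    by (intro conjI exI[of _ c]) (auto simp: S_def bij_betw_def)
  moreover have "induced_subgraph ?H G"
    unfolding induced_subgraph_def using *(2) by (auto simp: R_def arcs_ends_conv)
  ultimately show ?thesis by blast
qed

lemma out_degree_induced:
  assumes G: "graph G" and H: "induced_subgraph H G" and v: "v \<in> verts H"
  shows "out_degree H v = card {y \<in> verts H. (v, y) \<in> arcs_ends G}"
proof -
  interpret graph G by (rule G)
  have H': "arcs H = {e \<in> arcs G. tail G e \<in> verts H \<and> head G e \<in> verts H}" "tail H = tail G"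
    using H by (auto simp: induced_subgraph_def subgraph_def compatible_def)
  have "{y \<in> verts H. (v, y) \<in> arcs_ends G} = head G ` out_arcs H v"
    using v by (auto simp: out_arcs_def H' arcs_ends_conv image_iff)
  moreover have "inj_on (head G) (out_arcs H v)"
    by (rule inj_onI) (auto simp: out_arcs_def H' arc_to_ends_def intro!: no_multi_arcs)
  ultimately show ?thesis by (simp add: out_degree_def card_image)
qed

theorem theorem4:
  shows "\<exists>f :: nat \<Rightarrow> nat. (\<forall>t\<ge>1. 1 \<le> f t) \<and>
    (\<forall>t\<ge>1. \<forall>l\<ge>1. \<forall>G :: ('a, 'b) pre_digraph.
      graph G \<and> long_cycle_free t G \<and> \<not> (\<exists>H. subgraph H G \<and> K\<^bsub>l,l\<^esub> H)
      \<longrightarrow> degeneracy G \<le> l ^ f t)"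
proof -
  define e N :: "nat \<Rightarrow> nat" where "e t = t * t + 2 * t + 5" and "N t = 16 * e t + 5" for t
  have "\<forall>t. \<exists>a\<ge>1. \<forall>l\<ge>2. 3 \<le> t \<longrightarrow> 64 \<le> l ^ a \<and> 8 * (4 * N t) * (4 * N t) \<le> l ^ a \<and> 32 * t \<le> l ^ a \<and>
    (8 * t * l * t) ^ e t \<le> l ^ a \<and> 8 * t * l * (16 * (544 * t + 4)) \<le> l ^ a"
  proof
    fix t
    show "\<exists>a\<ge>1. \<forall>l\<ge>2. 3 \<le> t \<longrightarrow> 64 \<le> l ^ a \<and> 8 * (4 * N t) * (4 * N t) \<le> l ^ a \<and> 32 * t \<le> l ^ a \<and>
      (8 * t * l * t) ^ e t \<le> l ^ a \<and> 8 * t * l * (16 * (544 * t + 4)) \<le> l ^ a"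
    proof (cases "3 \<le> t")
      case True
      then show ?thesis using exponent_exists[of t "e t" "N t"] by (simp add: e_def)
    qed auto
  qed
  then obtain a where a: "\<And>t. 1 \<le> a t" "\<And>t l. 3 \<le> t \<Longrightarrow> 2 \<le> l \<Longrightarrow> 64 \<le> l ^ a t \<and>
    8 * (4 * N t) * (4 * N t) \<le> l ^ a t \<and> 32 * t \<le> l ^ a t \<and> (8 * t * l * t) ^ e t \<le> l ^ a t \<and>
    8 * t * l * (16 * (544 * t + 4)) \<le> l ^ a t"
    by metis
  \<comment> \<open>A hole has at least three vertices, so smaller values of \<open>t\<close> are
    replaced by \<open>3\<close>.\<close>
  define f where "f t = a (max t 3) * N (max t 3)" for t
  have "1 \<le> f t" for t using a(1)[of "max t 3"] by (simp add: f_def N_def)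
  moreover have "degeneracy G \<le> l ^ f t"
    if l: "1 \<le> l" and G: "graph G" "long_cycle_free t G" "\<not> (\<exists>H. subgraph H G \<and> K\<^bsub>l,l\<^esub> H)"
    for t l and G :: "('a, 'b) pre_digraph"
  proof -
    interpret graph G by (rule G(1))
    have "degenerate (l ^ f t) G"
      unfolding degenerate_def
    proof (intro allI impI, rule ccontr)
      fix H assume H: "induced_subgraph H G \<and> verts H \<noteq> {}"
        and "\<not> (\<exists>v\<in>verts H. out_degree H v \<le> l ^ f t)"
      then have deg: "l ^ f t < card {y \<in> verts H. (v, y) \<in> arcs_ends G}" if "v \<in> verts H" for v
        using that out_degree_induced[OF G(1), of H v] by force
      have HV: "verts H \<subseteq> verts G" using H by (auto simp: induced_subgraph_def subgraph_def)
      show False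
      proof (cases "l = 1")
        \<comment> \<open>Powers of \<open>1\<close> absorb no constants, but here the excluded
          biclique is a single edge, which a vertex of positive degree provides.\<close>
        case True
        obtain v where "v \<in> verts H" using H by blast
        then have "0 < card {y \<in> verts H. (v, y) \<in> arcs_ends G}" using deg[of v] by linarith
        then have "{y \<in> verts H. (v, y) \<in> arcs_ends G} \<noteq> {}" by (metis card.empty less_irrefl)
        then obtain y where "(v, y) \<in> arcs_ends G" by blast
        then show False
          using biclique_subgraph[OF G(1), of "{v}" "{y}" l] True G(3) adj_in_verts by auto
      next
        case False
        define T where "T = max t 3"
        interpret thin_graph "verts G" "\<lambda>u v. (u, v) \<in> arcs_ends G" l T
        proof
          show "\<exists>x\<in>X. \<exists>y\<in>Y. (x, y) \<notin> arcs_ends G"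
            if "X \<subseteq> verts G" "Y \<subseteq> verts G" "card X = l" "card Y = l" for X Y
            using biclique_subgraph[OF G(1) that] G(3) by blast
          show "n < T" if "ind_cycle (\<lambda>u v. (u, v) \<in> arcs_ends G) c n" for c n
          proof -
            have "\<not> t \<le> n"
              using cycle_induced_subgraph[OF G(1) that] G(2) unfolding long_cycle_free_def by blast
            then show ?thesis by (simp add: T_def)
          qed
        qed (use l False adj_not_same adj_in_verts arcs_ends_symmetric[OF sym_arcs] in auto)
        have T3: "3 \<le> T" by (simp add: T_def)
        have "l ^ f t = (l ^ a T) ^ N T" by (simp add: f_def T_def power_mult)
        then have "(l ^ a T) ^ N T \<le> card {y \<in> verts H. (v, y) \<in> arcs_ends G}" if "v \<in> verts H" for v
          using deg[OF that] by simp
        moreover have "2 \<le> l" using l False by simp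
        ultimately show False
          using no_min_degree_subset[OF T3 HV, of "l ^ a T" "N T" "e T"] H a(2)[OF T3, of l] N_def e_def
          by blast
      qed
    qed
    then show ?thesis using degeneracy_le_iff[OF fin_digraph_axioms] by blast
  qed
  ultimately show ?thesis by blast
qed

end
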